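(* For any $\mathbb J$ and $X$, the following inclusions hold and are strict: $$\mathcal{TE}_{ub}\subset\mathcal E_{ub}\subset\mathcal M\mathcal E_{ub}\subset\mathcal E\subset\mathcal M^2\mathcal E_{ub}\subset\mathcal M\mathcal E\subset\mathcal M^3\mathcal E_{ub}\subset\cdots\subset\mathcal M^n\mathcal E\subset\mathcal M^{n+2}\mathcal E_{ub}\subset\cdots$$ and, for $\mathbb J=\mathbb R$, all these classes are strictly contained in $\mathcal D'_{\mathcal E_{ub}}(\mathbb R,X)=\mathcal D'_{\mathcal E}(\mathbb R,X)$. These relations also hold if $\mathcal E$ is replaced everywhere by $\mathcal E_0$, by $\mathcal{TE}_0$ or by $\mathcal{TE}$ (with $\mathcal E_{ub}$ replaced by the intersection of the new class with $C_{ub}$; the first inclusion $\mathcal{TE}_{ub}\subset\mathcal E_{ub}$ becoming $\mathcal{TE}_{0,ub}\subset\mathcal E_{0,ub}$ for $\mathcal E_0$ and being void for $\mathcal{TE}_0$ and $\mathcal{TE}$). Furthermore $C_{ub}(\mathbb R,X)\cap\mathcal D'_{\mathcal{TE}}(\mathbb R,X)=\mathcal{TE}_{ub}(\mathbb R,X)$ and $C_{ub}(\mathbb R,X)\cap\mathcal D'_{\mathcal{TE}_0}(\mathbb R,X)=\mathcal{TE}_0(\mathbb R,X)\cap C_{ub}(\mathbb R,X)$; but $\mathcal E_{ub}\not\subset\bigcup_{n=0}^\infty\mathcal M^n\mathcal{TE}=\bigcup_{n=0}^\infty\mathcal M^n\mathcal{TE}_{ub}$.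
   Context: $X\ne\{0\}$ is a complex Banach space; $\mathbb J$ is an interval of the form $\mathbb R$, $(\alpha,\infty)$ or $[\alpha,\infty)$, $\alpha\in\mathbb R$; all classes are classes of functions $\mathbb J\to X$ unless indicated. $C_{ub}(\mathbb J,X)$: bounded uniformly continuous functions. $\mathcal E(\mathbb J,X)$ (ergodic functions): all $\phi\in L^1_{loc}(\mathbb J,X)$ for which there is $m(\phi)\in X$ with $\sup_{x\in\mathbb J}\left\|\frac1T\int_0^T\phi(x+s)\,ds-m(\phi)\right\|\to0$ as $T\to\infty$. $\mathcal E_0=\{\phi\in\mathcal E:m(\phi)=0\}$. With $\gamma_\omega(t)=e^{i\omega t}$: $\mathcal{TE}=\{\phi\in L^1_{loc}:\gamma_\omega\phi\in\mathcal E\ \forall\omega\in\mathbb R\}$, $\mathcal{TE}_0=\{\phi\in\mathcal{TE}:\gamma_\omega\phi\in\mathcal E_0\ \forall\omega\in\mathbb R\}$. $\mathcal E_{ub}=\mathcal E\cap C_{ub}$, $\mathcal E_{0,ub}=\mathcal E_0\cap C_{ub}$, $\mathcal{TE}_{ub}=\mathcal{TE}\cap C_{ub}$, $\mathcal{TE}_{0,ub}=\mathcal{TE}_0\cap C_{ub}$. $M_hf(t)=\frac1h\int_0^hf(t+s)\,ds$; $\mathcal M\mathcal A=\{f\in L^1_{loc}(\mathbb J,X):M_hf\in\mathcal A\ \forall h>0\}$, $\mathcal M^0\mathcal A=\mathcal A$, $\mathcal M^n\mathcal A=\mathcal M(\mathcal M^{n-1}\mathcal A)$. $\mathcal D'(\mathbb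 R,X)$: linear continuous maps from the Schwartz test functions $\mathcal D(\mathbb R,\mathbb C)$ to $X$, locally integrable functions being identified with the distributions they define; $\mathcal D'_{\mathcal A}(\mathbb R,X)=\{T\in\mathcal D'(\mathbb R,X):T*\varphi\in\mathcal A\ \forall\varphi\in\mathcal D(\mathbb R,\mathbb C)\}$, $(T*\varphi)(x)=T(y\mapsto\varphi(x-y))$. *)

theory Defs
  imports "HOL-Analysis.Analysis" "HOL-Library.FuncSet"
begin

class complex_banach = banach +
  fixes scaleC :: "complex \<Rightarrow> 'a \<Rightarrow> 'a"  (infixr \<open>*\<^sub>C\<close> 75)
  assumes scaleC_add_right: "c *\<^sub>C (x + y) = c *\<^sub>C x + c *\<^sub>C y"
    and scaleC_add_left: "(c + d) *\<^sub>C x = c *\<^sub>C x + d *\<^sub>C x"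
    and scaleC_scaleC: "c *\<^sub>C d *\<^sub>C x = (c * d) *\<^sub>C x"
    and scaleC_of_real: "complex_of_real r *\<^sub>C x = r *\<^sub>R x"
    and norm_scaleC: "norm (c *\<^sub>C x) = cmod c * norm x"

instantiation complex :: complex_banach
begin

definition scaleC_complex :: "complex \<Rightarrow> complex \<Rightarrow> complex" where
  "scaleC_complex c z = c * z"

instance
  by standard (simp_all add: scaleC_complex_def algebra_simps norm_mult scaleR_conv_of_real)

end

text \<open>
  The library's \<open>has_bochner_integral\<close> is restricted to second countable ranges.  The definitions
  below are the same, except that Borel measurability is replaced by strong measurability, as is
  necessary for non-separable ranges.  They are only used for complete measures
  (Lebesgue measure and its restrictions to compact sets).
\<close>

definition strongly_measurable :: "'m measure \<Rightarrow> ('m \<Rightarrow> 'a::real_normed_vector) \<Rightarrow> bool" where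
  "strongly_measurable M f \<longleftrightarrow>
     (\<exists>s. (\<forall>i::nat. simple_function M (s i)) \<and> (AE x in M. (\<lambda>i. s i x) \<longlonglongrightarrow> f x))"

definition has_bochner :: "'m measure \<Rightarrow> ('m \<Rightarrow> 'a::real_normed_vector) \<Rightarrow> 'a \<Rightarrow> bool" where
  "has_bochner M f v \<longleftrightarrow> strongly_measurable M f \<and>
     (\<exists>s. (\<forall>i::nat. Bochner_Integration.simple_bochner_integrable M (s i)) \<and>
          (\<lambda>i. \<integral>\<^sup>+x. ennreal (norm (f x - s i x)) \<partial>M) \<longlonglongrightarrow> 0 \<and>
          (\<lambda>i. Bochner_Integration.simple_bochner_integral M (s i)) \<longlonglongrightarrow> v)"

definition bochner_integrable :: "'m measure \<Rightarrow> ('m \<Rightarrow> 'a::real_normed_vector) \<Rightarrow> bool" where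
  "bochner_integrable M f \<longleftrightarrow> (\<exists>v. has_bochner M f v)"

definition bochner_integral :: "'m measure \<Rightarrow> ('m \<Rightarrow> 'a::real_normed_vector) \<Rightarrow> 'a" where
  "bochner_integral M f = (if bochner_integrable M f then THE v. has_bochner M f v else 0)"

text \<open>
  Functions \<open>J \<rightarrow> X\<close> are represented by total functions on the reals; no definition below depends on
  values outside \<open>J\<close>.  Elements of \<open>L\<^sup>1\<^sub>l\<^sub>o\<^sub>c\<close> are classes modulo equality almost everywhere on \<open>J\<close>.
  Every class of functions is represented by the set of all representatives of its members.
  Hence \<open>C_ub\<close> consists of the functions having a bounded uniformly continuous representative, and
  inclusions, equalities and strict inclusions between the sets are those between the classes:
  strictness is not witnessed by a change on a null set.
\<close>

definition L1loc :: "real set \<Rightarrow> (real \<Rightarrow> 'a::complex_banach) set" where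
  "L1loc J = {f. \<forall>K. compact K \<and> K \<subseteq> J \<longrightarrow> bochner_integrable (lebesgue_on K) f}"

definition C_ub :: "real set \<Rightarrow> (real \<Rightarrow> 'a::complex_banach) set" where
  "C_ub J = {f. \<exists>g. bounded (g ` J) \<and> uniformly_continuous_on J g \<and>
                    (AE t in lebesgue_on J. f t = g t)}"

definition M_avg :: "real \<Rightarrow> (real \<Rightarrow> 'a::complex_banach) \<Rightarrow> real \<Rightarrow> 'a" where
  "M_avg h f t = (1 / h) *\<^sub>R bochner_integral (lebesgue_on {0..h}) (\<lambda>s. f (t + s))"

definition has_erg_mean :: "real set \<Rightarrow> (real \<Rightarrow> 'a::complex_banach) \<Rightarrow> 'a \<Rightarrow> bool" where
  "has_erg_mean J f m \<longleftrightarrow>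
     uniform_limit J
       (\<lambda>T x. (1 / T) *\<^sub>R bochner_integral (lebesgue_on {0..T}) (\<lambda>s. f (x + s))) (\<lambda>x. m) at_top"

definition erg_mean :: "real set \<Rightarrow> (real \<Rightarrow> 'a::complex_banach) \<Rightarrow> 'a" where
  "erg_mean J f = (THE m. has_erg_mean J f m)"

definition Erg :: "real set \<Rightarrow> (real \<Rightarrow> 'a::complex_banach) set" where
  "Erg J = {f \<in> L1loc J. \<exists>m. has_erg_mean J f m}"

definition Erg0 :: "real set \<Rightarrow> (real \<Rightarrow> 'a::complex_banach) set" where
  "Erg0 J = {f \<in> Erg J. erg_mean J f = 0}"

definition modulate :: "real \<Rightarrow> (real \<Rightarrow> 'a::complex_banach) \<Rightarrow> real \<Rightarrow> 'a" where
  "modulate \<omega> f t = exp (\<i> * complex_of_real (\<omega> * t)) *\<^sub>C f t"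

definition TErg :: "real set \<Rightarrow> (real \<Rightarrow> 'a::complex_banach) set" where
  "TErg J = {f \<in> L1loc J. \<forall>\<omega>. modulate \<omega> f \<in> Erg J}"

definition TErg0 :: "real set \<Rightarrow> (real \<Rightarrow> 'a::complex_banach) set" where
  "TErg0 J = {f \<in> TErg J. \<forall>\<omega>. modulate \<omega> f \<in> Erg0 J}"

definition Mcl :: "real set \<Rightarrow> (real \<Rightarrow> 'a::complex_banach) set \<Rightarrow> (real \<Rightarrow> 'a) set" where
  "Mcl J A = {f \<in> L1loc J. \<forall>h>0. M_avg h f \<in> A}"

definition nderiv :: "nat \<Rightarrow> (real \<Rightarrow> complex) \<Rightarrow> real \<Rightarrow> complex" where
  "nderiv k \<phi> = ((\<lambda>g t. vector_derivative g (at t)) ^^ k) \<phi>"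

definition test_fun :: "(real \<Rightarrow> complex) set" where
  "test_fun = {\<phi>. (\<forall>k t. nderiv k \<phi> differentiable (at t)) \<and> compact (closure {t. \<phi> t \<noteq> 0})}"

definition test_tendsto :: "(nat \<Rightarrow> real \<Rightarrow> complex) \<Rightarrow> (real \<Rightarrow> complex) \<Rightarrow> bool" where
  "test_tendsto \<phi>s \<phi> \<longleftrightarrow>
     (\<exists>K. compact K \<and> (\<forall>n. closure {t. \<phi>s n t \<noteq> 0} \<subseteq> K)) \<and>
     (\<forall>k. uniform_limit UNIV (\<lambda>n. nderiv k (\<phi>s n)) (nderiv k \<phi>) sequentially)"

text \<open>
  Continuity on the space of test functions is sequential continuity; for linear maps it coincides
  with continuity for the usual inductive limit topology.  Distributions are extensional, so that
  two of them are equal iff they agree on all test functions.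
\<close>

definition distributions :: "((real \<Rightarrow> complex) \<Rightarrow> 'a::complex_banach) set" where
  "distributions = {T \<in> extensional test_fun.
     (\<forall>\<phi>\<in>test_fun. \<forall>\<psi>\<in>test_fun. T (\<lambda>t. \<phi> t + \<psi> t) = T \<phi> + T \<psi>) \<and>
     (\<forall>c. \<forall>\<phi>\<in>test_fun. T (\<lambda>t. c * \<phi> t) = c *\<^sub>C T \<phi>) \<and>
     (\<forall>\<phi>s. \<forall>\<phi>\<in>test_fun. (\<forall>n. \<phi>s n \<in> test_fun) \<and> test_tendsto \<phi>s \<phi> \<longrightarrow>
        (\<lambda>n. T (\<phi>s n)) \<longlonglongrightarrow> T \<phi>)}"

definition dist_conv ::
    "((real \<Rightarrow> complex) \<Rightarrow> 'a::complex_banach) \<Rightarrow> (real \<Rightarrow> complex) \<Rightarrow> real \<Rightarrow> 'a" where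
  "dist_conv T \<phi> x = T (\<lambda>y. \<phi> (x - y))"

definition dist_of_fun :: "(real \<Rightarrow> 'a::complex_banach) \<Rightarrow> (real \<Rightarrow> complex) \<Rightarrow> 'a" where
  "dist_of_fun f = (\<lambda>\<phi>\<in>test_fun. bochner_integral lebesgue (\<lambda>t. \<phi> t *\<^sub>C f t))"

definition Dist_cl ::
    "(real \<Rightarrow> 'a::complex_banach) set \<Rightarrow> ((real \<Rightarrow> complex) \<Rightarrow> 'a) set" where
  "Dist_cl A = {T \<in> distributions. \<forall>\<phi>\<in>test_fun. dist_conv T \<phi> \<in> A}"

end

theory Submission
  imports Defs "HOL-Complex_Analysis.Complex_Analysis"
begin

text \<open>
  Why the inclusions hold.  All four classes ask for means of \<open>\<gamma>\<^sub>\<omega> f\<close>, for \<open>\<omega>\<close> in \<open>{0}\<close> or for all \<open>\<omega>\<close>, and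
  possibly for the means to vanish; they are treated simultaneously as \<open>erg_class J \<Omega> z\<close>.  With a primitive
  \<open>G\<close> of \<open>\<gamma>\<^sub>\<omega> f\<close>, a mean is the limit of \<open>(G (x + T) - G x) / T\<close>, uniformly in \<open>x\<close>.  Passing from \<open>f\<close> to \<open>M\<^sub>h f\<close>,
  or to a convolution \<open>f * \<phi>\<close>, replaces these increments by their averages against the kernel \<open>e\<^sup>-\<^sup>i\<^sup>\<omega>\<^sup>s / h\<close> on
  \<open>[0, h]\<close>, or \<open>e\<^sup>-\<^sup>i\<^sup>\<omega>\<^sup>s \<phi>(-s)\<close>.  Means carry over to the average (\<open>mean_on_kernel\<close>).  Conversely they can be recovered
  from it, provided the kernel has non-zero integral and \<open>G\<close> has bounded increments over bounded steps
  (\<open>mean_on_of_kernel\<close>), for then shifting \<open>x\<close> by a bounded amount changes \<open>G (x + T) - G x\<close> by a bounded amount,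
  which is negligible as \<open>T \<rightarrow> \<infinity>\<close>.

  Bounded increments come for free: a function with a mean has them, and if all the averages \<open>M\<^sub>h f\<close> are
  bounded, they follow from Baire's theorem (\<open>Baire_bounded_increments\<close>).  This gives \<open>\<M> \<A>\<^sub>u\<^sub>b \<subseteq> \<A>\<close>.  The inclusion
  \<open>\<A> \<subseteq> \<M>\<^sup>2 \<A>\<^sub>u\<^sub>b\<close> holds because the first average of \<open>f \<in> \<A>\<close> is bounded and the second one is then Lipschitz
  continuous.  The whole chain follows by applying \<open>\<M>\<close> repeatedly.

  For a distribution \<open>T\<close> all of whose convolutions lie in \<open>\<A>\<close>, the derivatives of \<open>T * \<phi>\<close> are again such convolutions,
  so \<open>T * \<phi>\<close> and its derivative have bounded increments and are bounded (\<open>dist_conv_C_ub\<close>); hence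
  they even lie in \<open>\<A>\<^sub>u\<^sub>b\<close>.  Since \<open>M\<^sub>h (f * \<phi>) = (M\<^sub>h f) * \<phi>\<close>, all members of \<open>\<M>\<^sup>n \<A>\<close> define such distributions.

  Why they are strict.  Derivatives of order \<open>n\<close> of functions in \<open>\<A>\<close> lie in \<open>\<M>\<^sup>n \<A>\<close>, and \<open>n\<close>-fold averages of an \<open>n\<close>-th
  derivative are iterated difference quotients.  So a function \<open>H\<close> vanishing at infinity is needed whose first derivative
  has unbounded, or bounded but not uniformly continuous, iterated difference quotients.  An oscillating
  function \<open>e\<^sup>-\<^sup>t exp (i e\<^sup>l\<^sup>t)\<close>, cut off at \<open>-\<infinity>\<close>, achieves this for \<open>l = 2\<close> and \<open>l = 1\<close>, because for large steps the
  last term of a difference quotient dominates or oscillates much faster than the others.  The point mass at \<open>0\<close> is a distribution that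
  is not a function.  Finally, \<open>exp (i (t + ln (1 + t\<^sup>2)))\<close> is ergodic but not totally ergodic, and for
  bounded functions the latter cannot be repaired by averaging (\<open>Mcl_funpow_erg_class_Lipschitz\<close>).

  The Bochner integrals over compact intervals are identified with Henstock--Kurzweil integrals at the outset
  (\<open>has_bochner_has_integral\<close>), so that primitives, integration by parts and the fundamental theorem of calculus are available.
\<close>


section \<open>The complex scalar multiplication\<close>

lemma bounded_bilinear_scaleC:
  "bounded_bilinear (scaleC :: complex \<Rightarrow> 'a::complex_banach \<Rightarrow> 'a)"
proof
  fix a :: complex and b :: 'a and r :: real
  show "(r *\<^sub>R a) *\<^sub>C b = r *\<^sub>R a *\<^sub>C b"
    by (metis scaleC_of_real scaleC_scaleC scaleR_conv_of_real)
  show "a *\<^sub>C r *\<^sub>R b = r *\<^sub>R a *\<^sub>C b"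
    by (metis scaleC_of_real scaleC_scaleC mult.commute)
  show "\<exists>K. \<forall>(a::complex) (b::'a). norm (a *\<^sub>C b) \<le> norm a * norm b * K"
    by (rule exI[of _ 1]) (simp add: norm_scaleC)
qed (simp_all add: scaleC_add_left scaleC_add_right)

interpretation scaleC: bounded_bilinear "scaleC :: complex \<Rightarrow> 'a::complex_banach \<Rightarrow> 'a"
  by (rule bounded_bilinear_scaleC)

lemma scaleC_one [simp]: "1 *\<^sub>C (x::'a::complex_banach) = x"
  using scaleC_of_real[of 1 x] by simp

section \<open>Strong measurability and the Bochner integral\<close>

abbreviation simple_bochner_integrable :: "'m measure \<Rightarrow> ('m \<Rightarrow> 'a::real_vector) \<Rightarrow> bool" where
  "simple_bochner_integrable \<equiv> Bochner_Integration.simple_bochner_integrable"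

abbreviation simple_bochner_integral :: "'m measure \<Rightarrow> ('m \<Rightarrow> 'a::real_vector) \<Rightarrow> 'a" where
  "simple_bochner_integral \<equiv> Bochner_Integration.simple_bochner_integral"

lemma complete_measure_lebesgue_on:
  assumes "S \<in> sets lebesgue"
  shows "complete_measure (lebesgue_on S)"
proof
  fix A B assume "B \<subseteq> A" "A \<in> null_sets (lebesgue_on S)"
  then have "A \<subseteq> S" "A \<in> null_sets lebesgue" using assms by (auto simp: null_sets_restrict_space)
  then have "B \<in> null_sets lebesgue" "B \<subseteq> S"
    using \<open>B \<subseteq> A\<close> complete_measure.complete2[OF completion.complete_measure_axioms] by blast+
  then show "B \<in> sets (lebesgue_on S)" using assms by (auto simp: sets_restrict_space_iff)
qed

lemma complete_measure_lebesgue: "complete_measure lebesgue"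
  by (rule completion.complete_measure_axioms)

text \<open>
  The limit of simple functions exists outside a null set only; as the measure is complete, the values
  on that null set do not affect measurability.
\<close>

lemma strongly_measurable_borel:
  fixes f :: "'m \<Rightarrow> 'a::real_normed_vector"
  assumes M: "complete_measure M" and f: "strongly_measurable M f"
  shows "f \<in> borel_measurable M"
proof -
  interpret complete_measure M by fact
  obtain s where s: "\<And>i::nat. simple_function M (s i)" and lim: "AE x in M. (\<lambda>i. s i x) \<longlonglongrightarrow> f x"
    using f unfolding strongly_measurable_def by blast
  define N where "N = {x\<in>space M. \<not> (\<lambda>i. s i x) \<longlonglongrightarrow> f x}"
  have N: "N \<in> null_sets M" using lim unfolding AE_iff_null_sets N_def .
  have g: "(\<lambda>x. if x \<in> N then 0 else f x) \<in> borel_measurable M"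
  proof (rule borel_measurable_LIMSEQ_metric)
    show "(\<lambda>x. if x \<in> N then 0 else s i x) \<in> borel_measurable M" for i
      using N s by (intro measurable_If_set) (auto intro: borel_measurable_simple_function)
    show "(\<lambda>i. if x \<in> N then 0 else s i x) \<longlonglongrightarrow> (if x \<in> N then 0 else f x)" if "x \<in> space M" for x
      using that by (auto simp: N_def)
  qed
  show ?thesis
  proof (rule measurableI)
    fix A :: "'a set" assume A: "A \<in> sets borel"
    have "AE x in M. x \<notin> N" using N by (rule AE_not_in)
    then have "AE x in M. (x \<in> (\<lambda>x. if x \<in> N then 0 else f x) -` A \<inter> space M) \<longleftrightarrow> x \<in> f -` A \<inter> space M"
      by eventually_elim auto
    then show "f -` A \<inter> space M \<in> sets M"
      by (rule in_sets_AE) (use measurable_sets[OF g A] in auto)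
  qed auto
qed

lemma strongly_measurable_cong_AE:
  assumes "strongly_measurable M f" "AE x in M. f x = g x"
  shows "strongly_measurable M g"
proof -
  obtain s where s: "\<And>i::nat. simple_function M (s i)" and lim: "AE x in M. (\<lambda>i. s i x) \<longlonglongrightarrow> f x"
    using assms(1) unfolding strongly_measurable_def by blast
  have "AE x in M. (\<lambda>i. s i x) \<longlonglongrightarrow> g x" using lim assms(2) by eventually_elim simp
  then show ?thesis unfolding strongly_measurable_def using s by blast
qed

lemma strongly_measurable_simple:
  "simple_function M f \<Longrightarrow> strongly_measurable M f"
  unfolding strongly_measurable_def by (intro exI[of _ "\<lambda>_. f"]) auto

lemma strongly_measurable_diff:
  assumes "strongly_measurable M f" "strongly_measurable M g"
  shows "strongly_measurable M (\<lambda>x. f x - g x)"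
proof -
  obtain s where s: "\<And>i::nat. simple_function M (s i)" and ls: "AE x in M. (\<lambda>i. s i x) \<longlonglongrightarrow> f x"
    using assms(1) unfolding strongly_measurable_def by blast
  obtain t where t: "\<And>i::nat. simple_function M (t i)" and lt: "AE x in M. (\<lambda>i. t i x) \<longlonglongrightarrow> g x"
    using assms(2) unfolding strongly_measurable_def by blast
  have "AE x in M. (\<lambda>i. s i x - t i x) \<longlonglongrightarrow> f x - g x"
    using ls lt by eventually_elim (rule tendsto_diff)
  moreover have "simple_function M (\<lambda>x. s i x - t i x)" for i
    by (rule simple_function_compose2[OF s t])
  ultimately show ?thesis
    unfolding strongly_measurable_def by (intro exI[of _ "\<lambda>i x. s i x - t i x"]) auto
qed

lemma strongly_measurable_bilinear:
  assumes "bounded_bilinear p" and "strongly_measurable M f" "strongly_measurable M g"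
  shows "strongly_measurable M (\<lambda>x. p (f x) (g x))"
proof -
  obtain s where s: "\<And>i::nat. simple_function M (s i)" and ls: "AE x in M. (\<lambda>i. s i x) \<longlonglongrightarrow> f x"
    using assms(2) unfolding strongly_measurable_def by blast
  obtain t where t: "\<And>i::nat. simple_function M (t i)" and lt: "AE x in M. (\<lambda>i. t i x) \<longlonglongrightarrow> g x"
    using assms(3) unfolding strongly_measurable_def by blast
  have "AE x in M. (\<lambda>i. p (s i x) (t i x)) \<longlonglongrightarrow> p (f x) (g x)"
    using ls lt by eventually_elim (rule bounded_bilinear.tendsto[OF assms(1)])
  moreover have "simple_function M (\<lambda>x. p (s i x) (t i x))" for i
    by (rule simple_function_compose2[OF s t])
  ultimately show ?thesis
    unfolding strongly_measurable_def by (intro exI[of _ "\<lambda>i x. p (s i x) (t i x)"]) auto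
qed

lemma norm_simple_bochner_integral_le:
  fixes s :: "'m \<Rightarrow> 'a::real_normed_vector"
  assumes "simple_bochner_integrable M s"
  shows "ennreal (norm (simple_bochner_integral M s)) \<le> (\<integral>\<^sup>+x. ennreal (norm (s x)) \<partial>M)"
proof -
  have "simple_bochner_integrable M (\<lambda>x. norm (s x))"
    using simple_bochner_integrable_compose2[OF _ assms assms, of "\<lambda>x y. norm x"] by simp
  then have "(\<integral>\<^sup>+x. ennreal (norm (s x)) \<partial>M) = ennreal (simple_bochner_integral M (\<lambda>x. norm (s x)))"
    by (subst simple_bochner_integral_eq_nn_integral) auto
  then show ?thesis
    using simple_bochner_integral_norm_bound[OF assms] by (simp add: ennreal_leI)
qed

text \<open>
  The integrals of two approximations of \<open>f\<close> differ by at most the sum of their errors.  This gives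
  both the uniqueness of the Bochner integral and, by completeness of the space, its existence.
\<close>

lemma dist_simple_bochner_integral_le:
  fixes f :: "'m \<Rightarrow> 'a::real_normed_vector"
  assumes M: "complete_measure M" and f: "strongly_measurable M f"
    and s: "simple_bochner_integrable M s"
    and t: "simple_bochner_integrable M t"
  shows "ennreal (norm (simple_bochner_integral M s - simple_bochner_integral M t))
           \<le> (\<integral>\<^sup>+x. ennreal (norm (f x - s x)) \<partial>M) + (\<integral>\<^sup>+x. ennreal (norm (f x - t x)) \<partial>M)"
proof -
  have meas: "(\<lambda>x. f x - u x) \<in> borel_measurable M" if "simple_bochner_integrable M u" for u
    using that
    by (intro strongly_measurable_borel[OF M] strongly_measurable_diff[OF f] strongly_measurable_simple)
       (auto elim: simple_bochner_integrable.cases)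
  have st: "simple_bochner_integrable M (\<lambda>x. s x - t x)"
    by (rule simple_bochner_integrable_compose2[OF _ s t]) simp
  have "ennreal (norm (simple_bochner_integral M s - simple_bochner_integral M t))
      \<le> (\<integral>\<^sup>+x. ennreal (norm (s x - t x)) \<partial>M)"
    using norm_simple_bochner_integral_le[OF st] by (simp add: simple_bochner_integral_diff[OF s t])
  also have "\<dots> \<le> (\<integral>\<^sup>+x. ennreal (norm (f x - s x)) + ennreal (norm (f x - t x)) \<partial>M)"
  proof (rule nn_integral_mono)
    fix x
    have "norm (s x - t x) \<le> norm (f x - s x) + norm (f x - t x)"
      using norm_triangle_ineq4[of "f x - t x" "f x - s x"] by simp
    then show "ennreal (norm (s x - t x)) \<le> ennreal (norm (f x - s x)) + ennreal (norm (f x - t x))"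
      by (simp add: ennreal_plus[symmetric] ennreal_leI del: ennreal_plus)
  qed
  also have "\<dots> = (\<integral>\<^sup>+x. ennreal (norm (f x - s x)) \<partial>M) + (\<integral>\<^sup>+x. ennreal (norm (f x - t x)) \<partial>M)"
    using meas[OF s] meas[OF t] by (intro nn_integral_add) auto
  finally show ?thesis .
qed

lemma has_bochner_unique:
  assumes M: "complete_measure M" and v: "has_bochner M f v" and w: "has_bochner M f w"
  shows "v = w"
proof -
  have f: "strongly_measurable M f" using v by (simp add: has_bochner_def)
  obtain s where s: "\<And>i::nat. simple_bochner_integrable M (s i)"
      "(\<lambda>i. \<integral>\<^sup>+x. ennreal (norm (f x - s i x)) \<partial>M) \<longlonglongrightarrow> 0"
      "(\<lambda>i. simple_bochner_integral M (s i)) \<longlonglongrightarrow> v"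
    using v unfolding has_bochner_def by blast
  obtain t where t: "\<And>i::nat. simple_bochner_integrable M (t i)"
      "(\<lambda>i. \<integral>\<^sup>+x. ennreal (norm (f x - t i x)) \<partial>M) \<longlonglongrightarrow> 0"
      "(\<lambda>i. simple_bochner_integral M (t i)) \<longlonglongrightarrow> w"
    using w unfolding has_bochner_def by blast
  let ?I = "\<lambda>i. norm (simple_bochner_integral M (s i) - simple_bochner_integral M (t i))"
  have "(\<lambda>i. ennreal (?I i)) \<longlonglongrightarrow> 0"
  proof (rule tendsto_sandwich[OF _ _ tendsto_const])
    show "\<forall>\<^sub>F i in sequentially. ennreal (?I i) \<le> (\<integral>\<^sup>+x. ennreal (norm (f x - s i x)) \<partial>M) + (\<integral>\<^sup>+x. ennreal (norm (f x - t i x)) \<partial>M)"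
      by (intro always_eventually allI dist_simple_bochner_integral_le[OF M f s(1) t(1)])
    show "(\<lambda>i. (\<integral>\<^sup>+x. ennreal (norm (f x - s i x)) \<partial>M) + (\<integral>\<^sup>+x. ennreal (norm (f x - t i x)) \<partial>M)) \<longlonglongrightarrow> 0"
      using tendsto_add[OF s(2) t(2)] by simp
  qed auto
  then have "?I \<longlonglongrightarrow> 0"
    by (simp add: ennreal_0[symmetric] tendsto_ennreal_iff del: ennreal_0)
  moreover have "?I \<longlonglongrightarrow> norm (v - w)" by (intro tendsto_intros s t)
  ultimately show ?thesis using LIMSEQ_unique by fastforce
qed

lemma has_bochner_integral_eq:
  "complete_measure M \<Longrightarrow> has_bochner M f v \<Longrightarrow> bochner_integral M f = v"
  unfolding bochner_integral_def bochner_integrable_def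
  by (auto intro!: the_equality dest: has_bochner_unique)

lemma bochner_integrable_has_bochner:
  "complete_measure M \<Longrightarrow> bochner_integrable M f \<Longrightarrow> has_bochner M f (bochner_integral M f)"
  using has_bochner_integral_eq unfolding bochner_integrable_def by blast

lemma bochner_integrableD:
  fixes f :: "'m \<Rightarrow> 'a::real_normed_vector"
  assumes M: "complete_measure M" and f: "bochner_integrable M f"
  shows "strongly_measurable M f" "(\<integral>\<^sup>+x. ennreal (norm (f x)) \<partial>M) < \<infinity>"
proof -
  obtain v where "has_bochner M f v" using f unfolding bochner_integrable_def by blast
  then obtain s where sm: "strongly_measurable M f"
    and s: "\<And>i::nat. simple_bochner_integrable M (s i)"
      "(\<lambda>i. \<integral>\<^sup>+x. ennreal (norm (f x - s i x)) \<partial>M) \<longlonglongrightarrow> 0"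
    unfolding has_bochner_def by blast
  show "strongly_measurable M f" by fact
  have "\<forall>\<^sub>F i in sequentially. (\<integral>\<^sup>+x. ennreal (norm (f x - s i x)) \<partial>M) < 1"
    using s(2) by (rule order_tendstoD) simp
  then obtain i where i: "(\<integral>\<^sup>+x. ennreal (norm (f x - s i x)) \<partial>M) < 1"
    using eventually_happens'[OF sequentially_bot] by blast
  have sf: "simple_function M (s i)" using s(1)[of i] by (auto elim: simple_bochner_integrable.cases)
  have m1: "(\<lambda>x. f x - s i x) \<in> borel_measurable M"
    by (intro strongly_measurable_borel[OF M] strongly_measurable_diff[OF sm strongly_measurable_simple[OF sf]])
  have m2: "s i \<in> borel_measurable M" using sf by (rule borel_measurable_simple_function)
  have ns: "simple_bochner_integrable M (\<lambda>x. norm (s i x))"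
    using simple_bochner_integrable_compose2[OF _ s(1) s(1), of "\<lambda>x y. norm x"] by simp
  have "(\<integral>\<^sup>+x. ennreal (norm (f x)) \<partial>M) \<le> (\<integral>\<^sup>+x. ennreal (norm (f x - s i x)) + ennreal (norm (s i x)) \<partial>M)"
  proof (rule nn_integral_mono)
    fix x
    have "norm (f x) \<le> norm (f x - s i x) + norm (s i x)"
      using norm_triangle_ineq[of "f x - s i x" "s i x"] by simp
    then show "ennreal (norm (f x)) \<le> ennreal (norm (f x - s i x)) + ennreal (norm (s i x))"
      by (simp add: ennreal_plus[symmetric] ennreal_leI del: ennreal_plus)
  qed
  also have "\<dots> = (\<integral>\<^sup>+x. ennreal (norm (f x - s i x)) \<partial>M) + (\<integral>\<^sup>+x. ennreal (norm (s i x)) \<partial>M)"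
    using m1 m2 by (intro nn_integral_add) auto
  also have "(\<integral>\<^sup>+x. ennreal (norm (s i x)) \<partial>M) = ennreal (simple_bochner_integral M (\<lambda>x. norm (s i x)))"
    using ns by (subst simple_bochner_integral_eq_nn_integral) auto
  also have "(\<integral>\<^sup>+x. ennreal (norm (f x - s i x)) \<partial>M) + \<dots> < \<infinity>"
    using order_less_trans[OF i ennreal_one_less_top] by (simp add: ennreal_add_less_top)
  finally show "(\<integral>\<^sup>+x. ennreal (norm (f x)) \<partial>M) < \<infinity>" .
qed

text \<open>
  The simple functions that converge to \<open>f\<close> need not converge in mean; cutting them off where they
  exceed \<open>2 \<parallel>f\<parallel>\<close> makes \<open>3 \<parallel>f\<parallel>\<close> an integrable majorant of the error.
\<close>

lemma bochner_integrableI: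
  fixes f :: "'m \<Rightarrow> 'a::banach"
  assumes M: "complete_measure M" and f: "strongly_measurable M f"
    and fin: "(\<integral>\<^sup>+x. ennreal (norm (f x)) \<partial>M) < \<infinity>"
  shows "bochner_integrable M f"
proof -
  obtain s where s: "\<And>i::nat. simple_function M (s i)" and lim: "AE x in M. (\<lambda>i. s i x) \<longlonglongrightarrow> f x"
    using f unfolding strongly_measurable_def by blast
  have fm: "f \<in> borel_measurable M" by (rule strongly_measurable_borel[OF M f])
  have sm: "s i \<in> borel_measurable M" for i by (rule borel_measurable_simple_function[OF s])
  define t where "t i x = (if norm (s i x) \<le> 2 * norm (f x) then s i x else 0)" for i x
  have t: "simple_function M (t i)" for i
  proof -
    have "{x\<in>space M. norm (s i x) \<le> 2 * norm (f x)} \<in> sets M" using fm sm[of i] by measurable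
    then show ?thesis unfolding t_def using s by (intro simple_function_If) auto
  qed
  have tb: "norm (t i x) \<le> 2 * norm (f x)" for i x by (auto simp: t_def)
  have tlim: "AE x in M. (\<lambda>i. t i x) \<longlonglongrightarrow> f x"
    using lim
  proof eventually_elim
    fix x assume l: "(\<lambda>i. s i x) \<longlonglongrightarrow> f x"
    show "(\<lambda>i. t i x) \<longlonglongrightarrow> f x"
    proof (cases "f x = 0")
      case True
      then have "t i x = 0" for i using tb[of i x] by simp
      then show ?thesis using True by simp
    next
      case False
      have "\<forall>\<^sub>F i in sequentially. norm (s i x) < 2 * norm (f x)"
        using tendsto_norm[OF l] False by (intro order_tendstoD) auto
      then have "\<forall>\<^sub>F i in sequentially. s i x = t i x" by eventually_elim (simp add: t_def)
      then show ?thesis by (rule Lim_transform_eventually[OF l])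
    qed
  qed
  have fin3: "(\<integral>\<^sup>+x. ennreal (3 * norm (f x)) \<partial>M) < \<infinity>"
    using fin fm by (simp add: ennreal_mult nn_integral_cmult ennreal_mult_less_top)
  have "(\<lambda>i. \<integral>\<^sup>+x. ennreal (norm (f x - t i x)) \<partial>M) \<longlonglongrightarrow> (\<integral>\<^sup>+x. 0 \<partial>M)"
  proof (rule nn_integral_dominated_convergence[where w="\<lambda>x. ennreal (3 * norm (f x))"])
    show "(\<lambda>x. ennreal (norm (f x - t i x))) \<in> borel_measurable M" for i
    proof -
      have "(\<lambda>x. f x - t i x) \<in> borel_measurable M"
        by (intro strongly_measurable_borel[OF M] strongly_measurable_diff[OF f strongly_measurable_simple[OF t]])
      then show ?thesis by measurable
    qed
    show "(\<lambda>x. ennreal (3 * norm (f x))) \<in> borel_measurable M" using fm by measurable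
    show "AE x in M. ennreal (norm (f x - t i x)) \<le> ennreal (3 * norm (f x))" for i
    proof (intro always_eventually allI ennreal_leI)
      fix x show "norm (f x - t i x) \<le> 3 * norm (f x)"
        using norm_triangle_ineq4[of "f x" "t i x"] tb[of i x] by simp
    qed
    show "AE x in M. (\<lambda>i. ennreal (norm (f x - t i x))) \<longlonglongrightarrow> 0"
      using tlim
    proof eventually_elim
      fix x assume "(\<lambda>i. t i x) \<longlonglongrightarrow> f x"
      then have "(\<lambda>i. norm (f x - t i x)) \<longlonglongrightarrow> norm (f x - f x)" by (intro tendsto_intros)
      then have "(\<lambda>i. ennreal (norm (f x - t i x))) \<longlonglongrightarrow> ennreal (norm (f x - f x))" by (rule tendsto_ennrealI)
      then show "(\<lambda>i. ennreal (norm (f x - t i x))) \<longlonglongrightarrow> 0" by simp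
    qed
  qed (use fin3 in auto)
  then have L1: "(\<lambda>i. \<integral>\<^sup>+x. ennreal (norm (f x - t i x)) \<partial>M) \<longlonglongrightarrow> 0" by simp
  have ti: "simple_bochner_integrable M (t i)" for i
  proof (rule simple_bochner_integrableI_bounded[OF t])
    have "(\<integral>\<^sup>+x. ennreal (norm (t i x)) \<partial>M) \<le> (\<integral>\<^sup>+x. ennreal (3 * norm (f x)) \<partial>M)"
    proof (intro nn_integral_mono ennreal_leI)
      fix x show "norm (t i x) \<le> 3 * norm (f x)" using tb[of i x] norm_ge_zero[of "f x"] by linarith
    qed
    then show "(\<integral>\<^sup>+x. ennreal (norm (t i x)) \<partial>M) < \<infinity>" using fin3 by (rule order_le_less_trans)
  qed
  have "Cauchy (\<lambda>i. simple_bochner_integral M (t i))"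
  proof (rule CauchyI)
    fix e :: real assume e: "e > 0"
    have "\<forall>\<^sub>F i in sequentially. (\<integral>\<^sup>+x. ennreal (norm (f x - t i x)) \<partial>M) < ennreal (e/2)"
      using L1 by (rule order_tendstoD) (use e in simp)
    then obtain N where N: "\<And>i. i \<ge> N \<Longrightarrow> (\<integral>\<^sup>+x. ennreal (norm (f x - t i x)) \<partial>M) < ennreal (e/2)"
      by (auto simp: eventually_sequentially)
    have "norm (simple_bochner_integral M (t i) - simple_bochner_integral M (t j)) < e"
      if "i \<ge> N" "j \<ge> N" for i j
    proof -
      have "ennreal (norm (simple_bochner_integral M (t i) - simple_bochner_integral M (t j)))
          < ennreal (e/2) + ennreal (e/2)"
        using dist_simple_bochner_integral_le[OF M f ti ti] add_strict_mono[OF N[OF that(1)] N[OF that(2)]]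
        by (rule order_le_less_trans)
      also have "\<dots> = ennreal e" using e by (simp add: ennreal_plus[symmetric] del: ennreal_plus)
      finally show ?thesis using e by (simp add: ennreal_less_iff)
    qed
    then show "\<exists>N. \<forall>i\<ge>N. \<forall>j\<ge>N. norm (simple_bochner_integral M (t i) - simple_bochner_integral M (t j)) < e"
      by blast
  qed
  then obtain v where "(\<lambda>i. simple_bochner_integral M (t i)) \<longlonglongrightarrow> v"
    by (meson Cauchy_convergent_iff convergent_def)
  then show ?thesis
    unfolding bochner_integrable_def has_bochner_def using f ti L1 by blast
qed

lemma strongly_measurable_lebesgue_on:
  fixes f :: "real \<Rightarrow> 'a::real_normed_vector"
  assumes S: "S \<in> sets lebesgue"
  shows "strongly_measurable (lebesgue_on S) f \<longleftrightarrow> strongly_measurable lebesgue (\<lambda>x. indicator S x *\<^sub>R f x)"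
proof
  assume "strongly_measurable (lebesgue_on S) f"
  then obtain s where s: "\<And>i::nat. simple_function (lebesgue_on S) (s i)"
    and l: "AE x in lebesgue_on S. (\<lambda>i. s i x) \<longlonglongrightarrow> f x"
    unfolding strongly_measurable_def by blast
  have "simple_function lebesgue (\<lambda>x. indicator S x *\<^sub>R s i x)" for i
    using s[of i] S by (simp add: simple_function_restrict_space)
  moreover have "AE x in lebesgue. x \<in> S \<longrightarrow> (\<lambda>i. s i x) \<longlonglongrightarrow> f x"
    using l S by (simp add: AE_restrict_space_iff)
  then have "AE x in lebesgue. (\<lambda>i. indicator S x *\<^sub>R s i x) \<longlonglongrightarrow> indicator S x *\<^sub>R f x"
    by eventually_elim (auto split: split_indicator)
  ultimately show "strongly_measurable lebesgue (\<lambda>x. indicator S x *\<^sub>R f x)"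
    unfolding strongly_measurable_def by (intro exI[of _ "\<lambda>i x. indicator S x *\<^sub>R s i x"]) auto
next
  assume "strongly_measurable lebesgue (\<lambda>x. indicator S x *\<^sub>R f x)"
  then obtain s where s: "\<And>i::nat. simple_function lebesgue (s i)"
    and l: "AE x in lebesgue. (\<lambda>i. s i x) \<longlonglongrightarrow> indicator S x *\<^sub>R f x"
    unfolding strongly_measurable_def by blast
  have "simple_function lebesgue (\<lambda>x. indicator S x *\<^sub>R s i x)" for i
    using S by (intro simple_function_compose2[where h="scaleR", OF simple_function_indicator s]) simp
  then have "simple_function (lebesgue_on S) (s i)" for i
    using S by (simp add: simple_function_restrict_space)
  moreover have "AE x in lebesgue_on S. (\<lambda>i. s i x) \<longlonglongrightarrow> f x"
    using l S by (subst AE_restrict_space_iff) (auto elim!: eventually_mono split: split_indicator_asm)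
  ultimately show "strongly_measurable (lebesgue_on S) f"
    unfolding strongly_measurable_def by blast
qed

lemma bochner_integrable_lebesgue_on:
  fixes f :: "real \<Rightarrow> 'a::banach"
  assumes S: "S \<in> sets lebesgue"
  shows "bochner_integrable (lebesgue_on S) f \<longleftrightarrow> bochner_integrable lebesgue (\<lambda>x. indicator S x *\<^sub>R f x)"
proof -
  have *: "(\<integral>\<^sup>+x. ennreal (norm (f x)) \<partial>lebesgue_on S) = (\<integral>\<^sup>+x. ennreal (norm (indicator S x *\<^sub>R f x)) \<partial>lebesgue)"
    using S by (subst nn_integral_restrict_space) (auto intro!: nn_integral_cong split: split_indicator)
  note c = complete_measure_lebesgue complete_measure_lebesgue_on[OF S]
  show ?thesis
    using bochner_integrableI[OF c(1), of "\<lambda>x. indicator S x *\<^sub>R f x"] bochner_integrableI[OF c(2), of f]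
      bochner_integrableD[OF c(1), of "\<lambda>x. indicator S x *\<^sub>R f x"] bochner_integrableD[OF c(2), of f]
    unfolding * strongly_measurable_lebesgue_on[OF S, symmetric] by blast
qed

lemma bochner_integrable_lebesgue_on_subset:
  fixes f :: "real \<Rightarrow> 'a::banach"
  assumes S: "S \<in> sets lebesgue" and T: "T \<in> sets lebesgue" "T \<subseteq> S"
    and f: "bochner_integrable (lebesgue_on S) f"
  shows "bochner_integrable (lebesgue_on T) f"
proof -
  note f' = bochner_integrableD[OF complete_measure_lebesgue f[unfolded bochner_integrable_lebesgue_on[OF S]]]
  have eq: "indicator T x *\<^sub>R (indicator S x *\<^sub>R f x) = indicator T x *\<^sub>R f x" for x
    using T by (auto split: split_indicator)
  have "strongly_measurable lebesgue (\<lambda>x. indicator T x *\<^sub>R (indicator S x *\<^sub>R f x))"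
    using T by (intro strongly_measurable_bilinear[OF bounded_bilinear_scaleR _ f'(1)] strongly_measurable_simple
      simple_function_indicator) simp
  moreover have "(\<integral>\<^sup>+x. ennreal (norm (indicator T x *\<^sub>R f x)) \<partial>lebesgue) \<le> (\<integral>\<^sup>+x. ennreal (norm (indicator S x *\<^sub>R f x)) \<partial>lebesgue)"
    using T by (intro nn_integral_mono ennreal_leI) (auto split: split_indicator)
  ultimately show ?thesis
    unfolding bochner_integrable_lebesgue_on[OF T(1)] eq
    using f'(2) by (intro bochner_integrableI[OF complete_measure_lebesgue]) (auto intro: order_le_less_trans)
qed

lemma bochner_integrable_translate:
  fixes f :: "real \<Rightarrow> 'a::banach"
  assumes f: "bochner_integrable lebesgue f"
  shows "bochner_integrable lebesgue (\<lambda>x. f (t + x))"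
proof -
  let ?T = "\<lambda>x::real. t + x"
  have T: "?T \<in> lebesgue \<rightarrow>\<^sub>M lebesgue"
    using lebesgue_affine_measurable[of "\<lambda>_. 1" t] by (simp add: euclidean_representation[where 'a=real])
  have d: "distr lebesgue lebesgue ?T = lebesgue"
    using lebesgue_real_affine[of 1 t] by (simp add: density_1)
  note f' = bochner_integrableD[OF complete_measure_lebesgue f]
  obtain s where s: "\<And>i::nat. simple_function lebesgue (s i)" and l: "AE x in lebesgue. (\<lambda>i. s i x) \<longlonglongrightarrow> f x"
    using f'(1) unfolding strongly_measurable_def by blast
  have "simple_function lebesgue (\<lambda>x. s i (t + x))" for i
    using simple_function_comp[OF T s] by (simp add: comp_def)
  moreover have "AE x in lebesgue. (\<lambda>i. s i (t + x)) \<longlonglongrightarrow> f (t + x)"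
    using AE_distrD[OF T, of "\<lambda>x. (\<lambda>i. s i x) \<longlonglongrightarrow> f x"] l unfolding d by simp
  ultimately have "strongly_measurable lebesgue (\<lambda>x. f (t + x))"
    unfolding strongly_measurable_def by (intro exI[of _ "\<lambda>i x. s i (t + x)"]) auto
  moreover have "(\<integral>\<^sup>+x. ennreal (norm (f (t + x))) \<partial>lebesgue) = (\<integral>\<^sup>+x. ennreal (norm (f x)) \<partial>lebesgue)"
    using nn_integral_distr[OF T, of "\<lambda>x. ennreal (norm (f x))"]
      strongly_measurable_borel[OF complete_measure_lebesgue f'(1)] unfolding d by simp
  ultimately show ?thesis
    using f'(2) by (intro bochner_integrableI[OF complete_measure_lebesgue]) auto
qed


section \<open>Bochner integrals over compact intervals as Henstock--Kurzweil integrals\<close>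

text \<open>
  If the error of an approximation is dominated by a real function with small integral, then so are
  the errors of all sufficiently fine Riemann sums.
\<close>

lemma has_integral_dominated_approximation:
  fixes f :: "real \<Rightarrow> 'a::real_normed_vector"
  assumes approx: "\<And>e. e > 0 \<Longrightarrow> \<exists>s w g r. (s has_integral w) {a..b} \<and> (g has_integral r) {a..b} \<and>
      r < e \<and> norm (w - v) < e \<and> (\<forall>x\<in>{a..b}. norm (f x - s x) \<le> g x)"
  shows "(f has_integral v) {a..b}"
  unfolding has_integral_real
proof (intro allI impI)
  fix e :: real assume "e > 0"
  then have "e / 4 > 0" by simp
  from approx[OF this] obtain s w g r where s: "(s has_integral w) {a..b}"
    and g: "(g has_integral r) {a..b}" and r: "r < e/4" and w: "norm (w - v) < e/4"
    and b: "\<And>x. x\<in>{a..b} \<Longrightarrow> norm (f x - s x) \<le> g x" by blast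
  obtain \<gamma>1 where \<gamma>1: "gauge \<gamma>1" "\<And>D. D tagged_division_of {a..b} \<Longrightarrow> \<gamma>1 fine D \<Longrightarrow>
      norm ((\<Sum>(x,k)\<in>D. measure lborel k *\<^sub>R s x) - w) < e/4"
    using s[unfolded has_integral_real, rule_format, OF \<open>e/4 > 0\<close>] by metis
  obtain \<gamma>2 where \<gamma>2: "gauge \<gamma>2" "\<And>D. D tagged_division_of {a..b} \<Longrightarrow> \<gamma>2 fine D \<Longrightarrow>
      norm ((\<Sum>(x,k)\<in>D. measure lborel k *\<^sub>R g x) - r) < e/4"
    using g[unfolded has_integral_real, rule_format, OF \<open>e/4 > 0\<close>] by metis
  have "norm ((\<Sum>(x,k)\<in>D. measure lborel k *\<^sub>R f x) - v) < e"
    if D: "D tagged_division_of {a..b}" "(\<lambda>x. \<gamma>1 x \<inter> \<gamma>2 x) fine D" for D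
  proof -
    have f1: "\<gamma>1 fine D" and f2: "\<gamma>2 fine D" using D(2) by (auto simp: fine_Int)
    have "norm (\<Sum>(x,k)\<in>D. measure lborel k *\<^sub>R (f x - s x)) \<le> (\<Sum>(x,k)\<in>D. measure lborel k *\<^sub>R g x)"
    proof (rule order_trans[OF norm_sum] , rule sum_mono, clarify)
      fix x k assume "(x, k) \<in> D"
      then have "x \<in> {a..b}" using tag_in_interval[OF D(1)] by blast
      then show "norm (measure lborel k *\<^sub>R (f x - s x)) \<le> measure lborel k *\<^sub>R g x"
        using b by (simp add: mult_left_mono)
    qed
    also have "\<dots> < r + e/4" using \<gamma>2(2)[OF D(1) f2] unfolding real_norm_def by linarith
    finally have 1: "norm (\<Sum>(x,k)\<in>D. measure lborel k *\<^sub>R (f x - s x)) < e/2" using r by linarith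
    have eq: "(\<Sum>(x,k)\<in>D. measure lborel k *\<^sub>R f x) - v
        = (\<Sum>(x,k)\<in>D. measure lborel k *\<^sub>R (f x - s x)) + (((\<Sum>(x,k)\<in>D. measure lborel k *\<^sub>R s x) - w) + (w - v))"
      by (simp add: scaleR_diff_right sum_subtractf split_def)
    show ?thesis
      unfolding eq using norm_triangle_ineq[of "\<Sum>(x,k)\<in>D. measure lborel k *\<^sub>R (f x - s x)" "((\<Sum>(x,k)\<in>D. measure lborel k *\<^sub>R s x) - w) + (w - v)"]
        norm_triangle_ineq[of "(\<Sum>(x,k)\<in>D. measure lborel k *\<^sub>R s x) - w" "w - v"] 1 \<gamma>1(2)[OF D(1) f1] w
      by linarith
  qed
  then show "\<exists>\<gamma>. gauge \<gamma> \<and> (\<forall>D. D tagged_division_of {a..b} \<and> \<gamma> fine D \<longrightarrow>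
      norm ((\<Sum>(x,k)\<in>D. measure lborel k *\<^sub>R f x) - v) < e)"
    using \<gamma>1(1) \<gamma>2(1) by (intro exI[of _ "\<lambda>x. \<gamma>1 x \<inter> \<gamma>2 x"]) (auto intro: gauge_Int)
qed

lemma simple_bochner_has_integral:
  fixes s :: "real \<Rightarrow> 'a::real_normed_vector"
  assumes s: "simple_bochner_integrable (lebesgue_on {a..b}) s"
  shows "(s has_integral simple_bochner_integral (lebesgue_on {a..b}) s) {a..b}"
proof -
  let ?M = "lebesgue_on {a..b}"
  have sf: "simple_function ?M s" using s by (auto elim: simple_bochner_integrable.cases)
  then have fin: "finite (s ` {a..b})" by (auto simp: simple_function_def)
  have A: "((\<lambda>x. indicator {x\<in>{a..b}. s x = y} x *\<^sub>R y) has_integral measure ?M {x\<in>{a..b}. s x = y} *\<^sub>R y) {a..b}"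
    if "y \<in> s ` {a..b}" for y
  proof (rule has_integral_scaleR_left)
    have "s -` {y} \<inter> space ?M \<in> sets ?M" using sf that by (auto simp: simple_function_def)
    moreover have eq: "s -` {y} \<inter> space ?M = {x\<in>{a..b}. s x = y}" by auto
    ultimately have m: "{x\<in>{a..b}. s x = y} \<in> sets ?M" by simp
    have "emeasure ?M {x\<in>{a..b}. s x = y} \<le> emeasure ?M {a..b}"
      by (rule emeasure_mono) (use m in auto)
    also have "\<dots> < \<infinity>"
      using emeasure_compact_finite[of "{a..b}"] by (simp add: emeasure_restrict_space)
    finally have "integrable ?M (indicator {x\<in>{a..b}. s x = y} :: real \<Rightarrow> real)"
      using m by (intro integrable_real_indicator) auto
    from has_integral_integral_lebesgue_on[OF this]
    show "((indicator {x\<in>{a..b}. s x = y} :: real \<Rightarrow> real) has_integral measure ?M {x\<in>{a..b}. s x = y}) {a..b}"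
      using eq by (simp add: Int_absorb2 subset_eq)
  qed
  have "((\<lambda>x. \<Sum>y\<in>s ` {a..b}. indicator {x\<in>{a..b}. s x = y} x *\<^sub>R y) has_integral
      (\<Sum>y\<in>s ` {a..b}. measure ?M {x\<in>{a..b}. s x = y} *\<^sub>R y)) {a..b}"
    by (rule has_integral_sum[OF fin A])
  moreover have "(\<Sum>y\<in>s ` {a..b}. indicator {x\<in>{a..b}. s x = y} x *\<^sub>R y) = s x" if "x \<in> {a..b}" for x
  proof -
    have "(\<Sum>y\<in>s ` {a..b}. indicator {x\<in>{a..b}. s x = y} x *\<^sub>R y) = (\<Sum>y\<in>s ` {a..b}. if s x = y then y else 0)"
      using that by (intro sum.cong) (auto split: split_indicator)
    then show ?thesis using fin that by (simp add: sum.delta)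
  qed
  ultimately show ?thesis
    unfolding simple_bochner_integral_def space_lebesgue_on by (rule has_integral_eq[rotated]) simp
qed

text \<open>
  The simple functions that define the Bochner integral are dominated approximations in the sense of
  \<open>has_integral_dominated_approximation\<close>.  Thus linearity, additivity over intervals and the
  fundamental theorem of calculus carry over from the Henstock--Kurzweil integral.
\<close>

lemma has_bochner_has_integral:
  fixes f :: "real \<Rightarrow> 'a::real_normed_vector"
  assumes f: "has_bochner (lebesgue_on {a..b}) f v"
  shows "(f has_integral v) {a..b}"
proof (rule has_integral_dominated_approximation)
  let ?M = "lebesgue_on {a..b}"
  have M: "complete_measure ?M" by (rule complete_measure_lebesgue_on) simp
  fix e :: real assume e: "e > 0"
  obtain s where sm: "strongly_measurable ?M f"
    and s: "\<And>i::nat. simple_bochner_integrable ?M (s i)"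
      "(\<lambda>i. \<integral>\<^sup>+x. ennreal (norm (f x - s i x)) \<partial>?M) \<longlonglongrightarrow> 0"
      "(\<lambda>i. simple_bochner_integral ?M (s i)) \<longlonglongrightarrow> v"
    using f unfolding has_bochner_def by blast
  have "\<forall>\<^sub>F i in sequentially. (\<integral>\<^sup>+x. ennreal (norm (f x - s i x)) \<partial>?M) < ennreal e"
    using s(2) by (rule order_tendstoD) (use e in simp)
  moreover have "\<forall>\<^sub>F i in sequentially. dist (simple_bochner_integral ?M (s i)) v < e"
    using s(3) e by (rule tendstoD)
  ultimately have "\<forall>\<^sub>F i in sequentially. (\<integral>\<^sup>+x. ennreal (norm (f x - s i x)) \<partial>?M) < ennreal e \<and>
      dist (simple_bochner_integral ?M (s i)) v < e" by (rule eventually_conj)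
  then obtain i where i: "(\<integral>\<^sup>+x. ennreal (norm (f x - s i x)) \<partial>?M) < ennreal e"
      "dist (simple_bochner_integral ?M (s i)) v < e"
    using eventually_happens'[OF sequentially_bot] by blast
  have sf: "simple_function ?M (s i)" using s(1)[of i] by (auto elim: simple_bochner_integrable.cases)
  have "(\<lambda>x. f x - s i x) \<in> borel_measurable ?M"
    by (intro strongly_measurable_borel[OF M] strongly_measurable_diff[OF sm strongly_measurable_simple[OF sf]])
  then have "(\<lambda>x. norm (f x - s i x)) \<in> borel_measurable ?M" by measurable
  then have g: "integrable ?M (\<lambda>x. norm (f x - s i x))"
    using i(1) by (intro integrableI_nonneg) (auto intro: order_less_trans)
  then have "ennreal (integral\<^sup>L ?M (\<lambda>x. norm (f x - s i x))) = (\<integral>\<^sup>+x. ennreal (norm (f x - s i x)) \<partial>?M)"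
    by (intro nn_integral_eq_integral[symmetric]) auto
  then have "integral\<^sup>L ?M (\<lambda>x. norm (f x - s i x)) < e"
    using i(1) e by (metis ennreal_less_iff integral_nonneg_AE AE_I2 norm_ge_zero)
  then show "\<exists>s w g r. (s has_integral w) {a..b} \<and> (g has_integral r) {a..b} \<and>
      r < e \<and> norm (w - v) < e \<and> (\<forall>x\<in>{a..b}. norm (f x - s x) \<le> g x)"
    using simple_bochner_has_integral[OF s(1)[of i]] has_integral_integral_lebesgue_on[OF g] i(2)
    by (intro exI[of _ "s i"] exI conjI) (auto simp: dist_norm)
qed

lemma
  fixes f :: "real \<Rightarrow> 'a::banach"
  assumes f: "bochner_integrable (lebesgue_on {a..b}) f"
  shows bochner_integrable_integrable_on: "f integrable_on {a..b}"
    and bochner_integral_eq_integral: "bochner_integral (lebesgue_on {a..b}) f = integral {a..b} f"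
    and bochner_integrable_norm_integrable_on: "(\<lambda>x. norm (f x)) integrable_on {a..b}"
proof -
  have M: "complete_measure (lebesgue_on {a..b})" by (rule complete_measure_lebesgue_on) simp
  have *: "(f has_integral bochner_integral (lebesgue_on {a..b}) f) {a..b}"
    by (rule has_bochner_has_integral[OF bochner_integrable_has_bochner[OF M f]])
  then show "f integrable_on {a..b}" "bochner_integral (lebesgue_on {a..b}) f = integral {a..b} f"
    by (auto simp: integrable_on_def integral_unique)
  note f' = bochner_integrableD[OF M f]
  have "integrable (lebesgue_on {a..b}) (\<lambda>x. norm (f x))"
    using strongly_measurable_borel[OF M f'(1)] f'(2) by (intro integrableI_nonneg) auto
  then show "(\<lambda>x. norm (f x)) integrable_on {a..b}" by (rule integrable_on_lebesgue_on) simp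
qed

lemma bochner_integral_compact_support:
  fixes f :: "real \<Rightarrow> 'a::banach"
  assumes f: "bochner_integrable (lebesgue_on {a..b}) f" and z: "\<And>x. x \<notin> {a..b} \<Longrightarrow> f x = 0"
  shows "bochner_integral lebesgue f = integral {a..b} f"
proof -
  let ?M = "lebesgue_on {a..b}"
  have M: "complete_measure ?M" by (rule complete_measure_lebesgue_on) simp
  have S: "{a..b} \<inter> space lebesgue \<in> sets lebesgue" by simp
  have fz: "(\<lambda>x. indicator {a..b} x *\<^sub>R f x) = f" using z by (auto split: split_indicator)
  have "has_bochner ?M f (integral {a..b} f)"
    using bochner_integrable_has_bochner[OF M f] by (simp add: bochner_integral_eq_integral[OF f])
  then obtain s where sm: "strongly_measurable ?M f"
    and s: "\<And>i::nat. simple_bochner_integrable ?M (s i)"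
      "(\<lambda>i. \<integral>\<^sup>+x. ennreal (norm (f x - s i x)) \<partial>?M) \<longlonglongrightarrow> 0"
      "(\<lambda>i. simple_bochner_integral ?M (s i)) \<longlonglongrightarrow> integral {a..b} f"
    unfolding has_bochner_def by blast
  let ?s = "\<lambda>i x. indicator {a..b} x *\<^sub>R s i x"
  have "strongly_measurable lebesgue f"
    using sm strongly_measurable_lebesgue_on[of "{a..b}" f] fz by simp
  moreover have "simple_bochner_integrable lebesgue (?s i)" for i
    using s(1)[of i] simple_bochner_integrable_restrict_space[OF S, of "s i"] by simp
  moreover have "(\<integral>\<^sup>+x. ennreal (norm (f x - ?s i x)) \<partial>lebesgue) = (\<integral>\<^sup>+x. ennreal (norm (f x - s i x)) \<partial>?M)" for i
    unfolding nn_integral_restrict_space[OF S] using z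
    by (intro nn_integral_cong) (auto split: split_indicator)
  moreover have "simple_bochner_integral lebesgue (?s i) = simple_bochner_integral ?M (s i)" for i
    using simple_bochner_integral_restrict_space[OF S s(1)[of i]] by simp
  ultimately have "has_bochner lebesgue f (integral {a..b} f)"
    unfolding has_bochner_def using s(2,3) by (intro conjI exI[of _ ?s]) simp_all
  then show ?thesis by (rule has_bochner_integral_eq[OF complete_measure_lebesgue])
qed

section \<open>Locally integrable functions and their primitives\<close>

text \<open>
  These sets are closed under moving to the right, so that the averages \<open>M\<^sub>h f\<close> are again functions on \<open>J\<close>.
\<close>

definition half_line :: "real set \<Rightarrow> bool" where
  "half_line J \<longleftrightarrow> J = UNIV \<or> (\<exists>\<alpha>. J = {\<alpha><..} \<or> J = {\<alpha>..})"

lemma half_lineD: "half_line J \<Longrightarrow> x \<in> J \<Longrightarrow> x \<le> y \<Longrightarrow> y \<in> J"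
  by (auto simp: half_line_def)

lemma half_line_nonempty: "half_line J \<Longrightarrow> J \<noteq> {}"
  unfolding half_line_def by (metis UNIV_not_empty lessThan_iff gt_ex greaterThan_iff atLeast_iff order_refl empty_iff)

lemma half_line_sets [simp]: "half_line J \<Longrightarrow> J \<in> sets lebesgue"
  by (auto simp: half_line_def)

lemma half_line_UNIV: "half_line UNIV" by (simp add: half_line_def)

lemma half_line_interval: "half_line J \<Longrightarrow> a \<in> J \<Longrightarrow> {a..b} \<subseteq> J"
  by (auto intro: half_lineD)

lemma strongly_measurable_continuous:
  fixes f :: "real \<Rightarrow> 'a::real_normed_vector"
  assumes f: "continuous_on {a..b} f"
  shows "strongly_measurable (lebesgue_on {a..b}) f"
proof -
  \<comment> \<open>the values of \<open>f\<close> at the largest multiple of \<open>1 / (i + 1)\<close> below \<open>x\<close>, moved into \<open>[a, b]\<close> by the maximum\<close>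
  define q :: "nat \<Rightarrow> real \<Rightarrow> real" where "q i x = max a (of_int \<lfloor>x * real (Suc i)\<rfloor> / real (Suc i))" for i x
  have simp_fl: "simple_function (lebesgue_on {a..b}) (\<lambda>x. \<lfloor>x * real (Suc i)\<rfloor>)" for i
    unfolding simple_function_eq_measurable
  proof
    have "(\<lambda>x. \<lfloor>x * real (Suc i)\<rfloor>) ` {a..b} \<subseteq> {\<lfloor>a * real (Suc i)\<rfloor>..\<lfloor>b * real (Suc i)\<rfloor>}"
      by (auto intro!: floor_mono mult_right_mono)
    then show "finite ((\<lambda>x. \<lfloor>x * real (Suc i)\<rfloor>) ` space (lebesgue_on {a..b}))"
      by (simp add: finite_subset)
    have "(\<lambda>x::real. \<lfloor>x * real (Suc i)\<rfloor>) \<in> borel \<rightarrow>\<^sub>M count_space UNIV" by measurable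
    then have "(\<lambda>x::real. \<lfloor>x * real (Suc i)\<rfloor>) \<in> lborel \<rightarrow>\<^sub>M count_space UNIV" by (simp add: measurable_lborel1)
    then show "(\<lambda>x. \<lfloor>x * real (Suc i)\<rfloor>) \<in> lebesgue_on {a..b} \<rightarrow>\<^sub>M count_space UNIV"
      by (intro measurable_restrict_space1 measurable_completion)
  qed
  have "simple_function (lebesgue_on {a..b}) (\<lambda>x. f (q i x))" for i
    using simple_function_compose1[OF simp_fl[of i], of "\<lambda>k. f (max a (of_int k / real (Suc i)))"]
    unfolding q_def .
  moreover have "(\<lambda>i. f (q i x)) \<longlonglongrightarrow> f x" if x: "x \<in> {a..b}" for x
  proof -
    have qx: "q i x \<in> {a..b}" for i
    proof -
      have "of_int \<lfloor>x * real (Suc i)\<rfloor> / real (Suc i) \<le> x" by (simp add: divide_le_eq del: of_nat_Suc)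
      then show ?thesis using x by (auto simp: q_def)
    qed
    have lim: "(\<lambda>i. q i x) \<longlonglongrightarrow> x"
    proof (rule tendsto_sandwich[OF _ _ _ tendsto_const])
      show "\<forall>\<^sub>F i in sequentially. x - inverse (real (Suc i)) \<le> q i x"
      proof (intro always_eventually allI)
        fix i
        have "x * real (Suc i) - 1 \<le> of_int \<lfloor>x * real (Suc i)\<rfloor>" by linarith
        then have "(x * real (Suc i) - 1) / real (Suc i) \<le> of_int \<lfloor>x * real (Suc i)\<rfloor> / real (Suc i)"
          by (rule divide_right_mono) simp
        then show "x - inverse (real (Suc i)) \<le> q i x"
          by (simp add: q_def diff_divide_distrib inverse_eq_divide del: of_nat_Suc)
      qed
      show "\<forall>\<^sub>F i in sequentially. q i x \<le> x"
      proof (intro always_eventually allI)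
        fix i
        have "of_int \<lfloor>x * real (Suc i)\<rfloor> / real (Suc i) \<le> x" by (simp add: divide_le_eq del: of_nat_Suc)
        then show "q i x \<le> x" using x by (simp add: q_def)
      qed
      show "(\<lambda>i. x - inverse (real (Suc i))) \<longlonglongrightarrow> x"
        using tendsto_diff[OF tendsto_const LIMSEQ_inverse_real_of_nat, of x] by simp
    qed
    have "(f \<longlongrightarrow> f x) (at x within {a..b})" using f x by (auto simp: continuous_on_def)
    then show ?thesis
      using f x qx lim by (intro continuous_on_tendsto_compose[OF f lim]) auto
  qed
  ultimately show ?thesis
    unfolding strongly_measurable_def by (intro exI[of _ "\<lambda>i x. f (q i x)"]) (auto intro!: AE_I2)
qed

lemma bochner_integrable_scaleC_continuous:
  fixes f :: "real \<Rightarrow> 'a::complex_banach"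
  assumes f: "bochner_integrable (lebesgue_on {a..b}) f" and c: "continuous_on {a..b} c"
  shows "bochner_integrable (lebesgue_on {a..b}) (\<lambda>t. c t *\<^sub>C f t)"
proof -
  have M: "complete_measure (lebesgue_on {a..b})" by (rule complete_measure_lebesgue_on) simp
  note f' = bochner_integrableD[OF M f]
  have fm: "f \<in> borel_measurable (lebesgue_on {a..b})" by (rule strongly_measurable_borel[OF M f'(1)])
  obtain B where B: "\<And>x. x \<in> {a..b} \<Longrightarrow> norm (c x) \<le> B" "B \<ge> 0"
    using compact_imp_bounded[OF compact_continuous_image[OF c]] unfolding bounded_pos by (force simp: less_imp_le)
  have "(\<integral>\<^sup>+x. ennreal (norm (c x *\<^sub>C f x)) \<partial>lebesgue_on {a..b}) \<le> (\<integral>\<^sup>+x. ennreal (B * norm (f x)) \<partial>lebesgue_on {a..b})"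
    using B by (intro nn_integral_mono ennreal_leI) (auto simp: norm_scaleC intro!: mult_right_mono)
  also have "\<dots> = ennreal B * (\<integral>\<^sup>+x. ennreal (norm (f x)) \<partial>lebesgue_on {a..b})"
    using B fm by (simp add: ennreal_mult nn_integral_cmult)
  also have "\<dots> < \<infinity>" using f'(2) by (simp add: ennreal_mult_less_top)
  finally show ?thesis
    by (intro bochner_integrableI[OF M] strongly_measurable_bilinear[OF bounded_bilinear_scaleC _ f'(1)]
        strongly_measurable_continuous c)
qed

lemma bochner_integrable_continuous:
  fixes f :: "real \<Rightarrow> 'a::banach"
  assumes f: "continuous_on {a..b} f"
  shows "bochner_integrable (lebesgue_on {a..b}) f"
proof -
  have M: "complete_measure (lebesgue_on {a..b})" by (rule complete_measure_lebesgue_on) simp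
  obtain B where B: "\<And>x. x \<in> {a..b} \<Longrightarrow> norm (f x) \<le> B"
    using compact_imp_bounded[OF compact_continuous_image[OF f]] unfolding bounded_pos by force
  have "(\<integral>\<^sup>+x. ennreal (norm (f x)) \<partial>lebesgue_on {a..b}) \<le> (\<integral>\<^sup>+x. ennreal B \<partial>lebesgue_on {a..b})"
    using B by (intro nn_integral_mono ennreal_leI) auto
  also have "\<dots> < \<infinity>"
    using emeasure_compact_finite[of "{a..b}"] by (simp add: emeasure_restrict_space ennreal_mult_less_top)
  finally show ?thesis
    by (intro bochner_integrableI[OF M] strongly_measurable_continuous f)
qed

lemma L1locD:
  assumes "half_line J" "f \<in> L1loc J" "a \<in> J"
  shows "bochner_integrable (lebesgue_on {a..b}) f"
  using assms half_line_interval[of J a b] by (auto simp: L1loc_def)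

lemma L1loc_iff:
  assumes J: "half_line J"
  shows "f \<in> L1loc J \<longleftrightarrow> (\<forall>a\<in>J. \<forall>b. bochner_integrable (lebesgue_on {a..b}) f)"
proof
  assume f: "\<forall>a\<in>J. \<forall>b. bochner_integrable (lebesgue_on {a..b}) f"
  obtain c where c: "c \<in> J" using half_line_nonempty[OF J] by blast
  show "f \<in> L1loc J"
    unfolding L1loc_def
  proof (intro CollectI allI impI, elim conjE)
    fix K assume K: "compact K" "K \<subseteq> J"
    obtain a b where ab: "K \<subseteq> {a..b}" "a \<in> J"
    proof (cases "K = {}")
      case True then show ?thesis using c that by blast
    next
      case False
      then obtain a b where "a \<in> K" "\<And>x. x\<in>K \<Longrightarrow> a \<le> x" "\<And>x. x\<in>K \<Longrightarrow> x \<le> b"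
        using compact_attains_inf[OF K(1)] compact_attains_sup[OF K(1)] by blast
      then have "K \<subseteq> {a..b}" "a \<in> J" using K(2) by auto
      then show ?thesis by (rule that)
    qed
    then show "bochner_integrable (lebesgue_on K) f"
      using f K compact_imp_closed[OF K(1)] by (intro bochner_integrable_lebesgue_on_subset[of "{a..b}" K f]) auto
  qed
qed (use L1locD[OF J] in blast)

lemma continuous_L1loc:
  assumes "half_line J" "continuous_on J f"
  shows "f \<in> L1loc J"
  unfolding L1loc_iff[OF assms(1)]
  using continuous_on_subset[OF assms(2) half_line_interval[OF assms(1)]] by (auto intro: bochner_integrable_continuous)

lemma L1loc_scaleC:
  assumes J: "half_line J" and f: "f \<in> L1loc J" and c: "continuous_on UNIV c"
  shows "(\<lambda>t. c t *\<^sub>C f t) \<in> L1loc J"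
  using L1locD[OF J f] continuous_on_subset[OF c] unfolding L1loc_iff[OF J]
  by (auto intro!: bochner_integrable_scaleC_continuous)

lemma bochner_integral_shift:
  fixes f :: "real \<Rightarrow> 'a::complex_banach"
  assumes J: "half_line J" and f: "f \<in> L1loc J" and x: "x \<in> J"
  shows "bochner_integral (lebesgue_on {0..T}) (\<lambda>s. f (x + s)) = integral {x..x+T} f"
proof -
  have "bochner_integrable lebesgue (\<lambda>u. indicator {x..x+T} u *\<^sub>R f u)"
    using L1locD[OF J f x, of "x+T"] by (simp add: bochner_integrable_lebesgue_on)
  from bochner_integrable_translate[OF this, of x]
  have "bochner_integrable lebesgue (\<lambda>s. indicator {0..T} s *\<^sub>R f (x + s))"
    by (rule back_subst[where P="bochner_integrable lebesgue"]) (auto simp: fun_eq_iff split: split_indicator)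
  then have b: "bochner_integrable (lebesgue_on {0..T}) (\<lambda>s. f (x + s))"
    by (simp add: bochner_integrable_lebesgue_on)
  have "(f has_integral integral {x..x+T} f) {0+x..T+x}"
    using bochner_integrable_integrable_on[OF L1locD[OF J f x, of "x+T"]]
    by (simp add: integrable_integral add.commute)
  then have "((\<lambda>s. f (x + s)) has_integral integral {x..x+T} f) {0..T}"
    unfolding has_integral_shift_Icc_real[symmetric] by (simp add: comp_def)
  then show ?thesis using bochner_integral_eq_integral[OF b] by (simp add: integral_unique)
qed

text \<open>
  The integrals of \<open>f\<close> over intervals are the increments of a primitive \<open>F\<close>, and \<open>F\<close> is continuous.
  Averages, means and convolutions of a locally integrable function thereby become integrals of
  continuous functions, to which the fundamental theorem of calculus applies.
\<close>

definition primitive_on :: "real set \<Rightarrow> (real \<Rightarrow> 'a::real_normed_vector) \<Rightarrow> (real \<Rightarrow> 'a) \<Rightarrow> bool" where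
  "primitive_on J f F \<longleftrightarrow> (\<forall>a\<in>J. \<forall>b\<ge>a. (f has_integral (F b - F a)) {a..b})"

lemma primitive_onD:
  "primitive_on J f F \<Longrightarrow> a \<in> J \<Longrightarrow> a \<le> b \<Longrightarrow> (f has_integral (F b - F a)) {a..b}"
  by (auto simp: primitive_on_def)

lemma primitive_on_integral:
  "primitive_on J f F \<Longrightarrow> a \<in> J \<Longrightarrow> a \<le> b \<Longrightarrow> integral {a..b} f = F b - F a"
  by (auto simp: primitive_on_def integral_unique)

lemma primitive_on_of_derivative:
  fixes U :: "real \<Rightarrow> 'a::banach"
  assumes "\<And>t. (U has_vector_derivative u t) (at t)"
  shows "primitive_on J u U"
  unfolding primitive_on_def
proof (intro ballI allI impI)
  fix a b :: real assume "a \<le> b"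
  then show "(u has_integral U b - U a) {a..b}"
    by (rule fundamental_theorem_of_calculus) (rule has_vector_derivative_at_within[OF assms])
qed

lemma L1loc_integrable:
  assumes "half_line J" "f \<in> L1loc J" "a \<in> J"
  shows "f integrable_on {a..b}" "(\<lambda>x. norm (f x)) integrable_on {a..b}"
  using L1locD[OF assms, of b] by (auto intro: bochner_integrable_integrable_on bochner_integrable_norm_integrable_on)

lemma ex_primitive_on:
  fixes f :: "real \<Rightarrow> 'a::banach"
  assumes J: "half_line J" and f: "\<And>a b. a \<in> J \<Longrightarrow> f integrable_on {a..b}"
  shows "\<exists>F. primitive_on J f F"
proof -
  obtain c where c: "c \<in> J" using half_line_nonempty[OF J] by blast
  define F where "F t = (if c \<le> t then integral {c..t} f else - integral {t..c} f)" for t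
  note comb = Henstock_Kurzweil_Integration.integral_combine
  have "integral {a..b} f = F b - F a" if ab: "a \<in> J" "a \<le> b" for a b
  proof -
    consider "c \<le> a" | "a < c" "c \<le> b" | "b < c" by linarith
    then show ?thesis
    proof cases
      case 1 then show ?thesis using comb[of c a b f] f[OF c] ab by (simp add: F_def algebra_simps)
    next
      case 2 then show ?thesis using comb[of a c b f] f[OF ab(1)] ab by (simp add: F_def add.commute)
    next
      case 3 then show ?thesis using comb[of a b c f] f[OF ab(1)] ab by (simp add: F_def algebra_simps)
    qed
  qed
  then have "primitive_on J f F"
    unfolding primitive_on_def using integrable_integral[OF f] by metis
  then show "\<exists>F::real \<Rightarrow> 'a. primitive_on J f F" by (intro exI[where x=F])
qed

lemma primitive_on_continuous:
  fixes f :: "real \<Rightarrow> 'a::banach"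
  assumes J: "half_line J" and F: "primitive_on J f F"
  shows "continuous_on J F"
  unfolding continuous_on_eq_continuous_within
proof
  fix x assume x: "x \<in> J"
  \<comment> \<open>a point of \<open>J\<close> to the left of \<open>x\<close>, or \<open>x\<close> itself if it is the left end point\<close>
  obtain a where a: "a \<in> J" "a \<le> x" "a < x \<or> (\<forall>y\<in>J. x \<le> y)"
    using x by (metis less_imp_le not_less order_refl)
  have "f integrable_on {a..x+1}" using primitive_onD[OF F a(1)] a(2) by (meson add_increasing2 integrable_on_def zero_le_one)
  then have "continuous_on {a..x+1} (\<lambda>t. integral {a..t} f)" by (rule indefinite_integral_continuous_1)
  then have "continuous_on {a..x+1} (\<lambda>t. integral {a..t} f + F a)" by (intro continuous_intros)
  moreover have "integral {a..t} f + F a = F t" if "t \<in> {a..x+1}" for t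
    using primitive_on_integral[OF F a(1), of t] that by auto
  ultimately have "continuous_on {a..x+1} F" by (metis (no_types, lifting) continuous_on_eq)
  then have "continuous (at x within {a..x+1}) F"
    using a(2) by (simp add: continuous_on_eq_continuous_within)
  moreover have "at x within J = at x within {a..x+1}"
  proof (rule at_within_nhd[of x "{y. (a < x \<longrightarrow> a < y) \<and> y < x + 1}"])
    have "{y. (a < x \<longrightarrow> a < y) \<and> y < x + 1} = (if a < x then {a<..<x+1} else {..<x+1})" by auto
    then show "open {y. (a < x \<longrightarrow> a < y) \<and> y < x + 1}" by simp
    show "J \<inter> {y. (a < x \<longrightarrow> a < y) \<and> y < x + 1} - {x} = {a..x+1} \<inter> {y. (a < x \<longrightarrow> a < y) \<and> y < x + 1} - {x}"
      using a half_lineD[OF J a(1)] by auto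
  qed (use a in auto)
  ultimately show "continuous (at x within J) F" by simp
qed

lemma L1loc_primitive:
  assumes "half_line J" "f \<in> L1loc J"
  obtains F where "primitive_on J f F" "continuous_on J F"
  using ex_primitive_on[OF assms(1) L1loc_integrable(1)[OF assms]] primitive_on_continuous[OF assms(1)] by blast

text \<open>
  Integration by parts for a merely integrable \<open>f\<close>: the difference of the two sides has derivative
  zero everywhere, because over a short interval \<open>\<phi>\<close> changes by a multiple of the length while the
  integral of \<open>\<parallel>f\<parallel>\<close> is small.
\<close>

lemma has_integral_scaleC_by_parts:
  fixes f :: "real \<Rightarrow> 'a::complex_banach"
  assumes J: "half_line J" and f: "f \<in> L1loc J" and F: "primitive_on J f F"
    and \<phi>: "\<And>t. (\<phi> has_vector_derivative \<phi>' t) (at t)" and \<phi>': "continuous_on UNIV \<phi>'"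
    and ab: "a \<in> J" "a \<le> b"
  shows "((\<lambda>t. \<phi> t *\<^sub>C f t) has_integral
           (\<phi> b *\<^sub>C F b - \<phi> a *\<^sub>C F a - integral {a..b} (\<lambda>t. \<phi>' t *\<^sub>C F t))) {a..b}"
proof -
  note comb = Henstock_Kurzweil_Integration.integral_combine
  have cphi: "continuous_on S \<phi>" for S
    using \<phi> by (meson continuous_at_imp_continuous_on has_vector_derivative_continuous)
  have cF: "continuous_on J F" by (rule primitive_on_continuous[OF J F])
  have sub: "{s..t} \<subseteq> J" if "s \<in> {a..b}" for s t using that ab half_lineD[OF J] by auto
  have inJ: "s \<in> J" if "s \<in> {a..b}" for s using that ab half_lineD[OF J] by auto
  have int1: "(\<lambda>t. \<phi> t *\<^sub>C f t) integrable_on {s..t}" if "s \<in> {a..b}" for s t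
    using L1loc_integrable(1)[OF J L1loc_scaleC[OF J f cphi] inJ[OF that]] .
  have int2: "(\<lambda>t. \<phi>' t *\<^sub>C F t) integrable_on {s..t}" if "s \<in> {a..b}" for s t
    by (intro integrable_continuous_interval scaleC.continuous_on continuous_on_subset[OF \<phi>'] continuous_on_subset[OF cF] sub that) auto
  note intf = L1loc_integrable(1)[OF J f inJ] and intn = L1loc_integrable(2)[OF J f inJ]
  define N where "N t = integral {a..t} (\<lambda>x. norm (f x))" for t
  define D where "D t = integral {a..t} (\<lambda>t. \<phi> t *\<^sub>C f t) - \<phi> t *\<^sub>C F t + integral {a..t} (\<lambda>t. \<phi>' t *\<^sub>C F t)" for t
  have cN: "continuous_on {a..b} N"
    unfolding N_def by (rule indefinite_integral_continuous_1) (use intn ab in auto)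
  obtain L where L: "L > 0" "\<And>t. t \<in> {a..b} \<Longrightarrow> norm (\<phi>' t) \<le> L"
    using compact_imp_bounded[OF compact_continuous_image[OF continuous_on_subset[OF \<phi>', of "{a..b}"]]]
    unfolding bounded_pos by force
  have Lip: "norm (\<phi> t - \<phi> s) \<le> L * \<bar>t - s\<bar>" if "s \<in> {a..b}" "t \<in> {a..b}" for s t
  proof -
    have "norm (\<phi> t - \<phi> s) \<le> L * norm (t - s)"
    proof (rule differentiable_bound[OF convex_closed_interval[of a b, unfolded box_real], where f'="\<lambda>x h. h *\<^sub>R \<phi>' x"])
      show "(\<phi> has_derivative (\<lambda>h. h *\<^sub>R \<phi>' x)) (at x within {a..b})" for x
        using \<phi>[of x] by (auto simp: has_vector_derivative_def intro: has_derivative_at_withinI)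
      show "onorm (\<lambda>h. h *\<^sub>R \<phi>' x) \<le> L" if "x \<in> {a..b}" for x
        using L(1) L(2)[OF that] by (intro onorm_bound) (simp_all add: mult.commute[of L] mult_left_mono)
    qed (use that in auto)
    then show ?thesis by simp
  qed
  \<comment> \<open>both \<open>\<phi>\<close> inside the first integral and \<open>F\<close> inside the second are compared with their values at an end point\<close>
  have key: "norm (D t - D s) \<le> L * (t - s) * ((N t - N s) + d)"
    if st: "s \<in> {a..b}" "t \<in> {a..b}" "s \<le> t" and d: "\<And>u. u \<in> {s..t} \<Longrightarrow> norm (F t - F u) \<le> d" for s t d
  proof -
    have "integral {s..t} (\<lambda>u. (\<phi> u - \<phi> s) *\<^sub>C f u) = integral {s..t} (\<lambda>u. \<phi> u *\<^sub>C f u) - \<phi> s *\<^sub>C (F t - F s)"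
    proof -
      have "((\<lambda>u. \<phi> s *\<^sub>C f u) has_integral \<phi> s *\<^sub>C (F t - F s)) {s..t}"
        using has_integral_linear[OF primitive_onD[OF F inJ[OF st(1)] st(3)] scaleC.bounded_linear_right[of "\<phi> s"]]
        by (simp add: comp_def)
      from has_integral_diff[OF integrable_integral[OF int1[OF st(1)]] this]
      show ?thesis by (simp add: scaleC.diff_left integral_unique)
    qed
    moreover have "integral {s..t} (\<lambda>u. \<phi>' u *\<^sub>C (F t - F u)) = (\<phi> t - \<phi> s) *\<^sub>C F t - integral {s..t} (\<lambda>u. \<phi>' u *\<^sub>C F u)"
    proof -
      have "(\<phi>' has_integral (\<phi> t - \<phi> s)) {s..t}"
        by (rule fundamental_theorem_of_calculus[OF st(3)]) (use \<phi> has_vector_derivative_at_within in blast)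
      from has_integral_linear[OF this scaleC.bounded_linear_left[of "F t"]]
      have "((\<lambda>u. \<phi>' u *\<^sub>C F t) has_integral (\<phi> t - \<phi> s) *\<^sub>C F t) {s..t}" by (simp add: comp_def)
      from has_integral_diff[OF this integrable_integral[OF int2[OF st(1)]]]
      show ?thesis by (simp add: scaleC.diff_right integral_unique)
    qed
    moreover have "integral {a..t} (\<lambda>t. \<phi> t *\<^sub>C f t) = integral {a..s} (\<lambda>t. \<phi> t *\<^sub>C f t) + integral {s..t} (\<lambda>t. \<phi> t *\<^sub>C f t)"
      using st by (intro comb[symmetric] int1) auto
    moreover have "integral {a..t} (\<lambda>t. \<phi>' t *\<^sub>C F t) = integral {a..s} (\<lambda>t. \<phi>' t *\<^sub>C F t) + integral {s..t} (\<lambda>t. \<phi>' t *\<^sub>C F t)"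
      using st by (intro comb[symmetric] int2) auto
    ultimately have eq: "D t - D s = integral {s..t} (\<lambda>u. (\<phi> u - \<phi> s) *\<^sub>C f u) - integral {s..t} (\<lambda>u. \<phi>' u *\<^sub>C (F t - F u))"
      by (simp add: D_def scaleC.diff_left scaleC.diff_right)
    have "norm (integral {s..t} (\<lambda>u. (\<phi> u - \<phi> s) *\<^sub>C f u)) \<le> integral {s..t} (\<lambda>u. L * (t - s) * norm (f u))"
    proof (rule Henstock_Kurzweil_Integration.integral_norm_bound_integral)
      show "(\<lambda>u. (\<phi> u - \<phi> s) *\<^sub>C f u) integrable_on {s..t}"
        by (rule L1loc_integrable(1)[OF J L1loc_scaleC[OF J f] inJ[OF st(1)]]) (intro continuous_intros cphi)
      show "(\<lambda>u. L * (t - s) * norm (f u)) integrable_on {s..t}"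
        using intn[OF st(1), of t] by (intro integrable_on_mult_right) auto
      show "norm ((\<phi> u - \<phi> s) *\<^sub>C f u) \<le> L * (t - s) * norm (f u)" if "u \<in> {s..t}" for u
      proof -
        have "norm (\<phi> u - \<phi> s) \<le> L * \<bar>u - s\<bar>" using that st by (intro Lip) auto
        also have "\<dots> \<le> L * (t - s)" using that L(1) by auto
        finally show ?thesis by (simp add: norm_scaleC mult_right_mono)
      qed
    qed
    also have "\<dots> = L * (t - s) * (N t - N s)"
      using comb[of a s t "\<lambda>x. norm (f x)"] intn[of a t] st ab by (auto simp: N_def)
    finally have 1: "norm (integral {s..t} (\<lambda>u. (\<phi> u - \<phi> s) *\<^sub>C f u)) \<le> L * (t - s) * (N t - N s)" .
    have 2: "norm (integral {s..t} (\<lambda>u. \<phi>' u *\<^sub>C (F t - F u))) \<le> (L * d) * (t - s)"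
    proof (rule integral_bound[OF st(3)])
      show "continuous_on {s..t} (\<lambda>u. \<phi>' u *\<^sub>C (F t - F u))"
        by (intro scaleC.continuous_on continuous_intros continuous_on_subset[OF \<phi>'] continuous_on_subset[OF cF] sub st) auto
      show "norm (\<phi>' u *\<^sub>C (F t - F u)) \<le> L * d" if "u \<in> {s..t}" for u
        using L(1) L(2)[of u] d[OF that] that st by (auto simp: norm_scaleC intro!: mult_mono)
    qed
    show ?thesis
      unfolding eq using norm_triangle_ineq4[of "integral {s..t} (\<lambda>u. (\<phi> u - \<phi> s) *\<^sub>C f u)" "integral {s..t} (\<lambda>u. \<phi>' u *\<^sub>C (F t - F u))"] 1 2
      by (simp add: algebra_simps)
  qed
  have "\<exists>c. \<forall>x\<in>{a..b}. D x = c"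
  proof (rule has_derivative_zero_constant)
    fix x assume x: "x \<in> {a..b}"
    show "(D has_derivative (\<lambda>h. 0)) (at x within {a..b})"
      unfolding has_derivative_within_alt
    proof (intro conjI allI impI)
      fix e :: real assume e: "e > 0"
      define e' where "e' = e / (2 * L)"
      have e': "e' > 0" "L * (e' + e') = e" using e L(1) by (auto simp: e'_def)
      have "uniformly_continuous_on {a..b} N" "uniformly_continuous_on {a..b} F"
        using cN cF continuous_on_subset[OF cF sub[of a b]] ab by (auto intro!: compact_uniformly_continuous)
      then obtain d1 d2 where d: "d1 > 0" "\<And>s t. s \<in> {a..b} \<Longrightarrow> t \<in> {a..b} \<Longrightarrow> \<bar>t - s\<bar> < d1 \<Longrightarrow> \<bar>N t - N s\<bar> < e'"
        "d2 > 0" "\<And>s t. s \<in> {a..b} \<Longrightarrow> t \<in> {a..b} \<Longrightarrow> \<bar>t - s\<bar> < d2 \<Longrightarrow> norm (F t - F s) < e'"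
        using e'(1) unfolding uniformly_continuous_on_def dist_norm real_norm_def by metis
      have *: "norm (D t - D s) \<le> e * (t - s)" if st: "s \<in> {a..b}" "t \<in> {a..b}" "s \<le> t" "t - s < min d1 d2" for s t
      proof -
        have "norm (F t - F u) \<le> e'" if "u \<in> {s..t}" for u
          using d(4)[of u t] that st by auto
        from key[OF st(1-3) this] have "norm (D t - D s) \<le> L * (t - s) * ((N t - N s) + e')" .
        also have "\<dots> \<le> L * (t - s) * (e' + e')"
          using d(2)[of s t] st L(1) by (intro mult_left_mono) auto
        also have "\<dots> = L * (e' + e') * (t - s)" by simp
        finally show ?thesis unfolding e'(2) .
      qed
      show "\<exists>d>0. \<forall>y\<in>{a..b}. norm (y - x) < d \<longrightarrow> norm (D y - D x - 0) \<le> e * norm (y - x)"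
      proof (intro exI[of _ "min d1 d2"] conjI ballI impI)
        fix y assume y: "y \<in> {a..b}" "norm (y - x) < min d1 d2"
        show "norm (D y - D x - 0) \<le> e * norm (y - x)"
          using *[of x y] *[of y x] x y by (cases "x \<le> y") (auto simp: norm_minus_commute)
      qed (use d in auto)
    qed simp
  qed simp
  then have "D b = D a" using ab by auto
  then have "integral {a..b} (\<lambda>t. \<phi> t *\<^sub>C f t) = \<phi> b *\<^sub>C F b - \<phi> a *\<^sub>C F a - integral {a..b} (\<lambda>t. \<phi>' t *\<^sub>C F t)"
    by (simp add: D_def algebra_simps)
  then show ?thesis using integrable_integral[OF int1[of a b]] ab by simp
qed


section \<open>Modulation\<close>

definition wave :: "real \<Rightarrow> real \<Rightarrow> complex" where
  "wave \<omega> t = exp (\<i> * complex_of_real (\<omega> * t))"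

lemma modulate_wave: "modulate \<omega> f = (\<lambda>t. wave \<omega> t *\<^sub>C f t)"
  by (simp add: modulate_def wave_def fun_eq_iff)

lemma norm_wave [simp]: "norm (wave \<omega> t) = 1"
  by (simp add: wave_def norm_exp_i_times)

lemma wave_add: "wave \<omega> (s + t) = wave \<omega> s * wave \<omega> t"
  by (simp add: wave_def algebra_simps exp_add)

lemma wave_minus: "wave (- \<omega>) t * wave \<omega> t = 1"
  by (simp add: wave_def exp_add[symmetric])

lemma wave_neg_arg: "wave \<omega> (- t) = wave (- \<omega>) t"
  by (simp add: wave_def)

lemma wave_zero [simp]: "wave 0 t = 1" "wave \<omega> 0 = 1"
  by (simp_all add: wave_def)

lemma wave_derivative:
  "(wave \<omega> has_vector_derivative (\<i> * of_real \<omega> * wave \<omega> t)) (at t within S)"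
proof -
  have "((\<lambda>z. exp (\<i> * (of_real \<omega> * z))) has_field_derivative \<i> * of_real \<omega> * exp (\<i> * (of_real \<omega> * of_real t))) (at (of_real t))"
    by (auto intro!: derivative_eq_intros)
  from has_vector_derivative_real_field[OF this] show ?thesis
    by (simp add: wave_def[abs_def] has_vector_derivative_at_within)
qed

lemma continuous_on_wave [continuous_intros]: "continuous_on S (wave \<omega>)"
  unfolding wave_def by (intro continuous_intros)

lemma modulate_zero [simp]: "modulate 0 f = f"
  by (simp add: modulate_wave)

lemma modulate_L1loc: "half_line J \<Longrightarrow> f \<in> L1loc J \<Longrightarrow> modulate \<omega> f \<in> L1loc J"
  unfolding modulate_wave by (intro L1loc_scaleC continuous_intros)

section \<open>Ergodic means in terms of primitives\<close>

text \<open>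
  Uniform convergence of the means \<open>(G (x + T) - G x) / T\<close> to \<open>m\<close>, multiplied by \<open>T\<close>.
\<close>

definition mean_on :: "real set \<Rightarrow> (real \<Rightarrow> 'a::real_normed_vector) \<Rightarrow> 'a \<Rightarrow> bool" where
  "mean_on J G m \<longleftrightarrow> (\<forall>e>0. \<exists>T0>0. \<forall>T\<ge>T0. \<forall>x\<in>J. norm (G (x + T) - G x - T *\<^sub>R m) \<le> e * T)"

lemma has_erg_mean_iff:
  assumes J: "half_line J" and f: "f \<in> L1loc J" and G: "primitive_on J f G"
  shows "has_erg_mean J f m \<longleftrightarrow> mean_on J G m"
proof -
  have *: "(1 / T) *\<^sub>R bochner_integral (lebesgue_on {0..T}) (\<lambda>s. f (x + s)) = (1 / T) *\<^sub>R (G (x + T) - G x)"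
    if "x \<in> J" "T > 0" for x T
    using that by (simp add: bochner_integral_shift[OF J f] primitive_on_integral[OF G])
  have d: "norm (G (x + T) - G x - T *\<^sub>R m) = T * dist ((1 / T) *\<^sub>R (G (x + T) - G x)) m" if "T > 0" for x T
  proof -
    have "G (x + T) - G x - T *\<^sub>R m = T *\<^sub>R ((1 / T) *\<^sub>R (G (x + T) - G x) - m)"
      using that by (simp add: scaleR_diff_right)
    then show ?thesis using that by (simp add: dist_norm)
  qed
  show ?thesis
  proof
    assume "has_erg_mean J f m"
    then have u: "\<And>e. e > 0 \<Longrightarrow> \<exists>N. \<forall>T\<ge>N. \<forall>x\<in>J. dist ((1 / T) *\<^sub>R bochner_integral (lebesgue_on {0..T}) (\<lambda>s. f (x + s))) m < e"
      unfolding has_erg_mean_def uniform_limit_iff eventually_at_top_linorder by blast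
    show "mean_on J G m"
      unfolding mean_on_def
    proof (intro allI impI)
      fix e :: real assume "e > 0"
      from u[OF this] obtain N where N: "\<And>T x. T \<ge> N \<Longrightarrow> x \<in> J \<Longrightarrow>
        dist ((1 / T) *\<^sub>R bochner_integral (lebesgue_on {0..T}) (\<lambda>s. f (x + s))) m < e" by blast
      show "\<exists>T0>0. \<forall>T\<ge>T0. \<forall>x\<in>J. norm (G (x + T) - G x - T *\<^sub>R m) \<le> e * T"
      proof (intro exI[of _ "max N 1"] conjI allI impI ballI)
        fix T x assume T: "T \<ge> max N 1" and x: "x \<in> J"
        then have "T > 0" by auto
        then show "norm (G (x + T) - G x - T *\<^sub>R m) \<le> e * T"
          using N[of T x] T x *[of x T] by (simp add: d mult.commute less_imp_le)
      qed simp
    qed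
  next
    assume m: "mean_on J G m"
    show "has_erg_mean J f m"
      unfolding has_erg_mean_def uniform_limit_iff eventually_at_top_linorder
    proof (intro allI impI)
      fix e :: real assume "e > 0"
      then have "e / 2 > 0" by simp
      then obtain T0 where T0: "T0 > 0" "\<And>T x. T \<ge> T0 \<Longrightarrow> x \<in> J \<Longrightarrow> norm (G (x + T) - G x - T *\<^sub>R m) \<le> e/2 * T"
        using m unfolding mean_on_def by metis
      show "\<exists>N. \<forall>T\<ge>N. \<forall>x\<in>J. dist ((1 / T) *\<^sub>R bochner_integral (lebesgue_on {0..T}) (\<lambda>s. f (x + s))) m < e"
      proof (intro exI[of _ T0] allI impI ballI)
        fix T x assume T: "T \<ge> T0" and x: "x \<in> J"
        then have "T > 0" using T0(1) by auto
        then have "T * dist ((1 / T) *\<^sub>R (G (x + T) - G x)) m \<le> T * (e / 2)"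
          using T0(2)[OF T x] by (simp add: d mult.commute)
        then have "dist ((1 / T) *\<^sub>R (G (x + T) - G x)) m \<le> e / 2"
          using \<open>T > 0\<close> by (simp only: mult_le_cancel_left_pos)
        then show "dist ((1 / T) *\<^sub>R bochner_integral (lebesgue_on {0..T}) (\<lambda>s. f (x + s))) m < e"
          unfolding *[OF x \<open>T > 0\<close>] using \<open>e > 0\<close> by simp
      qed
    qed
  qed
qed

lemma has_erg_mean_unique:
  assumes "J \<noteq> {}" "has_erg_mean J f m" "has_erg_mean J f m'"
  shows "m = m'"
proof -
  obtain x where "x \<in> J" using assms(1) by blast
  then show ?thesis
    using assms(2,3)[unfolded has_erg_mean_def, THEN tendsto_uniform_limitI] tendsto_unique[OF trivial_limit_at_top_linorder]
    by blast
qed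

lemma erg_mean_eq: "J \<noteq> {} \<Longrightarrow> has_erg_mean J f m \<Longrightarrow> erg_mean J f = m"
  unfolding erg_mean_def by (blast intro: has_erg_mean_unique)

text \<open>
  All four classes are instances of one family: \<open>\<Omega>\<close> is the set of frequencies \<open>\<omega>\<close> for which
  \<open>\<gamma>\<^sub>\<omega> f\<close> is required to be ergodic, and \<open>z\<close> says whether the means are required to vanish.
\<close>

definition erg_class :: "real set \<Rightarrow> real set \<Rightarrow> bool \<Rightarrow> (real \<Rightarrow> 'a::complex_banach) set" where
  "erg_class J \<Omega> z = {f \<in> L1loc J. \<forall>\<omega>\<in>\<Omega>. \<exists>m. (z \<longrightarrow> m = 0) \<and> has_erg_mean J (modulate \<omega> f) m}"

lemma Erg0_iff: "J \<noteq> {} \<Longrightarrow> f \<in> Erg0 J \<longleftrightarrow> f \<in> L1loc J \<and> has_erg_mean J f 0"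
  unfolding Erg0_def Erg_def mem_Collect_eq using erg_mean_eq[of J f] by metis

lemma
  assumes J: "half_line J"
  shows Erg_eq: "Erg J = erg_class J {0} False"
    and Erg0_eq: "Erg0 J = erg_class J {0} True"
    and TErg_eq: "TErg J = erg_class J UNIV False"
    and TErg0_eq: "TErg0 J = erg_class J UNIV True"
proof -
  have ne: "J \<noteq> {}" by (rule half_line_nonempty[OF J])
  show 1: "Erg J = erg_class J {0} False" by (simp add: Erg_def erg_class_def)
  show "Erg0 J = erg_class J {0} True"
    by (rule set_eqI) (simp add: Erg0_iff[OF ne] erg_class_def)
  show "TErg J = erg_class J UNIV False"
    using modulate_L1loc[OF J] by (auto simp: TErg_def Erg_def erg_class_def)
  show "TErg0 J = erg_class J UNIV True"
    using modulate_L1loc[OF J] by (auto simp: TErg0_def TErg_def Erg_def Erg0_iff[OF ne] erg_class_def)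
qed

lemma erg_classI:
  assumes J: "half_line J" and f: "f \<in> L1loc J"
    and "\<And>\<omega>. \<omega> \<in> \<Omega> \<Longrightarrow> \<exists>G m. primitive_on J (modulate \<omega> f) G \<and> (z \<longrightarrow> m = 0) \<and> mean_on J G m"
  shows "f \<in> erg_class J \<Omega> z"
  using assms(3) has_erg_mean_iff[OF J modulate_L1loc[OF J f]] f unfolding erg_class_def by blast

lemma erg_classD:
  assumes J: "half_line J" and f: "f \<in> erg_class J \<Omega> z" and w: "\<omega> \<in> \<Omega>" and G: "primitive_on J (modulate \<omega> f) G"
  shows "\<exists>m. (z \<longrightarrow> m = 0) \<and> mean_on J G m"
proof -
  have "f \<in> L1loc J" using f by (simp add: erg_class_def)
  then show ?thesis
    using f w has_erg_mean_iff[OF J modulate_L1loc[OF J] G] unfolding erg_class_def by blast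
qed

lemma erg_class_L1loc: "f \<in> erg_class J \<Omega> z \<Longrightarrow> f \<in> L1loc J"
  by (simp add: erg_class_def)

lemma erg_class_mono: "\<Omega>' \<subseteq> \<Omega> \<Longrightarrow> (z' \<longrightarrow> z) \<Longrightarrow> erg_class J \<Omega> z \<subseteq> erg_class J \<Omega>' z'"
  unfolding erg_class_def by blast

section \<open>Averages\<close>

lemma M_avg_eq:
  assumes "half_line J" "f \<in> L1loc J" "primitive_on J f F" "t \<in> J" "h \<ge> 0"
  shows "M_avg h f t = (1 / h) *\<^sub>R (F (t + h) - F t)"
  using assms by (simp add: M_avg_def bochner_integral_shift primitive_on_integral)

lemma continuous_on_M_avg:
  assumes J: "half_line J" and f: "f \<in> L1loc J" and h: "h \<ge> 0"
  shows "continuous_on J (M_avg h f)"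
proof -
  obtain F where F: "primitive_on J f F" "continuous_on J F" using L1loc_primitive[OF J f] by blast
  have "(\<lambda>t. t + h) ` J \<subseteq> J" using half_lineD[OF J] h by auto
  then have "continuous_on J (\<lambda>t. (1 / h) *\<^sub>R (F (t + h) - F t))"
    by (intro continuous_intros F(2) continuous_on_compose2[OF F(2)]) auto
  then show ?thesis by (rule continuous_on_eq) (simp add: M_avg_eq[OF J f F(1) _ h])
qed

lemma M_avg_L1loc: "half_line J \<Longrightarrow> f \<in> L1loc J \<Longrightarrow> h \<ge> 0 \<Longrightarrow> M_avg h f \<in> L1loc J"
  by (rule continuous_L1loc[OF _ continuous_on_M_avg])

lemma primitive_on_derivative:
  fixes u :: "real \<Rightarrow> 'a::banach"
  assumes J: "half_line J" and u: "continuous_on J u" and U: "primitive_on J u U" and a: "a \<in> J" and t: "t \<in> {a..b}"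
  shows "(U has_vector_derivative u t) (at t within {a..b})"
proof -
  have "continuous_on {a..b} u" by (rule continuous_on_subset[OF u half_line_interval[OF J a]])
  then have "((\<lambda>t. integral {a..t} u) has_vector_derivative u t) (at t within {a..b})"
    using t by (rule integral_has_vector_derivative)
  then have "((\<lambda>t. integral {a..t} u + U a) has_vector_derivative u t) (at t within {a..b})"
    by (auto intro!: derivative_eq_intros)
  then show ?thesis
    by (rule has_vector_derivative_transform[OF t, rotated])
      (use primitive_on_integral[OF U a] in auto)
qed

lemma primitive_on_shifted_derivative:
  fixes u :: "real \<Rightarrow> 'a::banach"
  assumes J: "half_line J" and u: "continuous_on J u" and U: "primitive_on J u U" and y: "y \<in> J" and s: "s \<in> {0..h}"
  shows "((\<lambda>s. U (y + s)) has_vector_derivative u (y + s)) (at s within {0..h})"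
proof -
  have "((\<lambda>s. y + s) has_vector_derivative 1) (at s within {0..h})"
    by (auto intro!: derivative_eq_intros)
  moreover have "(U has_vector_derivative u (y + s)) (at (y + s) within (\<lambda>s. y + s) ` {0..h})"
    using primitive_on_derivative[OF J u U y, of "y + s" "h + y"] s by simp
  ultimately have "(U \<circ> (\<lambda>s. y + s) has_vector_derivative 1 *\<^sub>R u (y + s)) (at s within {0..h})"
    by (rule vector_diff_chain_within)
  then show ?thesis by (simp add: comp_def)
qed

lemma primitive_on_modulate:
  fixes f :: "real \<Rightarrow> 'a::complex_banach"
  assumes J: "half_line J" and f: "f \<in> L1loc J" and F: "primitive_on J f F"
    and G: "primitive_on J (modulate \<omega> f) G" and ab: "a \<in> J" "a \<le> b"
  shows "G b - G a = wave \<omega> b *\<^sub>C F b - wave \<omega> a *\<^sub>C F a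
           - integral {a..b} (\<lambda>t. (\<i> * of_real \<omega> * wave \<omega> t) *\<^sub>C F t)"
proof -
  have "((\<lambda>t. wave \<omega> t *\<^sub>C f t) has_integral (wave \<omega> b *\<^sub>C F b - wave \<omega> a *\<^sub>C F a
           - integral {a..b} (\<lambda>t. (\<i> * of_real \<omega> * wave \<omega> t) *\<^sub>C F t))) {a..b}"
    by (rule has_integral_scaleC_by_parts[OF J f F wave_derivative _ ab]) (intro continuous_intros)
  then show ?thesis
    using primitive_onD[OF G ab] unfolding modulate_wave by (simp add: has_integral_unique)
qed

text \<open>
  Averaging \<open>f\<close> over \<open>[0, h]\<close> turns the means of \<open>\<gamma>\<^sub>\<omega> f\<close> into their averages against
  \<open>s \<mapsto> e\<^sup>-\<^sup>i\<^sup>\<omega>\<^sup>s\<close>.  Both sides equal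
  \<open>e\<^sup>-\<^sup>i\<^sup>\<omega>\<^sup>h (K (x + T + h) - K (x + h)) - (K (x + T) - K x)\<close>, where \<open>K\<close> is a primitive of
  \<open>\<gamma>\<^sub>\<omega> F\<close>; this uses \<open>G = \<gamma>\<^sub>\<omega> F - i \<omega> K\<close> up to a constant, so that \<open>e\<^sup>-\<^sup>i\<^sup>\<omega>\<^sup>s G (y + s)\<close> is the
  derivative of \<open>e\<^sup>-\<^sup>i\<^sup>\<omega>\<^sup>s K (y + s)\<close>.
\<close>

lemma integral_wave_difference:
  fixes f :: "real \<Rightarrow> 'a::complex_banach"
  assumes J: "half_line J" and f: "f \<in> L1loc J" and F: "primitive_on J f F"
    and G: "primitive_on J (modulate \<omega> f) G" and x: "x \<in> J" and T: "T \<ge> 0" and h: "h \<ge> 0"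
  shows "integral {x..x+T} (\<lambda>u. wave \<omega> u *\<^sub>C (F (u + h) - F u))
         = integral {0..h} (\<lambda>s. wave (-\<omega>) s *\<^sub>C (G (x + T + s) - G (x + s)))"
proof -
  have cF: "continuous_on J F" by (rule primitive_on_continuous[OF J F])
  define k where "k u = wave \<omega> u *\<^sub>C F u" for u
  have ck: "continuous_on J k" unfolding k_def by (intro scaleC.continuous_on continuous_intros cF)
  obtain K where K: "primitive_on J k K" using L1loc_primitive[OF J continuous_L1loc[OF J ck]] by blast
  have GK: "G b - G a = (k b - k a) - (\<i> * of_real \<omega>) *\<^sub>C (K b - K a)" if "a \<in> J" "a \<le> b" for a b
  proof -
    have "((\<lambda>t. (\<i> * of_real \<omega>) *\<^sub>C k t) has_integral (\<i> * of_real \<omega>) *\<^sub>C (K b - K a)) {a..b}"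
      using has_integral_linear[OF primitive_onD[OF K that] scaleC.bounded_linear_right] by (simp add: comp_def)
    then show ?thesis
      using primitive_on_modulate[OF J f F G that] by (simp add: k_def scaleC_scaleC integral_unique)
  qed
  have xT: "x + T \<in> J" "x + h \<in> J" "x + T + h \<in> J" using half_lineD[OF J x] T h by auto
  have "integral {x..x+T} (\<lambda>u. wave \<omega> u *\<^sub>C (F (u + h) - F u))
      = wave (-\<omega>) h *\<^sub>C (K (x + T + h) - K (x + h)) - (K (x + T) - K x)"
  proof -
    have "(k has_integral K (x + T + h) - K (x + h)) {x + h..x + T + h}"
      by (rule primitive_onD[OF K xT(2)]) (use T in simp)
    then have "((\<lambda>u. k (h + u)) has_integral K (x + T + h) - K (x + h)) {x..x+T}"
      unfolding has_integral_shift_Icc_real[symmetric] by (simp add: comp_def)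
    from has_integral_linear[OF this scaleC.bounded_linear_right[of "wave (-\<omega>) h"]]
    have 1: "((\<lambda>u. wave (-\<omega>) h *\<^sub>C k (h + u)) has_integral wave (-\<omega>) h *\<^sub>C (K (x + T + h) - K (x + h))) {x..x+T}"
      by (simp add: comp_def)
    have 2: "wave (-\<omega>) h *\<^sub>C k (h + u) = wave \<omega> u *\<^sub>C F (u + h)" for u
      by (simp add: k_def scaleC_scaleC wave_add mult.assoc[symmetric] wave_minus add.commute)
    have 3: "(k has_integral K (x + T) - K x) {x..x+T}" by (rule primitive_onD[OF K x]) (use T in simp)
    from has_integral_diff[OF 1[unfolded 2] 3] show ?thesis
      by (simp add: k_def scaleC.diff_right integral_unique)
  qed
  also have "\<dots> = integral {0..h} (\<lambda>s. wave (-\<omega>) s *\<^sub>C (G (x + T + s) - G (x + s)))"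
  proof -
    have "((\<lambda>s. wave (-\<omega>) s *\<^sub>C (G (x + T + s) - G (x + s))) has_integral
        (wave (-\<omega>) h *\<^sub>C (K (x + T + h) - K (x + h)) - wave (-\<omega>) 0 *\<^sub>C (K (x + T + 0) - K (x + 0)))) {0..h}"
    proof (rule fundamental_theorem_of_calculus[OF h])
      fix s assume s: "s \<in> {0..h}"
      have "((\<lambda>s. K (x + T + s) - K (x + s)) has_vector_derivative (k (x + T + s) - k (x + s))) (at s within {0..h})"
        by (intro has_vector_derivative_diff primitive_on_shifted_derivative[OF J ck K] xT x s)
      from scaleC.has_vector_derivative[OF wave_derivative this]
      have "((\<lambda>s. wave (-\<omega>) s *\<^sub>C (K (x + T + s) - K (x + s))) has_vector_derivative
          (wave (-\<omega>) s *\<^sub>C (k (x + T + s) - k (x + s)) + (\<i> * of_real (-\<omega>) * wave (-\<omega>) s) *\<^sub>C (K (x + T + s) - K (x + s)))) (at s within {0..h})" .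
      moreover have "wave (-\<omega>) s *\<^sub>C (G (x + T + s) - G (x + s)) =
          wave (-\<omega>) s *\<^sub>C (k (x + T + s) - k (x + s)) + (\<i> * of_real (-\<omega>) * wave (-\<omega>) s) *\<^sub>C (K (x + T + s) - K (x + s))"
      proof -
        have "G (x + T + s) - G (x + s) = (k (x + T + s) - k (x + s)) - (\<i> * of_real \<omega>) *\<^sub>C (K (x + T + s) - K (x + s))"
          using s T half_lineD[OF J x] by (intro GK) auto
        then show ?thesis by (simp add: scaleC.diff_right scaleC_scaleC scaleC.minus_left mult.commute mult.left_commute)
      qed
      ultimately show "((\<lambda>s. wave (-\<omega>) s *\<^sub>C (K (x + T + s) - K (x + s))) has_vector_derivative
          wave (-\<omega>) s *\<^sub>C (G (x + T + s) - G (x + s))) (at s within {0..h})" by simp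
    qed
    then show ?thesis by (simp add: integral_unique)
  qed
  finally show ?thesis .
qed

lemma primitive_modulate_M_avg:
  fixes f :: "real \<Rightarrow> 'a::complex_banach"
  assumes J: "half_line J" and f: "f \<in> L1loc J"
    and G: "primitive_on J (modulate \<omega> f) G" and H: "primitive_on J (modulate \<omega> (M_avg h f)) H"
    and x: "x \<in> J" and T: "T \<ge> 0" and h: "h > 0"
  shows "H (x + T) - H x = integral {0..h} (\<lambda>s. ((1 / h) *\<^sub>R wave (-\<omega>) s) *\<^sub>C (G (x + T + s) - G (x + s)))"
proof -
  obtain F where F: "primitive_on J f F" "continuous_on J F" using L1loc_primitive[OF J f] by blast
  have "H (x + T) - H x = integral {x..x+T} (modulate \<omega> (M_avg h f))"
    using T by (simp add: primitive_on_integral[OF H x])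
  also have "\<dots> = integral {x..x+T} (\<lambda>u. (1 / h) *\<^sub>R (wave \<omega> u *\<^sub>C (F (u + h) - F u)))"
    using half_lineD[OF J x] h
    by (intro integral_cong) (simp add: modulate_wave M_avg_eq[OF J f F(1)] scaleC.scaleR_right)
  also have "\<dots> = (1 / h) *\<^sub>R integral {x..x+T} (\<lambda>u. wave \<omega> u *\<^sub>C (F (u + h) - F u))"
    by (rule integral_cmul)
  finally show ?thesis using integral_wave_difference[OF J f F(1) G x T] h
    by (simp add: scaleC.scaleR_left)
qed

section \<open>Bounded increments\<close>

text \<open>
  For a primitive \<open>F\<close> of \<open>f\<close> this says that the integrals of \<open>f\<close> over intervals of bounded length are
  bounded.  It is the weak form of boundedness that ergodic functions have, and it is what allows
  to recover the means of \<open>f\<close> from those of its averages.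
\<close>

definition bounded_increments :: "real set \<Rightarrow> (real \<Rightarrow> 'a::real_normed_vector) \<Rightarrow> bool" where
  "bounded_increments J F \<longleftrightarrow> (\<forall>h. \<exists>B. \<forall>x\<in>J. \<forall>s\<in>{0..h}. norm (F (x + s) - F x) \<le> B)"

text \<open>
  A bound for the steps of length between \<open>a\<close> and \<open>b\<close> gives one for the steps of length up to
  \<open>b - a\<close>, since \<open>F (y + s) - F y = (F (y + (s + a)) - F y) - (F ((y + s) + a) - F (y + s))\<close>, and
  longer steps are composed of such steps.
\<close>

lemma bounded_incrementsI:
  fixes F :: "real \<Rightarrow> 'a::real_normed_vector"
  assumes J: "half_line J" and ab: "0 \<le> a" "a < b"
    and B: "\<And>x s. x \<in> J \<Longrightarrow> s \<in> {a..b} \<Longrightarrow> norm (F (x + s) - F x) \<le> B"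
  shows "bounded_increments J F"
proof -
  define D where "D = b - a"
  have D: "D > 0" using ab by (simp add: D_def)
  have short: "norm (F (y + s) - F y) \<le> 2 * B" if y: "y \<in> J" and s: "s \<in> {0..D}" for y s
  proof -
    have "norm (F (y + (s + a)) - F y) \<le> B" using s ab y by (intro B) (auto simp: D_def)
    moreover have "norm (F ((y + s) + a) - F (y + s)) \<le> B" using s ab half_lineD[OF J y] by (intro B) auto
    moreover have "F (y + s) - F y = (F (y + (s + a)) - F y) - (F ((y + s) + a) - F (y + s))"
      by (simp add: add.assoc)
    ultimately show ?thesis
      using norm_triangle_ineq4[of "F (y + (s + a)) - F y" "F ((y + s) + a) - F (y + s)"] by simp
  qed
  obtain x0 where "x0 \<in> J" using half_line_nonempty[OF J] by blast
  then have B0: "B \<ge> 0" using B[of x0 a] ab by (meson atLeastAtMost_iff less_imp_le norm_ge_zero order_refl order_trans)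
  have long: "norm (F (y + s) - F y) \<le> real n * (2 * B)" if "y \<in> J" "s \<in> {0..real n * D}" for n y s
    using that
  proof (induction n arbitrary: y s)
    case (Suc n)
    show ?case
    proof (cases "s \<le> D")
      case True
      then have "norm (F (y + s) - F y) \<le> 2 * B" using Suc.prems by (intro short) auto
      also have "\<dots> \<le> real (Suc n) * (2 * B)" using B0 by (simp add: algebra_simps)
      finally show ?thesis .
    next
      case False
      have "norm (F ((y + D) + (s - D)) - F (y + D)) \<le> real n * (2 * B)"
        using Suc.prems False D half_lineD[OF J Suc.prems(1)] by (intro Suc.IH) (auto simp: algebra_simps)
      moreover have "norm (F (y + D) - F y) \<le> 2 * B" using Suc.prems D by (intro short) auto
      moreover have "F (y + s) - F y = (F ((y + D) + (s - D)) - F (y + D)) + (F (y + D) - F y)" by simp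
      ultimately show ?thesis
        using norm_triangle_ineq[of "F ((y + D) + (s - D)) - F (y + D)" "F (y + D) - F y"]
        by (simp add: algebra_simps)
    qed
  qed simp
  show ?thesis
    unfolding bounded_increments_def
  proof
    fix h :: real
    obtain n :: nat where "h / D \<le> real n" using real_arch_simple by blast
    then have "h \<le> real n * D" using D by (simp add: divide_le_eq)
    then show "\<exists>B. \<forall>x\<in>J. \<forall>s\<in>{0..h}. norm (F (x + s) - F x) \<le> B" using long[of _ _ n] by fastforce
  qed
qed

lemma Lipschitz_bounded_increments:
  assumes J: "half_line J" and Lip: "\<And>x y. x \<in> J \<Longrightarrow> x \<le> y \<Longrightarrow> norm (F y - F x) \<le> B * (y - x)"
  shows "bounded_increments J F"
proof (rule bounded_incrementsI[OF J, of 0 1])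
  fix x s assume x: "x \<in> J" and s: "s \<in> {0..1::real}"
  have "norm (F (x + s) - F x) \<le> B * s" using Lip[OF x, of "x + s"] s by simp
  also have "\<dots> \<le> \<bar>B\<bar> * 1" using s by (intro mult_mono) auto
  finally show "norm (F (x + s) - F x) \<le> \<bar>B\<bar>" by simp
qed auto

text \<open>
  A single long step \<open>T\<close> is bounded as \<open>G (x + T) - G x\<close> is close to \<open>T m\<close>, uniformly for \<open>T\<close> in an interval.
\<close>

lemma mean_on_bounded_increments:
  assumes J: "half_line J" and m: "mean_on J G m"
  shows "bounded_increments J G"
proof -
  obtain T0 where T0: "T0 > 0" "\<And>T x. T \<ge> T0 \<Longrightarrow> x \<in> J \<Longrightarrow> norm (G (x + T) - G x - T *\<^sub>R m) \<le> 1 * T"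
    using m unfolding mean_on_def by (metis zero_less_one)
  show ?thesis
  proof (rule bounded_incrementsI[OF J, of T0 "T0 + 1"])
    fix x s assume x: "x \<in> J" and s: "s \<in> {T0..T0+1}"
    have "norm (G (x + s) - G x) \<le> norm (G (x + s) - G x - s *\<^sub>R m) + norm (s *\<^sub>R m)"
      using norm_triangle_ineq[of "G (x + s) - G x - s *\<^sub>R m" "s *\<^sub>R m"] by simp
    also have "\<dots> \<le> s + s * norm m" using T0(2)[of s x] T0(1) s x by auto
    also have "\<dots> \<le> (T0 + 1) + (T0 + 1) * norm m" using s by (intro add_mono mult_right_mono) auto
    finally show "norm (G (x + s) - G x) \<le> (T0 + 1) + (T0 + 1) * norm m" .
  qed (use T0 in auto)
qed

text \<open>
  The bound for steps of length \<open>h\<close> may depend on \<open>h\<close> in an uncontrolled way; by the Baire category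
  theorem it is uniform for the \<open>h\<close> in some interval.
\<close>

lemma Baire_bounded_increments:
  fixes F :: "real \<Rightarrow> 'a::real_normed_vector"
  assumes J: "half_line J" and F: "continuous_on J F"
    and b: "\<And>h. h > 0 \<Longrightarrow> \<exists>B. \<forall>x\<in>J. norm (F (x + h) - F x) \<le> B"
  shows "bounded_increments J F"
proof -
  let ?S = "{1..2::real}"
  define A where "A n = {s\<in>?S. \<forall>x\<in>J. norm (F (x + s) - F x) \<le> real n}" for n :: nat
  have clA: "closed (A n)" for n
  proof -
    have "closed {s\<in>?S. norm (F (x + s) - F x) \<le> real n}" if x: "x \<in> J" for x
    proof -
      have "continuous_on ?S (\<lambda>s. norm (F (x + s) - F x))"
        using half_lineD[OF J x] by (intro continuous_intros continuous_on_compose2[OF F]) auto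
      from continuous_on_closed_Collect_le[OF this continuous_on_const] show ?thesis by simp
    qed
    moreover have "A n = (\<Inter>x\<in>J. {s\<in>?S. norm (F (x + s) - F x) \<le> real n})"
      using half_line_nonempty[OF J] by (auto simp: A_def)
    ultimately show ?thesis by auto
  qed
  have un: "\<exists>n. s \<in> A n" if "s \<in> ?S" for s
  proof -
    obtain B where B: "\<forall>x\<in>J. norm (F (x + s) - F x) \<le> B" using b[of s] \<open>s \<in> ?S\<close> by auto
    obtain n :: nat where "B \<le> real n" using real_arch_simple by blast
    then have "s \<in> A n" using B that by (force simp: A_def)
    then show ?thesis by blast
  qed
  have "\<exists>n. \<not> ?S \<subseteq> closure (?S - A n)"
  proof (rule ccontr)
    assume "\<not> ?thesis"
    then have dense: "?S \<subseteq> closure (?S - A n)" for n by blast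
    have "?S \<subseteq> closure (\<Inter>(range (\<lambda>n. ?S - A n)))"
    proof (rule Baire)
      fix T assume "T \<in> range (\<lambda>n. ?S - A n)"
      then obtain n where T: "T = ?S - A n" by blast
      have "openin (top_of_set ?S) (?S - A n)"
        using clA[of n] by (metis openin_open_Int open_Compl Diff_eq)
      then show "openin (top_of_set ?S) T \<and> ?S \<subseteq> closure T" using dense[of n] T by simp
    qed auto
    moreover have "\<Inter>(range (\<lambda>n. ?S - A n)) = {}" using un by auto
    ultimately have "?S \<subseteq> closure {}" by (simp only:)
    then show False by auto
  qed
  then obtain n s where s: "s \<in> ?S" "s \<notin> closure (?S - A n)" by blast
  then obtain e where e: "e > 0" "\<And>y. y \<in> ?S - A n \<Longrightarrow> \<not> dist y s < e"
    unfolding closure_approachable by blast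
  obtain a b where ab: "0 \<le> a" "a < b" "{a..b} \<subseteq> A n"
  proof (cases "s < 2")
    case True
    have "{s..min 2 (s + e/2)} \<subseteq> A n"
    proof
      fix y assume "y \<in> {s..min 2 (s + e/2)}"
      then have "y \<in> ?S" "dist y s < e" using s(1) e(1) by (auto simp: dist_real_def)
      then show "y \<in> A n" using e(2) by blast
    qed
    then show ?thesis using that[of s "min 2 (s + e/2)"] s(1) e(1) True by auto
  next
    case False
    then have s2: "s = 2" using s(1) by auto
    have "{max 1 (2 - e/2)..2} \<subseteq> A n"
    proof
      fix y assume "y \<in> {max 1 (2 - e/2)..2}"
      then have "y \<in> ?S" "dist y s < e" using s2 e(1) by (auto simp: dist_real_def)
      then show "y \<in> A n" using e(2) by blast
    qed
    then show ?thesis using that[of "max 1 (2 - e/2)" 2] e(1) by auto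
  qed
  show ?thesis
    by (rule bounded_incrementsI[OF J ab(1,2), where B="real n"]) (use ab(3) in \<open>auto simp: A_def\<close>)
qed

text \<open>
  Integration by parts with \<open>F - F(x)\<close>, which is bounded near \<open>x\<close>, in place of \<open>F\<close>.
\<close>

lemma bounded_increments_modulate:
  fixes f :: "real \<Rightarrow> 'a::complex_banach"
  assumes J: "half_line J" and f: "f \<in> L1loc J" and F: "primitive_on J f F"
    and G: "primitive_on J (modulate \<omega> f) G" and b: "bounded_increments J F"
  shows "bounded_increments J G"
  unfolding bounded_increments_def
proof
  fix h :: real
  obtain B where B: "\<And>x s. x \<in> J \<Longrightarrow> s \<in> {0..h} \<Longrightarrow> norm (F (x + s) - F x) \<le> B"
    using b unfolding bounded_increments_def by blast
  have cF: "continuous_on J F" by (rule primitive_on_continuous[OF J F])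
  show "\<exists>B. \<forall>x\<in>J. \<forall>s\<in>{0..h}. norm (G (x + s) - G x) \<le> B"
  proof (intro exI[of _ "B + (\<bar>\<omega>\<bar> * B) * h"] ballI)
    fix x s assume x: "x \<in> J" and s: "s \<in> {0..h}"
    then have B0: "B \<ge> 0" using B[of x s] by (meson norm_ge_zero order_trans)
    let ?F = "\<lambda>t. F t - F x"
    have F': "primitive_on J f ?F" using F by (simp add: primitive_on_def)
    have eq: "G (x + s) - G x = wave \<omega> (x + s) *\<^sub>C ?F (x + s)
           - integral {x..x + s} (\<lambda>t. (\<i> * of_real \<omega> * wave \<omega> t) *\<^sub>C ?F t)"
      using primitive_on_modulate[OF J f F' G x, of "x + s"] s by (simp add: scaleC.zero_right)
    have "norm (integral {x..x + s} (\<lambda>t. (\<i> * of_real \<omega> * wave \<omega> t) *\<^sub>C ?F t)) \<le> (\<bar>\<omega>\<bar> * B) * (x + s - x)"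
    proof (rule integral_bound)
      show "continuous_on {x..x + s} (\<lambda>t. (\<i> * of_real \<omega> * wave \<omega> t) *\<^sub>C ?F t)"
        by (intro scaleC.continuous_on continuous_intros continuous_on_subset[OF cF] half_line_interval[OF J x])
      show "norm ((\<i> * of_real \<omega> * wave \<omega> t) *\<^sub>C ?F t) \<le> \<bar>\<omega>\<bar> * B" if "t \<in> {x..x + s}" for t
        using B[of x "t - x"] that x s by (auto simp: norm_scaleC norm_mult intro!: mult_left_mono)
    qed (use s in auto)
    also have "\<dots> \<le> (\<bar>\<omega>\<bar> * B) * h" using s B0 by (intro mult_left_mono) auto
    finally show "norm (G (x + s) - G x) \<le> B + (\<bar>\<omega>\<bar> * B) * h"
      unfolding eq using B[OF x s] norm_triangle_ineq4[of "wave \<omega> (x + s) *\<^sub>C ?F (x + s)" "integral {x..x + s} (\<lambda>t. (\<i> * of_real \<omega> * wave \<omega> t) *\<^sub>C ?F t)"]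
      by (simp add: norm_scaleC)
  qed
qed

section \<open>Averages and the ergodic classes\<close>

text \<open>
  If the increments of \<open>H\<close> are those of \<open>G\<close> averaged with a kernel \<open>k\<close>, then the means of \<open>G\<close>
  carry over to \<open>H\<close>.  Conversely, if \<open>G\<close> has bounded increments, averaging changes its increments
  \<open>G (x + T) - G x\<close> by a bounded amount only, up to the factor \<open>\<integral>k\<close>; hence the means of \<open>H\<close>
  carry over to \<open>G\<close> if this factor is not zero.
\<close>

lemma
  fixes G H :: "real \<Rightarrow> 'a::complex_banach"
  assumes J: "half_line J" and G: "continuous_on J G" and k: "continuous_on {a..b} k" and ab: "a \<le> b"
    and inJ: "\<And>x s. x \<in> J \<Longrightarrow> s \<in> {a..b} \<Longrightarrow> x + s \<in> J"
    and H: "\<And>x T. x \<in> J \<Longrightarrow> T \<ge> 0 \<Longrightarrow> H (x + T) - H x = integral {a..b} (\<lambda>s. k s *\<^sub>C (G (x + T + s) - G (x + s)))"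
  shows mean_on_kernel: "mean_on J G m \<Longrightarrow> mean_on J H (integral {a..b} k *\<^sub>C m)"
    and mean_on_of_kernel: "mean_on J H m \<Longrightarrow> integral {a..b} k \<noteq> 0 \<Longrightarrow>
          (\<And>x s. x \<in> J \<Longrightarrow> s \<in> {a..b} \<Longrightarrow> norm (G (x + s) - G x) \<le> B) \<Longrightarrow>
          mean_on J G (inverse (integral {a..b} k) *\<^sub>C m)"
proof -
  define c where "c = integral {a..b} k"
  have c: "(k has_integral c) {a..b}"
    unfolding c_def by (intro integrable_integral integrable_continuous_interval k)
  have cv: "((\<lambda>s. k s *\<^sub>C v) has_integral c *\<^sub>C v) {a..b}" for v :: 'a
    using has_integral_linear[OF c scaleC.bounded_linear_left] by (simp add: comp_def)
  obtain K where K: "K > 0" "\<And>s. s \<in> {a..b} \<Longrightarrow> norm (k s) \<le> K"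
    using compact_imp_bounded[OF compact_continuous_image[OF k]] unfolding bounded_pos by force
  have est: "norm (H (x + T) - H x - c *\<^sub>C v) \<le> K * d * (b - a)"
    if x: "x \<in> J" and T: "T \<ge> 0" and d: "\<And>s. s \<in> {a..b} \<Longrightarrow> norm (G (x + T + s) - G (x + s) - v) \<le> d" for x T v d
  proof -
    let ?g = "\<lambda>s. k s *\<^sub>C (G (x + T + s) - G (x + s))"
    have xT: "x + T \<in> J" using half_lineD[OF J x] T by simp
    have cg: "continuous_on {a..b} (\<lambda>s. G (x + T + s))" "continuous_on {a..b} (\<lambda>s. G (x + s))"
      using inJ[OF x] inJ[OF xT] by (auto intro!: continuous_intros continuous_on_compose2[OF G])
    have "?g integrable_on {a..b}"
      by (intro integrable_continuous_interval scaleC.continuous_on continuous_intros cg k)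
    from has_integral_diff[OF integrable_integral[OF this] cv[of v]]
    have "H (x + T) - H x - c *\<^sub>C v = integral {a..b} (\<lambda>s. k s *\<^sub>C (G (x + T + s) - G (x + s) - v))"
      unfolding H[OF x T] scaleC.diff_right[symmetric] by (rule integral_unique[symmetric])
    also have "norm \<dots> \<le> (K * d) * (b - a)"
    proof (rule integral_bound[OF ab])
      show "continuous_on {a..b} (\<lambda>s. k s *\<^sub>C (G (x + T + s) - G (x + s) - v))"
        by (intro scaleC.continuous_on continuous_intros cg k)
      show "norm (k s *\<^sub>C (G (x + T + s) - G (x + s) - v)) \<le> K * d" if "s \<in> {a..b}" for s
        unfolding norm_scaleC using K that d[OF that] by (intro mult_mono) auto
    qed
    finally show ?thesis .
  qed
  show "mean_on J H (integral {a..b} k *\<^sub>C m)" if m: "mean_on J G m"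
    unfolding mean_on_def
  proof (intro allI impI)
    fix e :: real assume e: "e > 0"
    define e' where "e' = e / (K * (b - a) + 1)"
    have pos: "K * (b - a) + 1 > 0" using K(1) ab by (simp add: add_nonneg_pos)
    have e': "e' > 0" "K * e' * (b - a) \<le> e"
    proof -
      show "e' > 0" using e pos by (simp add: e'_def)
      have "K * e' * (b - a) = e * (K * (b - a) / (K * (b - a) + 1))" by (simp add: e'_def)
      also have "\<dots> \<le> e * 1" using e pos by (intro mult_left_mono) (auto simp: divide_le_eq)
      finally show "K * e' * (b - a) \<le> e" by simp
    qed
    obtain T0 where T0: "T0 > 0" "\<And>T x. T \<ge> T0 \<Longrightarrow> x \<in> J \<Longrightarrow> norm (G (x + T) - G x - T *\<^sub>R m) \<le> e' * T"
      using m e'(1) unfolding mean_on_def by metis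
    show "\<exists>T0>0. \<forall>T\<ge>T0. \<forall>x\<in>J. norm (H (x + T) - H x - T *\<^sub>R (integral {a..b} k *\<^sub>C m)) \<le> e * T"
    proof (intro exI[of _ T0] conjI allI impI ballI T0(1))
      fix T x assume T: "T0 \<le> T" and x: "x \<in> J"
      have T': "T \<ge> 0" using T T0(1) by simp
      have "norm (H (x + T) - H x - c *\<^sub>C (T *\<^sub>R m)) \<le> K * (e' * T) * (b - a)"
      proof (rule est[OF x T'])
        show "norm (G (x + T + s) - G (x + s) - T *\<^sub>R m) \<le> e' * T" if "s \<in> {a..b}" for s
          using T0(2)[OF T inJ[OF x that]] by (simp add: add.commute add.left_commute)
      qed
      also have "\<dots> \<le> e * T" using mult_right_mono[OF e'(2) T'] by (simp add: mult_ac)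
      finally show "norm (H (x + T) - H x - T *\<^sub>R (integral {a..b} k *\<^sub>C m)) \<le> e * T"
        by (simp add: c_def scaleC.scaleR_right)
    qed
  qed
  show "mean_on J G (inverse (integral {a..b} k) *\<^sub>C m)"
    if m: "mean_on J H m" and c0': "integral {a..b} k \<noteq> 0"
      and B: "\<And>x s. x \<in> J \<Longrightarrow> s \<in> {a..b} \<Longrightarrow> norm (G (x + s) - G x) \<le> B"
    unfolding mean_on_def
  proof (intro allI impI)
    fix e :: real assume e: "e > 0"
    have c0: "c \<noteq> 0" using c0' by (simp add: c_def)
    define E where "E = K * (2 * B) * (b - a)"
    have "e * norm c / 2 > 0" using e c0 by simp
    then obtain T0 where T0: "T0 > 0" "\<And>T x. T \<ge> T0 \<Longrightarrow> x \<in> J \<Longrightarrow> norm (H (x + T) - H x - T *\<^sub>R m) \<le> e * norm c / 2 * T"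
      using m unfolding mean_on_def by metis
    show "\<exists>T0>0. \<forall>T\<ge>T0. \<forall>x\<in>J. norm (G (x + T) - G x - T *\<^sub>R (inverse (integral {a..b} k) *\<^sub>C m)) \<le> e * T"
    proof (intro exI[of _ "max T0 (2 * E / (e * norm c))"] conjI allI impI ballI)
      show "max T0 (2 * E / (e * norm c)) > 0" using T0(1) by simp
      fix T x assume T: "max T0 (2 * E / (e * norm c)) \<le> T" and x: "x \<in> J"
      have T': "T \<ge> 0" "T \<ge> T0" using T T0(1) by auto
      have TE: "2 * E \<le> e * norm c * T" using T e c0 by (auto simp: divide_le_eq mult_ac)
      have xT: "x + T \<in> J" using half_lineD[OF J x] T' by auto
      have r: "norm (H (x + T) - H x - c *\<^sub>C (G (x + T) - G x)) \<le> E"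
        unfolding E_def
      proof (rule est[OF x T'(1)])
        fix s assume s: "s \<in> {a..b}"
        have eq: "G (x + T + s) - G (x + s) - (G (x + T) - G x) = (G (x + T + s) - G (x + T)) - (G (x + s) - G x)" by simp
        show "norm (G (x + T + s) - G (x + s) - (G (x + T) - G x)) \<le> 2 * B"
          unfolding eq using norm_triangle_ineq4[of "G (x + T + s) - G (x + T)" "G (x + s) - G x"] B[OF xT s] B[OF x s] by simp
      qed
      have "c *\<^sub>C (G (x + T) - G x - T *\<^sub>R (inverse c *\<^sub>C m)) = (H (x + T) - H x - T *\<^sub>R m) - (H (x + T) - H x - c *\<^sub>C (G (x + T) - G x))"
        using c0 by (simp add: scaleC.diff_right scaleC.scaleR_right scaleC_scaleC)
      then have "norm c * norm (G (x + T) - G x - T *\<^sub>R (inverse c *\<^sub>C m)) \<le> e * norm c / 2 * T + E"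
        using norm_triangle_ineq4[of "H (x + T) - H x - T *\<^sub>R m" "H (x + T) - H x - c *\<^sub>C (G (x + T) - G x)"] T0(2)[OF T'(2) x] r
        by (simp add: norm_scaleC[symmetric])
      also have "\<dots> \<le> norm c * (e * T)"
      proof -
        define X where "X = e * norm c * T"
        have 1: "norm c * (e * T) = X" unfolding X_def by (metis mult.assoc mult.commute)
        have 2: "e * norm c / 2 * T = X / 2" unfolding X_def by (rule times_divide_eq_left)
        have "2 * E \<le> X" using TE unfolding X_def .
        then have "X / 2 + E \<le> X" by linarith
        then show ?thesis unfolding 1 2 .
      qed
      finally have "norm (G (x + T) - G x - T *\<^sub>R (inverse c *\<^sub>C m)) \<le> e * T"
        by (rule mult_left_le_imp_le) (use c0 in simp)
      then show "norm (G (x + T) - G x - T *\<^sub>R (inverse (integral {a..b} k) *\<^sub>C m)) \<le> e * T" by (simp add: c_def)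
    qed
  qed
qed

lemma erg_class_M_avg:
  fixes f :: "real \<Rightarrow> 'a::complex_banach"
  assumes J: "half_line J" and f: "f \<in> erg_class J \<Omega> z" and h: "h > 0"
  shows "M_avg h f \<in> erg_class J \<Omega> z"
proof (rule erg_classI[OF J])
  have fl: "f \<in> L1loc J" by (rule erg_class_L1loc[OF f])
  show Ml: "M_avg h f \<in> L1loc J" using h by (intro M_avg_L1loc[OF J fl]) auto
  fix \<omega> assume w: "\<omega> \<in> \<Omega>"
  obtain G where G: "primitive_on J (modulate \<omega> f) G" "continuous_on J G"
    using L1loc_primitive[OF J modulate_L1loc[OF J fl]] by blast
  obtain m where m: "z \<longrightarrow> m = 0" "mean_on J G m" using erg_classD[OF J f w G(1)] by blast
  obtain H where H: "primitive_on J (modulate \<omega> (M_avg h f)) H"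
    using L1loc_primitive[OF J modulate_L1loc[OF J Ml]] by blast
  have "mean_on J H (integral {0..h} (\<lambda>s. (1 / h) *\<^sub>R wave (-\<omega>) s) *\<^sub>C m)"
    by (rule mean_on_kernel[OF J G(2) _ _ _ primitive_modulate_M_avg[OF J fl G(1) H _ _ h] m(2)])
      (use h half_lineD[OF J] in \<open>auto intro!: continuous_intros\<close>)
  then show "\<exists>G m. primitive_on J (modulate \<omega> (M_avg h f)) G \<and> (z \<longrightarrow> m = 0) \<and> mean_on J G m"
    using H m(1) by (intro exI[of _ H] exI conjI) (auto simp: scaleC.zero_right)
qed

lemma norm_wave_minus_one: "norm (wave \<omega> s - 1) \<le> \<bar>\<omega> * s\<bar>"
proof -
  have *: "norm (wave \<omega> s - 1) \<le> \<bar>\<omega> * s\<bar>" if s: "s \<ge> 0" for s \<omega>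
  proof -
    have "((\<lambda>t. \<i> * of_real \<omega> * wave \<omega> t) has_integral (wave \<omega> s - wave \<omega> 0)) {0..s}"
      by (rule fundamental_theorem_of_calculus[OF s]) (rule wave_derivative)
    then have "wave \<omega> s - 1 = integral {0..s} (\<lambda>t. \<i> * of_real \<omega> * wave \<omega> t)"
      unfolding wave_zero by (rule integral_unique[symmetric])
    also have "norm \<dots> \<le> \<bar>\<omega>\<bar> * (s - 0)"
      by (rule integral_bound[OF s]) (auto intro!: continuous_intros simp: norm_mult)
    finally show ?thesis using s by (simp add: abs_mult)
  qed
  show ?thesis using *[of s \<omega>] *[of "-s" "-\<omega>"] wave_neg_arg[of "-\<omega>" s] by (cases "s \<ge> 0") auto
qed

text \<open>
  For \<open>\<bar>\<omega>\<bar> h \<le> 1/2\<close> the average of \<open>e\<^sup>-\<^sup>i\<^sup>\<omega>\<^sup>s\<close> over \<open>[0, h]\<close> is close to \<open>1\<close>, hence not zero,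
  and the means of \<open>\<gamma>\<^sub>\<omega> f\<close> can be recovered from those of \<open>\<gamma>\<^sub>\<omega> M\<^sub>h f\<close>.
\<close>

lemma erg_class_of_M_avg:
  fixes f :: "real \<Rightarrow> 'a::complex_banach"
  assumes J: "half_line J" and f: "f \<in> L1loc J" and F: "primitive_on J f F" and b: "bounded_increments J F"
    and Mf: "\<And>h. h > 0 \<Longrightarrow> M_avg h f \<in> erg_class J \<Omega> z"
  shows "f \<in> erg_class J \<Omega> z"
proof (rule erg_classI[OF J f])
  fix \<omega> assume w: "\<omega> \<in> \<Omega>"
  define h where "h = 1 / (2 * (1 + \<bar>\<omega>\<bar>))"
  have h: "h > 0" "\<bar>\<omega>\<bar> * h \<le> 1/2" by (auto simp: h_def field_simps)
  obtain G where G: "primitive_on J (modulate \<omega> f) G" "continuous_on J G"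
    using L1loc_primitive[OF J modulate_L1loc[OF J f]] by blast
  obtain B where B: "\<And>x s. x \<in> J \<Longrightarrow> s \<in> {0..h} \<Longrightarrow> norm (G (x + s) - G x) \<le> B"
    using bounded_increments_modulate[OF J f F G(1) b] unfolding bounded_increments_def by blast
  obtain H where H: "primitive_on J (modulate \<omega> (M_avg h f)) H"
    using L1loc_primitive[OF J modulate_L1loc[OF J erg_class_L1loc[OF Mf[OF h(1)]]]] by blast
  obtain m where m: "z \<longrightarrow> m = 0" "mean_on J H m" using erg_classD[OF J Mf[OF h(1)] w H] by blast
  let ?k = "\<lambda>s. (1 / h) *\<^sub>R wave (-\<omega>) s"
  have ck: "continuous_on {0..h} ?k" by (intro continuous_intros)
  have c0: "integral {0..h} ?k \<noteq> 0"
  proof -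
    have "((\<lambda>s. ?k s - of_real (1 / h)) has_integral integral {0..h} ?k - h *\<^sub>R of_real (1 / h)) {0..h}"
      using has_integral_diff[OF integrable_integral[OF integrable_continuous_interval[OF ck]] has_integral_const_real[of _ 0 h]] h(1)
      by simp
    then have "integral {0..h} ?k - 1 = integral {0..h} (\<lambda>s. ?k s - of_real (1 / h))"
      using h(1) by (simp add: integral_unique scaleR_conv_of_real)
    also have "norm \<dots> \<le> (1 / h * (1/2)) * (h - 0)"
    proof (rule integral_bound)
      show "norm (?k s - of_real (1 / h)) \<le> 1 / h * (1/2)" if "s \<in> {0..h}" for s
      proof -
        have "norm (wave (-\<omega>) s - 1) \<le> \<bar>-\<omega> * s\<bar>" by (rule norm_wave_minus_one)
        also have "\<dots> \<le> \<bar>\<omega>\<bar> * h" using that by (auto simp: abs_mult intro: mult_left_mono)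
        finally have "norm (wave (-\<omega>) s - 1) \<le> 1/2" using h(2) by simp
        then have "1 / h * norm (wave (-\<omega>) s - 1) \<le> 1 / h * (1/2)" using h(1) by (intro mult_left_mono) auto
        moreover have "?k s - of_real (1 / h) = (1 / h) *\<^sub>R (wave (-\<omega>) s - 1)"
          by (simp add: scaleR_conv_of_real algebra_simps)
        ultimately show ?thesis using h(1) by simp
      qed
    qed (use h in \<open>auto intro!: continuous_intros\<close>)
    finally have "norm (integral {0..h} ?k - 1) \<le> 1/2" using h(1) by simp
    then show ?thesis by auto
  qed
  have "mean_on J G (inverse (integral {0..h} ?k) *\<^sub>C m)"
    by (rule mean_on_of_kernel[OF J G(2) ck _ _ primitive_modulate_M_avg[OF J f G(1) H _ _ h(1)] m(2) c0 B])
      (use h half_lineD[OF J] in auto)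
  then show "\<exists>G m. primitive_on J (modulate \<omega> f) G \<and> (z \<longrightarrow> m = 0) \<and> mean_on J G m"
    using G(1) m(1) by (intro exI[of _ G] exI conjI) (auto simp: scaleC.zero_right)
qed

section \<open>Bounded uniformly continuous functions\<close>

lemma AE_eq_integral:
  fixes f g :: "real \<Rightarrow> 'a::banach"
  assumes J: "half_line J" and fg: "AE t in lebesgue_on J. f t = g t" and a: "a \<in> J"
  shows "integral {a..b} f = integral {a..b} g" "f integrable_on {a..b} \<longleftrightarrow> g integrable_on {a..b}"
proof -
  have "AE t in lebesgue. t \<in> J \<longrightarrow> f t = g t"
    using fg by (simp add: AE_restrict_space_iff J)
  then have N: "{t. \<not> (t \<in> J \<longrightarrow> f t = g t)} \<in> null_sets lebesgue"
    by (simp add: complete_measure.AE_iff_null_sets[OF complete_measure_lebesgue])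
  then have neg: "negligible {t. \<not> (t \<in> J \<longrightarrow> f t = g t)}" by (simp add: negligible_iff_null_sets)
  have *: "g t = f t" if "t \<in> {a..b} - {t. \<not> (t \<in> J \<longrightarrow> f t = g t)}" for t
    using that half_lineD[OF J a] by auto
  show "integral {a..b} f = integral {a..b} g" by (rule integral_spike[OF neg *])
  show "f integrable_on {a..b} \<longleftrightarrow> g integrable_on {a..b}"
    using integrable_spike[OF _ neg, of f "{a..b}" g] integrable_spike[OF _ neg, of g "{a..b}" f] * by metis
qed

lemma bounded_continuous_Lipschitz_primitive:
  fixes g :: "real \<Rightarrow> 'a::banach"
  assumes J: "half_line J" and g: "continuous_on J g" and B: "\<And>t. t \<in> J \<Longrightarrow> norm (g t) \<le> B"
    and G: "primitive_on J g G" and x: "x \<in> J" "x \<le> y"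
  shows "norm (G y - G x) \<le> B * (y - x)"
  using integral_bound[OF x(2) continuous_on_subset[OF g half_line_interval[OF J x(1)]], of B] B half_lineD[OF J x(1)]
  by (simp add: primitive_on_integral[OF G x])

lemma C_ub_L1loc:
  fixes f :: "real \<Rightarrow> 'a::complex_banach"
  assumes J: "half_line J" and f: "f \<in> C_ub J"
  shows "f \<in> L1loc J"
  unfolding L1loc_iff[OF J]
proof (intro ballI allI)
  fix a b assume a: "a \<in> J"
  have M: "complete_measure (lebesgue_on {a..b})" by (rule complete_measure_lebesgue_on) simp
  obtain g where g: "uniformly_continuous_on J g" "AE t in lebesgue_on J. f t = g t"
    using f by (auto simp: C_ub_def)
  have "AE t in lebesgue. t \<in> J \<longrightarrow> f t = g t"
    using g(2) by (simp add: AE_restrict_space_iff J)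
  then have "AE t in lebesgue. t \<in> {a..b} \<longrightarrow> g t = f t"
    by eventually_elim (use half_lineD[OF J a] in auto)
  then have ae: "AE t in lebesgue_on {a..b}. g t = f t" by (simp add: AE_restrict_space_iff)
  have "bochner_integrable (lebesgue_on {a..b}) g"
    using continuous_on_subset[OF uniformly_continuous_imp_continuous[OF g(1)] half_line_interval[OF J a]]
    by (rule bochner_integrable_continuous)
  note g' = bochner_integrableD[OF M this]
  have "(\<integral>\<^sup>+x. ennreal (norm (f x)) \<partial>lebesgue_on {a..b}) = (\<integral>\<^sup>+x. ennreal (norm (g x)) \<partial>lebesgue_on {a..b})"
    using ae by (intro nn_integral_cong_AE) (auto elim: eventually_mono)
  then show "bochner_integrable (lebesgue_on {a..b}) f"
    using g'(2) by (intro bochner_integrableI[OF M strongly_measurable_cong_AE[OF g'(1) ae]]) simp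
qed

lemma C_ub_Lipschitz_primitive:
  fixes f :: "real \<Rightarrow> 'a::complex_banach"
  assumes J: "half_line J" and f: "f \<in> C_ub J" and F: "primitive_on J f F"
  shows "\<exists>B. \<forall>x\<in>J. \<forall>y\<ge>x. norm (F y - F x) \<le> B * (y - x)"
proof -
  obtain g where g: "bounded (g ` J)" "uniformly_continuous_on J g" "AE t in lebesgue_on J. f t = g t"
    using f by (auto simp: C_ub_def)
  obtain B where B: "\<And>t. t \<in> J \<Longrightarrow> norm (g t) \<le> B" using g(1) unfolding bounded_iff by blast
  have "primitive_on J g F"
    unfolding primitive_on_def
  proof (intro ballI allI impI)
    fix a b assume a: "a \<in> J" and ab: "a \<le> (b::real)"
    show "(g has_integral F b - F a) {a..b}"
      using primitive_onD[OF F a ab] AE_eq_integral[OF J g(3) a, of b]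
      by (metis has_integral_integrable_integral)
  qed
  then show ?thesis
    using bounded_continuous_Lipschitz_primitive[OF J uniformly_continuous_imp_continuous[OF g(2)] B] by blast
qed

text \<open>
  A continuous function is determined by its class modulo null sets, so for continuous functions
  membership in \<open>C_ub\<close> has the classical meaning.
\<close>

lemma C_ub_continuous_on:
  fixes f :: "real \<Rightarrow> 'a::complex_banach"
  assumes J: "half_line J" and f: "f \<in> C_ub J" and c: "continuous_on J f"
  shows "bounded (f ` J)" "uniformly_continuous_on J f"
proof -
  obtain g where g: "bounded (g ` J)" "uniformly_continuous_on J g" "AE t in lebesgue_on J. f t = g t"
    using f by (auto simp: C_ub_def)
  have eq: "f x = g x" if x: "x \<in> J" for x
  proof -
    have cd: "continuous_on {x..x+1} (\<lambda>t. norm (f t - g t))"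
      by (intro continuous_intros continuous_on_subset[OF c half_line_interval[OF J x]]
          continuous_on_subset[OF uniformly_continuous_imp_continuous[OF g(2)] half_line_interval[OF J x]])
    have "AE t in lebesgue_on J. norm (f t - g t) = 0" using g(3) by eventually_elim simp
    then have "integral {x..x+1} (\<lambda>t. norm (f t - g t)) = integral {x..x+1} (\<lambda>_. 0)"
      by (rule AE_eq_integral(1)[OF J _ x])
    then have "\<forall>t\<in>{x..x+1}. norm (f t - g t) = 0"
      using integral_eq_0_iff[OF cd] by simp
    then show ?thesis by simp
  qed
  then have "f ` J = g ` J" by auto
  then show "bounded (f ` J)" using g(1) by simp
  show "uniformly_continuous_on J f" using g(2) eq by (simp add: uniformly_continuous_on_def)
qed

lemma C_ubI:
  fixes f :: "real \<Rightarrow> 'a::complex_banach"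
  shows "bounded (f ` J) \<Longrightarrow> uniformly_continuous_on J f \<Longrightarrow> f \<in> C_ub J"
  unfolding C_ub_def by (intro CollectI exI[of _ f]) auto

lemma Lipschitz_C_ub:
  fixes f :: "real \<Rightarrow> 'a::complex_banach"
  assumes b: "\<And>t. t \<in> J \<Longrightarrow> norm (f t) \<le> B" and L: "\<And>x y. x \<in> J \<Longrightarrow> y \<in> J \<Longrightarrow> x \<le> y \<Longrightarrow> norm (f y - f x) \<le> L * (y - x)"
  shows "f \<in> C_ub J"
proof (rule C_ubI)
  show "bounded (f ` J)" using b unfolding bounded_iff by blast
  have L': "norm (f y - f x) \<le> \<bar>L\<bar> * (y - x)" if "x \<in> J" "y \<in> J" "x \<le> y" for x y
    using L[OF that] that by (meson abs_ge_self diff_ge_0_iff_ge mult_right_mono order_trans)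
  have "norm (f x - f y) \<le> \<bar>L\<bar> * \<bar>x - y\<bar>" if "x \<in> J" "y \<in> J" for x y
    using L'[of x y] L'[of y x] that
    by (cases "x \<le> y") (auto simp: norm_minus_commute abs_minus_commute[of x y])
  then have "\<bar>L\<bar>-lipschitz_on J f"
    by (intro lipschitz_onI) (auto simp: dist_norm)
  then show "uniformly_continuous_on J f" by (rule lipschitz_on_uniformly_continuous)
qed

text \<open>
  The average \<open>(F (t + h) - F t) / h\<close> inherits the Lipschitz condition from \<open>F\<close>.
\<close>

lemma M_avg_C_ub:
  fixes f :: "real \<Rightarrow> 'a::complex_banach"
  assumes J: "half_line J" and f: "f \<in> L1loc J" and F: "primitive_on J f F" and h: "h > 0"
    and Lip: "\<And>x y. x \<in> J \<Longrightarrow> x \<le> y \<Longrightarrow> norm (F y - F x) \<le> B * (y - x)"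
  shows "M_avg h f \<in> C_ub J"
proof (rule Lipschitz_C_ub)
  have M: "M_avg h f t = (1 / h) *\<^sub>R (F (t + h) - F t)" if "t \<in> J" for t
    using h by (simp add: M_avg_eq[OF J f F that])
  show "norm (M_avg h f t) \<le> B" if "t \<in> J" for t
    using Lip[OF that, of "t + h"] h by (simp add: M[OF that] divide_le_eq)
  show "norm (M_avg h f y - M_avg h f x) \<le> (2 * B / h) * (y - x)" if xy: "x \<in> J" "y \<in> J" "x \<le> y" for x y
  proof -
    have "M_avg h f y - M_avg h f x = (1 / h) *\<^sub>R ((F (y + h) - F (x + h)) - (F y - F x))"
      by (simp add: M xy scaleR_diff_right)
    moreover have "norm ((F (y + h) - F (x + h)) - (F y - F x)) \<le> 2 * (B * (y - x))"
      using norm_triangle_ineq4[of "F (y + h) - F (x + h)" "F y - F x"] Lip[of "x + h" "y + h"] Lip[of x y]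
        xy h half_lineD[OF J xy(1), of "x + h"] by simp
    ultimately show ?thesis using h by (simp add: divide_le_eq)
  qed
qed

section \<open>The inclusions between the classes\<close>

lemma Mcl_iff: "f \<in> Mcl J A \<longleftrightarrow> f \<in> L1loc J \<and> (\<forall>h>0. M_avg h f \<in> A)"
  by (simp add: Mcl_def)

lemma Mcl_mono: "A \<subseteq> B \<Longrightarrow> Mcl J A \<subseteq> Mcl J B"
  unfolding Mcl_def by blast

lemma Mcl_funpow_mono: "A \<subseteq> B \<Longrightarrow> (Mcl J ^^ n) A \<subseteq> (Mcl J ^^ n) B"
  by (induction n) (auto intro!: Mcl_mono)

lemma erg_class_ub_subset_Mcl:
  assumes J: "half_line J"
  shows "erg_class J \<Omega> z \<inter> C_ub J \<subseteq> Mcl J (erg_class J \<Omega> z \<inter> C_ub J)"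
proof
  fix f :: "real \<Rightarrow> 'a" assume f: "f \<in> erg_class J \<Omega> z \<inter> C_ub J"
  then have fl: "f \<in> L1loc J" by (auto intro: erg_class_L1loc)
  obtain F where F: "primitive_on J f F" using L1loc_primitive[OF J fl] by blast
  obtain B where "\<And>x y. x \<in> J \<Longrightarrow> x \<le> y \<Longrightarrow> norm (F y - F x) \<le> B * (y - x)"
    using C_ub_Lipschitz_primitive[OF J _ F] f by blast
  then show "f \<in> Mcl J (erg_class J \<Omega> z \<inter> C_ub J)"
    unfolding Mcl_def using fl f erg_class_M_avg[OF J] M_avg_C_ub[OF J fl F] by blast
qed

text \<open>
  Each \<open>M\<^sub>h f\<close> is bounded, which gives \<open>F\<close> bounded increments by Baire's theorem; then the means of \<open>f\<close>
  exist since those of the averages do.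
\<close>

lemma Mcl_erg_class_ub_subset:
  assumes J: "half_line J"
  shows "Mcl J (erg_class J \<Omega> z \<inter> C_ub J) \<subseteq> erg_class J \<Omega> z"
proof
  fix f :: "real \<Rightarrow> 'a" assume f: "f \<in> Mcl J (erg_class J \<Omega> z \<inter> C_ub J)"
  then have fl: "f \<in> L1loc J" by (simp add: Mcl_def)
  obtain F where F: "primitive_on J f F" "continuous_on J F" using L1loc_primitive[OF J fl] by blast
  have "bounded_increments J F"
  proof (rule Baire_bounded_increments[OF J F(2)])
    fix h :: real assume h: "h > 0"
    then have "M_avg h f \<in> C_ub J" using f by (simp add: Mcl_def)
    then have "bounded (M_avg h f ` J)"
      by (rule C_ub_continuous_on(1)[OF J]) (use continuous_on_M_avg[OF J fl] h in simp)
    then obtain B where B: "\<And>t. t \<in> J \<Longrightarrow> norm (M_avg h f t) \<le> B" unfolding bounded_iff by blast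
    have "norm (F (x + h) - F x) \<le> h * B" if "x \<in> J" for x
      using B[OF that] h by (simp add: M_avg_eq[OF J fl F(1) that] divide_le_eq mult.commute)
    then show "\<exists>B. \<forall>x\<in>J. norm (F (x + h) - F x) \<le> B" by blast
  qed
  then show "f \<in> erg_class J \<Omega> z"
    by (rule erg_class_of_M_avg[OF J fl F(1)]) (use f in \<open>simp add: Mcl_def\<close>)
qed

lemma erg_class_bounded_increments:
  assumes J: "half_line J" and f: "f \<in> erg_class J \<Omega> z" and z: "0 \<in> \<Omega>" and F: "primitive_on J f F"
  shows "bounded_increments J F"
proof -
  have "primitive_on J (modulate 0 f) F" using F by simp
  from erg_classD[OF J f z this] show ?thesis using mean_on_bounded_increments[OF J] by blast
qed

lemma erg_class_M_avg_bounded: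
  assumes J: "half_line J" and f: "f \<in> erg_class J \<Omega> z" and z: "0 \<in> \<Omega>" and h: "h > 0"
  shows "\<exists>B. \<forall>t\<in>J. norm (M_avg h f t) \<le> B"
proof -
  have fl: "f \<in> L1loc J" by (rule erg_class_L1loc[OF f])
  obtain F where F: "primitive_on J f F" using L1loc_primitive[OF J fl] by blast
  obtain B where B: "\<And>x s. x \<in> J \<Longrightarrow> s \<in> {0..h} \<Longrightarrow> norm (F (x + s) - F x) \<le> B"
    using erg_class_bounded_increments[OF J f z F] unfolding bounded_increments_def by blast
  have "norm (M_avg h f t) \<le> B / h" if "t \<in> J" for t
    using B[OF that, of h] h by (simp add: M_avg_eq[OF J fl F that] divide_right_mono)
  then show ?thesis by blast
qed

text \<open>
  As \<open>f\<close> has a mean, its primitive has bounded increments.  Hence the first average is bounded, and the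
  second one is Lipschitz continuous.
\<close>

lemma erg_class_subset_Mcl_Mcl:
  assumes J: "half_line J" and z: "0 \<in> \<Omega>"
  shows "erg_class J \<Omega> z \<subseteq> Mcl J (Mcl J (erg_class J \<Omega> z \<inter> C_ub J))"
proof
  fix f :: "real \<Rightarrow> 'a" assume f: "f \<in> erg_class J \<Omega> z"
  then have fl: "f \<in> L1loc J" by (simp add: erg_class_L1loc)
  have "M_avg h f \<in> Mcl J (erg_class J \<Omega> z \<inter> C_ub J)" if h: "h > 0" for h
  proof -
    have c: "continuous_on J (M_avg h f)" using h by (intro continuous_on_M_avg[OF J fl]) simp
    have l: "M_avg h f \<in> L1loc J" by (rule continuous_L1loc[OF J c])
    obtain G where G: "primitive_on J (M_avg h f) G" using L1loc_primitive[OF J l] by blast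
    obtain B where B: "\<And>t. t \<in> J \<Longrightarrow> norm (M_avg h f t) \<le> B" using erg_class_M_avg_bounded[OF J f z h] by blast
    have "M_avg k (M_avg h f) \<in> C_ub J" if "k > 0" for k
      by (rule M_avg_C_ub[OF J l G that bounded_continuous_Lipschitz_primitive[OF J c B G]])
    then show ?thesis unfolding Mcl_def using l erg_class_M_avg[OF J erg_class_M_avg[OF J f h]] by blast
  qed
  then show "f \<in> Mcl J (Mcl J (erg_class J \<Omega> z \<inter> C_ub J))"
    using fl unfolding Mcl_def[of J "Mcl J _"] by blast
qed

text \<open>
  If \<open>f\<close> has a Lipschitz primitive, which is the case for bounded \<open>f\<close>, then so have all its averages.
  They have bounded increments, so each averaging can be undone.
\<close>

lemma Mcl_funpow_erg_class_Lipschitz: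
  assumes J: "half_line J" and "f \<in> (Mcl J ^^ n) (erg_class J \<Omega> z)" and "f \<in> L1loc J" and "primitive_on J f F"
    and "\<And>x y. x \<in> J \<Longrightarrow> x \<le> y \<Longrightarrow> norm (F y - F x) \<le> B * (y - x)"
  shows "f \<in> erg_class J \<Omega> z"
  using assms(2-)
proof (induction n arbitrary: f F B)
  case (Suc n)
  note f = Suc.prems(2) and F = Suc.prems(3) and Lip = Suc.prems(4)
  show ?case
  proof (rule erg_class_of_M_avg[OF J f F Lipschitz_bounded_increments[OF J Lip]])
    fix h :: real assume h: "h > 0"
    have c: "continuous_on J (M_avg h f)" using h by (intro continuous_on_M_avg[OF J f]) simp
    have l: "M_avg h f \<in> L1loc J" by (rule continuous_L1loc[OF J c])
    obtain G where G: "primitive_on J (M_avg h f) G" using L1loc_primitive[OF J l] by blast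
    have "norm (M_avg h f t) \<le> B" if "t \<in> J" for t
      using Lip[OF that, of "t + h"] h by (simp add: M_avg_eq[OF J f F that] divide_le_eq)
    from bounded_continuous_Lipschitz_primitive[OF J c this G]
    show "M_avg h f \<in> erg_class J \<Omega> z"
      using Suc.prems(1) h by (intro Suc.IH[OF _ l G]) (auto simp: Mcl_def)
  qed
qed simp

section \<open>Test functions\<close>

lemma nderiv_0 [simp]: "nderiv 0 \<phi> = \<phi>"
  by (simp add: nderiv_def)

lemma nderiv_Suc: "nderiv (Suc k) \<phi> t = vector_derivative (nderiv k \<phi>) (at t)"
  by (simp add: nderiv_def)

text \<open>
  All higher derivatives are known once a sequence of functions is exhibited in which each one is the
  derivative of its predecessor.
\<close>

lemma nderiv_chain:
  assumes "\<And>k t. (\<Phi> k has_vector_derivative \<Phi> (Suc k) t) (at t)"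
  shows "nderiv k (\<Phi> 0) = \<Phi> k"
proof (induction k)
  case (Suc k)
  show ?case by (rule ext) (simp add: nderiv_Suc Suc vector_derivative_at[OF assms])
qed simp

definition smooth :: "(real \<Rightarrow> complex) \<Rightarrow> bool" where
  "smooth \<phi> \<longleftrightarrow> (\<forall>k t. nderiv k \<phi> differentiable (at t))"

lemma smooth_nderiv: "smooth \<phi> \<Longrightarrow> (nderiv k \<phi> has_vector_derivative nderiv (Suc k) \<phi> t) (at t)"
  by (simp add: smooth_def nderiv_Suc vector_derivative_works)

lemma smooth_chain:
  assumes "\<And>k t. (\<Phi> k has_vector_derivative \<Phi> (Suc k) t) (at t)"
  shows "smooth (\<Phi> 0)"
  unfolding smooth_def nderiv_chain[where \<Phi>=\<Phi>, OF assms] using assms by (blast intro: differentiableI_vector)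

text \<open>
  Smoothness without formulas for the higher derivatives: it suffices to find a family containing \<open>f\<close>
  that is closed under differentiation.
\<close>

lemma smooth_family:
  assumes \<F>: "\<And>f. f \<in> \<F> \<Longrightarrow> \<exists>f'\<in>\<F>. \<forall>t. (f has_vector_derivative f' t) (at t)" and f: "f \<in> \<F>"
  shows "smooth f"
proof -
  obtain d where d: "\<And>f. f \<in> \<F> \<Longrightarrow> d f \<in> \<F> \<and> (\<forall>t. (f has_vector_derivative d f t) (at t))"
    using \<F> by metis
  have "(d ^^ k) f \<in> \<F>" for k using f d by (induction k) auto
  then have "((d ^^ k) f has_vector_derivative (d ^^ Suc k) f t) (at t)" for k t using d by simp
  from smooth_chain[where \<Phi>="\<lambda>k. (d ^^ k) f", OF this] show ?thesis by simp
qed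

lemma
  assumes \<phi>: "smooth \<phi>" and \<psi>: "smooth \<psi>"
  shows smooth_add: "smooth (\<lambda>t. \<phi> t + \<psi> t)"
    and nderiv_add: "nderiv k (\<lambda>t. \<phi> t + \<psi> t) = (\<lambda>t. nderiv k \<phi> t + nderiv k \<psi> t)"
  using smooth_chain[where \<Phi>="\<lambda>k t. nderiv k \<phi> t + nderiv k \<psi> t"] nderiv_chain[where \<Phi>="\<lambda>k t. nderiv k \<phi> t + nderiv k \<psi> t"]
  by (simp_all add: has_vector_derivative_add smooth_nderiv[OF \<phi>] smooth_nderiv[OF \<psi>])

lemma
  assumes \<phi>: "smooth \<phi>"
  shows smooth_cmult: "smooth (\<lambda>t. c * \<phi> t)"
    and nderiv_cmult: "nderiv k (\<lambda>t. c * \<phi> t) = (\<lambda>t. c * nderiv k \<phi> t)"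
  using smooth_chain[where \<Phi>="\<lambda>k t. c * nderiv k \<phi> t"] nderiv_chain[where \<Phi>="\<lambda>k t. c * nderiv k \<phi> t"]
    has_vector_derivative_mult_right[OF smooth_nderiv[OF \<phi>]]
  by (simp_all del: has_vector_derivative_mult_right)

lemma
  assumes \<phi>: "smooth \<phi>"
  shows smooth_affine: "smooth (\<lambda>t. \<phi> (a + b * t))"
    and nderiv_affine: "nderiv k (\<lambda>t. \<phi> (a + b * t)) = (\<lambda>t. of_real (b ^ k) * nderiv k \<phi> (a + b * t))"
proof -
  have *: "((\<lambda>t. of_real (b ^ k) * nderiv k \<phi> (a + b * t)) has_vector_derivative of_real (b ^ Suc k) * nderiv (Suc k) \<phi> (a + b * t)) (at t)" for k t
  proof -
    have "((\<lambda>t. a + b * t) has_vector_derivative b) (at t)" by (auto intro!: derivative_eq_intros)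
    from vector_diff_chain_at[OF this smooth_nderiv[OF \<phi>, of k "a + b * t"]]
    have "((\<lambda>t. nderiv k \<phi> (a + b * t)) has_vector_derivative b *\<^sub>R nderiv (Suc k) \<phi> (a + b * t)) (at t)" by (simp add: comp_def)
    from has_vector_derivative_mult_right[OF this, of "of_real (b ^ k)"]
    show ?thesis by (simp add: scaleR_conv_of_real mult_ac)
  qed
  show "smooth (\<lambda>t. \<phi> (a + b * t))"
    using smooth_chain[where \<Phi>="\<lambda>k t. of_real (b ^ k) * nderiv k \<phi> (a + b * t)", OF *] by simp
  show "nderiv k (\<lambda>t. \<phi> (a + b * t)) = (\<lambda>t. of_real (b ^ k) * nderiv k \<phi> (a + b * t))"
    using nderiv_chain[where \<Phi>="\<lambda>k t. of_real (b ^ k) * nderiv k \<phi> (a + b * t)", OF *, of k] by simp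
qed

lemma nderiv_nderiv:
  assumes \<phi>: "smooth \<phi>"
  shows "smooth (nderiv j \<phi>)" "nderiv k (nderiv j \<phi>) = nderiv (k + j) \<phi>"
proof -
  have *: "(nderiv (k + j) \<phi> has_vector_derivative nderiv (Suc k + j) \<phi> t) (at t)" for k t
    using smooth_nderiv[OF \<phi>, of "k + j" t] by simp
  show "smooth (nderiv j \<phi>)" using smooth_chain[where \<Phi>="\<lambda>k. nderiv (k + j) \<phi>", OF *] by simp
  show "nderiv k (nderiv j \<phi>) = nderiv (k + j) \<phi>" using nderiv_chain[where \<Phi>="\<lambda>k. nderiv (k + j) \<phi>", OF *] by simp
qed

text \<open>
  The sums of products of derivatives of \<open>\<phi>\<close> and \<open>\<psi>\<close>: by the product rule they are closed under
  differentiation.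
\<close>

inductive_set derivative_products :: "(real \<Rightarrow> complex) \<Rightarrow> (real \<Rightarrow> complex) \<Rightarrow> (real \<Rightarrow> complex) set" for \<phi> \<psi> where
  product: "(\<lambda>t. nderiv i \<phi> t * nderiv j \<psi> t) \<in> derivative_products \<phi> \<psi>"
| sum: "f \<in> derivative_products \<phi> \<psi> \<Longrightarrow> g \<in> derivative_products \<phi> \<psi> \<Longrightarrow> (\<lambda>t. f t + g t) \<in> derivative_products \<phi> \<psi>"

lemma smooth_mult:
  assumes \<phi>: "smooth \<phi>" and \<psi>: "smooth \<psi>"
  shows "smooth (\<lambda>t. \<phi> t * \<psi> t)"
proof (rule smooth_family)
  show "\<exists>f'\<in>derivative_products \<phi> \<psi>. \<forall>t. (f has_vector_derivative f' t) (at t)" if "f \<in> derivative_products \<phi> \<psi>" for f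
    using that
  proof induction
    case (product i j)
    show ?case
    proof (intro bexI allI)
      show "(\<lambda>t. nderiv i \<phi> t * nderiv (Suc j) \<psi> t + nderiv (Suc i) \<phi> t * nderiv j \<psi> t) \<in> derivative_products \<phi> \<psi>"
        by (intro derivative_products.intros)
      show "((\<lambda>t. nderiv i \<phi> t * nderiv j \<psi> t) has_vector_derivative
          nderiv i \<phi> t * nderiv (Suc j) \<psi> t + nderiv (Suc i) \<phi> t * nderiv j \<psi> t) (at t)" for t
        by (intro has_vector_derivative_mult smooth_nderiv \<phi> \<psi>)
    qed
  next
    case (sum f g)
    then obtain f' g' where "f' \<in> derivative_products \<phi> \<psi>" "g' \<in> derivative_products \<phi> \<psi>"
      and "\<And>t. (f has_vector_derivative f' t) (at t)" "\<And>t. (g has_vector_derivative g' t) (at t)" by blast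
    then show ?case
      by (intro bexI[of _ "\<lambda>t. f' t + g' t"] allI has_vector_derivative_add derivative_products.sum)
  qed
  show "(\<lambda>t. \<phi> t * \<psi> t) \<in> derivative_products \<phi> \<psi>"
    using derivative_products.product[of 0 \<phi> 0 \<psi>] by simp
qed

lemma smooth_wave: "smooth (wave \<omega>)"
proof -
  have "((\<lambda>t. (\<i> * of_real \<omega>) ^ k * wave \<omega> t) has_vector_derivative (\<i> * of_real \<omega>) ^ Suc k * wave \<omega> t) (at t)" for k t
    using has_vector_derivative_mult_right[OF wave_derivative[of \<omega> t UNIV], of "(\<i> * of_real \<omega>) ^ k"] by (simp add: mult_ac)
  from smooth_chain[where \<Phi>="\<lambda>k t. (\<i> * of_real \<omega>) ^ k * wave \<omega> t", OF this] show ?thesis by simp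
qed

lemma test_fun_iff: "\<phi> \<in> test_fun \<longleftrightarrow> smooth \<phi> \<and> (\<exists>R>0. \<forall>t. \<bar>t\<bar> \<ge> R \<longrightarrow> \<phi> t = 0)"
proof -
  have "compact (closure {t. \<phi> t \<noteq> 0}) \<longleftrightarrow> (\<exists>R>0. \<forall>t. \<bar>t\<bar> \<ge> R \<longrightarrow> \<phi> t = 0)"
  proof
    assume "compact (closure {t. \<phi> t \<noteq> 0})"
    then obtain R where "R > 0" "\<And>t. \<phi> t \<noteq> 0 \<Longrightarrow> \<bar>t\<bar> \<le> R"
      unfolding compact_closure bounded_pos by auto
    then show "\<exists>R>0. \<forall>t. \<bar>t\<bar> \<ge> R \<longrightarrow> \<phi> t = 0" by (intro exI[of _ "R + 1"]) force
  next
    assume "\<exists>R>0. \<forall>t. \<bar>t\<bar> \<ge> R \<longrightarrow> \<phi> t = 0"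
    then obtain R where "R > 0" "\<forall>t. \<bar>t\<bar> \<ge> R \<longrightarrow> \<phi> t = 0" by blast
    then have "{t. \<phi> t \<noteq> 0} \<subseteq> cball 0 R" by (auto simp: dist_real_def not_le less_imp_le) (meson linear)
    then show "compact (closure {t. \<phi> t \<noteq> 0})" unfolding compact_closure by (rule bounded_subset[OF bounded_cball])
  qed
  then show ?thesis by (simp add: test_fun_def smooth_def)
qed

lemma test_fun_smooth: "\<phi> \<in> test_fun \<Longrightarrow> smooth \<phi>" by (simp add: test_fun_iff)

lemma nderiv_zero_outside:
  assumes \<phi>: "smooth \<phi>" and z: "\<And>t. \<bar>t\<bar> \<ge> R \<Longrightarrow> \<phi> t = 0" and t: "\<bar>t\<bar> > R"
  shows "nderiv k \<phi> t = 0"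
  using t
proof (induction k arbitrary: t)
  case (Suc k)
  have "open {u::real. \<bar>u\<bar> > R}" by (intro open_Collect_less continuous_intros)
  then have "(nderiv k \<phi> has_vector_derivative 0) (at t)"
    by (rule has_vector_derivative_transform_within_open[OF has_vector_derivative_const])
      (use Suc in auto)
  then show ?case by (simp add: nderiv_Suc vector_derivative_at)
qed (use z in simp)

lemma test_fun_nderiv:
  assumes "\<phi> \<in> test_fun" shows "nderiv j \<phi> \<in> test_fun"
proof -
  obtain R where R: "R > 0" "\<And>t. \<bar>t\<bar> \<ge> R \<Longrightarrow> \<phi> t = 0" using assms by (auto simp: test_fun_iff)
  have "nderiv j \<phi> t = 0" if "\<bar>t\<bar> \<ge> R + 1" for t
    by (rule nderiv_zero_outside[OF test_fun_smooth[OF assms] R(2)]) (use that in auto)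
  then show ?thesis
    using nderiv_nderiv(1)[OF test_fun_smooth[OF assms]] R(1) by (auto simp: test_fun_iff intro!: exI[of _ "R + 1"])
qed

lemma test_fun_add: "\<phi> \<in> test_fun \<Longrightarrow> \<psi> \<in> test_fun \<Longrightarrow> (\<lambda>t. \<phi> t + \<psi> t) \<in> test_fun"
proof -
  assume *: "\<phi> \<in> test_fun" "\<psi> \<in> test_fun"
  then obtain R S where "R > 0" "\<And>t. \<bar>t\<bar> \<ge> R \<Longrightarrow> \<phi> t = 0" "S > 0" "\<And>t. \<bar>t\<bar> \<ge> S \<Longrightarrow> \<psi> t = 0"
    by (auto simp: test_fun_iff)
  then show ?thesis using * by (auto simp: test_fun_iff smooth_add intro!: exI[of _ "max R S"])
qed

lemma test_fun_cmult: "\<phi> \<in> test_fun \<Longrightarrow> (\<lambda>t. c * \<phi> t) \<in> test_fun"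
  by (auto simp: test_fun_iff smooth_cmult)

lemma test_fun_affine:
  assumes \<phi>: "\<phi> \<in> test_fun" and b: "b \<noteq> 0"
  shows "(\<lambda>t. \<phi> (a + b * t)) \<in> test_fun"
proof -
  obtain R where R: "R > 0" "\<And>t. \<bar>t\<bar> \<ge> R \<Longrightarrow> \<phi> t = 0" using \<phi> by (auto simp: test_fun_iff)
  have "\<phi> (a + b * t) = 0" if "\<bar>t\<bar> \<ge> (R + \<bar>a\<bar>) / \<bar>b\<bar>" for t
  proof (rule R(2))
    have "\<bar>b * t\<bar> \<ge> R + \<bar>a\<bar>" using that b by (simp add: divide_le_eq abs_mult mult.commute)
    then show "\<bar>a + b * t\<bar> \<ge> R" by linarith
  qed
  then show ?thesis
    using smooth_affine[OF test_fun_smooth[OF \<phi>]] R(1) b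
    by (auto simp: test_fun_iff intro!: exI[of _ "(R + \<bar>a\<bar>) / \<bar>b\<bar>"] divide_pos_pos)
qed

lemma test_fun_reflect: "\<phi> \<in> test_fun \<Longrightarrow> (\<lambda>y. \<phi> (x - y)) \<in> test_fun"
  using test_fun_affine[of \<phi> "-1" x] by simp

lemma nderiv_continuous: "smooth \<phi> \<Longrightarrow> continuous_on S (nderiv k \<phi>)"
  using smooth_nderiv by (meson continuous_at_imp_continuous_on has_vector_derivative_continuous)

lemma test_fun_bounded:
  assumes "\<phi> \<in> test_fun"
  shows "\<exists>B. \<forall>t. norm (nderiv k \<phi> t) \<le> B"
proof -
  obtain R where R: "R > 0" "\<And>t. \<bar>t\<bar> \<ge> R \<Longrightarrow> nderiv k \<phi> t = 0"
    using test_fun_nderiv[OF assms, of k] by (auto simp: test_fun_iff)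
  obtain B where B: "B > 0" "\<And>t. t \<in> {-R..R} \<Longrightarrow> norm (nderiv k \<phi> t) \<le> B"
    using compact_imp_bounded[OF compact_continuous_image[OF nderiv_continuous[OF test_fun_smooth[OF assms], of "{-R..R}" k]]]
    unfolding bounded_pos by force
  have "norm (nderiv k \<phi> t) \<le> B" for t
    using B(1) B(2)[of t] R(2)[of t] by (cases "\<bar>t\<bar> \<ge> R") (auto simp: abs_le_iff not_le abs_less_iff)
  then show ?thesis by blast
qed

text \<open>
  The functions \<open>p(1/t) exp(-1/t)\<close>, extended by zero, form a family that is closed under
  differentiation; \<open>p \<mapsto> X\<^sup>2 (p - p')\<close> is the effect on the polynomial.
\<close>

definition flat_exp :: "real poly \<Rightarrow> real \<Rightarrow> real" where
  "flat_exp p t = (if t > 0 then poly p (1 / t) * exp (- (1 / t)) else 0)"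

lemma poly_exp_tendsto_0: "((\<lambda>x::real. poly p x * exp (- x)) \<longlongrightarrow> 0) at_top"
proof (induction p)
  case (pCons a p)
  have "((\<lambda>x::real. a * exp (- x) + x * (poly p x * exp (- x))) \<longlongrightarrow> 0) at_top" if "((\<lambda>x::real. x * (poly p x * exp (- x))) \<longlongrightarrow> 0) at_top"
    using tendsto_add[OF tendsto_mult_right_zero[of "\<lambda>x::real. exp (- x)" at_top a] that]
      filterlim_compose[OF exp_at_bot filterlim_uminus_at_bot_at_top] by simp
  moreover have "((\<lambda>x::real. x * (poly p x * exp (- x))) \<longlongrightarrow> 0) at_top"
  proof -
    have "((\<lambda>x::real. \<Sum>i\<le>degree p. coeff p i * (x ^ Suc i / exp x)) \<longlongrightarrow> (\<Sum>i\<le>degree p. coeff p i * 0)) at_top"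
      by (intro tendsto_sum tendsto_mult tendsto_const tendsto_power_div_exp_0)
    moreover have "(\<Sum>i\<le>degree p. coeff p i * (x ^ Suc i / exp x)) = x * (poly p x * exp (- x))" for x :: real
      by (simp add: poly_altdef sum_distrib_left sum_distrib_right exp_minus field_simps)
    ultimately show ?thesis by simp
  qed
  ultimately show ?case by (simp add: algebra_simps)
qed simp

lemma flat_exp_derivative:
  "(flat_exp p has_real_derivative flat_exp ([:0,0,1:] * (p - pderiv p)) t) (at t)"
proof -
  consider "t > 0" | "t < 0" | "t = 0" by linarith
  then show ?thesis
  proof cases
    case 1
    have "((\<lambda>t. poly p (1 / t) * exp (- (1 / t))) has_real_derivative flat_exp ([:0,0,1:] * (p - pderiv p)) t) (at t)"
      using 1 by (auto intro!: derivative_eq_intros DERIV_chain2[OF poly_DERIV] simp: flat_exp_def)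
        (simp add: field_simps power2_eq_square)
    then show ?thesis
      by (rule has_field_derivative_transform_within_open[of _ _ _ "{0<..}"]) (use 1 in \<open>auto simp: flat_exp_def\<close>)
  next
    case 2
    have "((\<lambda>t. 0) has_real_derivative flat_exp ([:0,0,1:] * (p - pderiv p)) t) (at t)"
      using 2 by (simp add: flat_exp_def)
    then show ?thesis
      by (rule has_field_derivative_transform_within_open[of _ _ _ "{..<0}"]) (use 2 in \<open>auto simp: flat_exp_def\<close>)
  next
    case 3
    have "((\<lambda>h. (flat_exp p (0 + h) - flat_exp p 0) / h) \<longlongrightarrow> 0) (at_right 0)"
    proof (rule Lim_transform_eventually)
      show "((\<lambda>h::real. poly ([:0,1:] * p) (inverse h) * exp (- inverse h)) \<longlongrightarrow> 0) (at_right 0)"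
        by (rule filterlim_compose[OF poly_exp_tendsto_0 filterlim_inverse_at_top_right])
      show "\<forall>\<^sub>F h in at_right 0. poly ([:0,1:] * p) (inverse h) * exp (- inverse h) = (flat_exp p (0 + h) - flat_exp p 0) / h"
        by (rule eventually_at_rightI[of 0 1]) (auto simp: flat_exp_def field_simps)
    qed
    moreover have "((\<lambda>h. (flat_exp p (0 + h) - flat_exp p 0) / h) \<longlongrightarrow> 0) (at_left 0)"
    proof (rule Lim_transform_eventually[OF tendsto_const])
      show "\<forall>\<^sub>F h in at_left 0. 0 = (flat_exp p (0 + h) - flat_exp p 0) / h"
        by (rule eventually_at_leftI[of "-1" 0]) (auto simp: flat_exp_def)
    qed
    ultimately have "((\<lambda>h. (flat_exp p (0 + h) - flat_exp p 0) / h) \<longlongrightarrow> 0) (at 0)"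
      by (rule filterlim_split_at[rotated])
    then show ?thesis using 3 by (simp add: DERIV_def flat_exp_def)
  qed
qed

lemma smooth_flat_exp: "smooth (\<lambda>t. of_real (flat_exp p t))"
proof (rule smooth_family[where \<F>="range (\<lambda>p t. complex_of_real (flat_exp p t))"])
  fix f assume "f \<in> range (\<lambda>p t. complex_of_real (flat_exp p t))"
  then obtain p where f: "f = (\<lambda>t. complex_of_real (flat_exp p t))" by blast
  show "\<exists>f'\<in>range (\<lambda>p t. complex_of_real (flat_exp p t)). \<forall>t. (f has_vector_derivative f' t) (at t)"
    unfolding f by (intro bexI[of _ "\<lambda>t. complex_of_real (flat_exp ([:0,0,1:] * (p - pderiv p)) t)"] allI
        has_vector_derivative_of_real flat_exp_derivative) auto
qed auto

lemma ex_bump: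
  obtains \<beta> :: "real \<Rightarrow> real" where "(\<lambda>t. complex_of_real (\<beta> t)) \<in> test_fun" "\<And>t. \<beta> t \<ge> 0" "\<beta> 0 > 0"
    "\<And>t. \<beta> t \<le> 1" "\<And>t. \<bar>t\<bar> \<ge> 1 \<Longrightarrow> \<beta> t = 0"
proof -
  define \<beta> where "\<beta> t = flat_exp 1 (1 + 1 * t) * flat_exp 1 (1 + (-1) * t)" for t
  have f: "0 \<le> flat_exp 1 t" "flat_exp 1 t \<le> 1" for t by (auto simp: flat_exp_def)
  have "smooth (\<lambda>t. of_real (flat_exp 1 (1 + 1 * t)) * of_real (flat_exp 1 (1 + (-1) * t)))"
    by (intro smooth_mult smooth_affine[OF smooth_flat_exp])
  moreover have z: "\<beta> t = 0" if "\<bar>t\<bar> \<ge> 1" for t using that by (auto simp: \<beta>_def flat_exp_def)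
  ultimately have "(\<lambda>t. complex_of_real (\<beta> t)) \<in> test_fun"
    by (auto simp: test_fun_iff \<beta>_def[abs_def] intro!: exI[of _ 1])
  moreover have "\<beta> t \<ge> 0" "\<beta> t \<le> 1" for t unfolding \<beta>_def using f by (auto intro: mult_le_one)
  moreover have "\<beta> 0 > 0" by (simp add: \<beta>_def flat_exp_def)
  ultimately show ?thesis using z that by blast
qed

section \<open>Convolution of a locally integrable function with a test function\<close>

lemma dist_of_fun_eq:
  fixes f :: "real \<Rightarrow> 'a::complex_banach"
  assumes f: "f \<in> L1loc UNIV" and \<phi>: "\<phi> \<in> test_fun" and z: "\<And>t. t \<notin> {a..b} \<Longrightarrow> \<phi> t = 0"
  shows "dist_of_fun f \<phi> = integral {a..b} (\<lambda>t. \<phi> t *\<^sub>C f t)"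
proof -
  have "bochner_integrable (lebesgue_on {a..b}) (\<lambda>t. \<phi> t *\<^sub>C f t)"
    using nderiv_continuous[OF test_fun_smooth[OF \<phi>], of _ 0]
    by (intro bochner_integrable_scaleC_continuous L1locD[OF half_line_UNIV f]) auto
  then have "bochner_integral lebesgue (\<lambda>t. \<phi> t *\<^sub>C f t) = integral {a..b} (\<lambda>t. \<phi> t *\<^sub>C f t)"
    by (rule bochner_integral_compact_support) (simp add: z scaleC.zero_left)
  then show ?thesis using \<phi> by (simp add: dist_of_fun_def)
qed

lemma dist_of_fun_distribution:
  fixes f :: "real \<Rightarrow> 'a::complex_banach"
  assumes f: "f \<in> L1loc UNIV"
  shows "dist_of_fun f \<in> distributions"
  unfolding distributions_def
proof (intro CollectI conjI ballI allI impI)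
  show "dist_of_fun f \<in> extensional test_fun" unfolding dist_of_fun_def by (rule restrict_extensional)
  have int: "(\<lambda>t. \<phi> t *\<^sub>C f t) integrable_on {a..b}" if "\<phi> \<in> test_fun" for \<phi> a b
    using nderiv_continuous[OF test_fun_smooth[OF that], of UNIV 0]
    by (intro L1loc_integrable(1)[OF half_line_UNIV] L1loc_scaleC[OF half_line_UNIV f]) auto
  have ex: "\<exists>R. \<forall>t. t \<notin> {-R..R} \<longrightarrow> \<phi> t = 0" if \<phi>: "\<phi> \<in> test_fun" for \<phi>
  proof -
    obtain R where "\<And>t. \<bar>t\<bar> \<ge> R \<Longrightarrow> \<phi> t = 0" using \<phi> by (auto simp: test_fun_iff)
    then show ?thesis by (intro exI[of _ R]) (auto simp: abs_le_iff)
  qed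
  {
    fix \<phi> \<psi> assume *: "\<phi> \<in> test_fun" "\<psi> \<in> test_fun"
    obtain R S where R: "\<forall>t. t \<notin> {-R..R} \<longrightarrow> \<phi> t = 0" and S: "\<forall>t. t \<notin> {-S..S} \<longrightarrow> \<psi> t = 0"
      using ex[OF *(1)] ex[OF *(2)] by blast
    have z: "\<phi> t = 0" "\<psi> t = 0" if "t \<notin> {-max R S..max R S}" for t
    proof -
      have "t \<notin> {-R..R}" "t \<notin> {-S..S}" using that by auto
      then show "\<phi> t = 0" "\<psi> t = 0" using R S by blast+
    qed
    have "dist_of_fun f \<eta> = integral {-max R S..max R S} (\<lambda>t. \<eta> t *\<^sub>C f t)"
      if "\<eta> \<in> {\<phi>, \<psi>, (\<lambda>t. \<phi> t + \<psi> t)}" for \<eta>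
      using that z * by (intro dist_of_fun_eq[OF f]) (auto intro: test_fun_add)
    then show "dist_of_fun f (\<lambda>t. \<phi> t + \<psi> t) = dist_of_fun f \<phi> + dist_of_fun f \<psi>"
      by (simp add: scaleC.add_left integral_add int *)
  }
  {
    fix c \<phi> assume *: "\<phi> \<in> test_fun"
    obtain R where R: "\<forall>t. t \<notin> {-R..R} \<longrightarrow> \<phi> t = 0" using ex[OF *] by blast
    have "dist_of_fun f \<eta> = integral {-R..R} (\<lambda>t. \<eta> t *\<^sub>C f t)" if "\<eta> \<in> {\<phi>, (\<lambda>t. c * \<phi> t)}" for \<eta>
      using that R * by (intro dist_of_fun_eq[OF f]) (auto intro: test_fun_cmult)
    then show "dist_of_fun f (\<lambda>t. c * \<phi> t) = c *\<^sub>C dist_of_fun f \<phi>"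
      using integral_linear[OF int[OF *] scaleC.bounded_linear_right[of c]]
      by (simp add: comp_def scaleC_scaleC)
  }
  {
    fix \<phi>s :: "nat \<Rightarrow> real \<Rightarrow> complex" and \<phi>
    assume \<phi>: "\<phi> \<in> test_fun" and *: "(\<forall>n. \<phi>s n \<in> test_fun) \<and> test_tendsto \<phi>s \<phi>"
    obtain K where K: "compact K" "\<And>n. closure {t. \<phi>s n t \<noteq> 0} \<subseteq> K" using * unfolding test_tendsto_def by blast
    obtain S where S: "\<forall>x\<in>K. norm x \<le> S" using compact_imp_bounded[OF K(1)] unfolding bounded_iff by blast
    obtain R where R: "\<forall>t. t \<notin> {-R..R} \<longrightarrow> \<phi> t = 0" using ex[OF \<phi>] by blast
    define a where "a = max R S"
    have z: "\<phi>s n t = 0" if "t \<notin> {-a..a}" for n t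
    proof (rule ccontr)
      assume "\<phi>s n t \<noteq> 0"
      then have "t \<in> K" by (intro subsetD[OF K(2)[of n]] subsetD[OF closure_subset]) simp
      then show False using S that by (auto simp: a_def abs_le_iff)
    qed
    have eq: "dist_of_fun f (\<phi>s n) - dist_of_fun f \<phi> = integral {-a..a} (\<lambda>t. (\<phi>s n t - \<phi> t) *\<^sub>C f t)" for n
    proof -
      have "dist_of_fun f (\<phi>s n) = integral {-a..a} (\<lambda>t. \<phi>s n t *\<^sub>C f t)"
        using * z by (intro dist_of_fun_eq[OF f]) auto
      moreover have "dist_of_fun f \<phi> = integral {-a..a} (\<lambda>t. \<phi> t *\<^sub>C f t)"
      proof (rule dist_of_fun_eq[OF f \<phi>])
        fix t assume "t \<notin> {-a..a}"
        then have "t \<notin> {-R..R}" by (auto simp: a_def)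
        then show "\<phi> t = 0" using R by blast
      qed
      ultimately show ?thesis using * \<phi> by (simp add: scaleC.diff_left integral_diff int)
    qed
    note nint = L1loc_integrable(2)[OF half_line_UNIV f UNIV_I, of "-a" a]
    define I where "I = integral {-a..a} (\<lambda>t. norm (f t))"
    have I: "I \<ge> 0" unfolding I_def by (intro integral_nonneg nint) auto
    have "uniform_limit UNIV (\<lambda>n. nderiv 0 (\<phi>s n)) (nderiv 0 \<phi>) sequentially" using * unfolding test_tendsto_def by blast
    then have u: "uniform_limit UNIV \<phi>s \<phi> sequentially" by simp
    show "(\<lambda>n. dist_of_fun f (\<phi>s n)) \<longlonglongrightarrow> dist_of_fun f \<phi>"
    proof (rule metric_LIMSEQ_I)
      fix e :: real assume "e > 0"
      then have e: "e / (I + 1) > 0" using I by simp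
      have "\<forall>\<^sub>F n in sequentially. \<forall>x\<in>UNIV. dist (\<phi>s n x) (\<phi> x) < e / (I + 1)"
        by (rule uniform_limitD[OF u e])
      then obtain N where N: "\<And>n t. n \<ge> N \<Longrightarrow> norm (\<phi>s n t - \<phi> t) \<le> e / (I + 1)"
        unfolding eventually_sequentially dist_norm by (meson UNIV_I less_imp_le)
      have "norm (dist_of_fun f (\<phi>s n) - dist_of_fun f \<phi>) < e" if "n \<ge> N" for n
      proof -
        have "norm (dist_of_fun f (\<phi>s n) - dist_of_fun f \<phi>) \<le> integral {-a..a} (\<lambda>t. e / (I + 1) * norm (f t))"
          unfolding eq
        proof (rule Henstock_Kurzweil_Integration.integral_norm_bound_integral)
          show "(\<lambda>t. (\<phi>s n t - \<phi> t) *\<^sub>C f t) integrable_on {-a..a}"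
            using int[of "\<phi>s n"] int[OF \<phi>] * by (simp add: scaleC.diff_left integrable_diff)
          show "(\<lambda>t. e / (I + 1) * norm (f t)) integrable_on {-a..a}"
            using nint by (rule integrable_on_mult_right)
          show "norm ((\<phi>s n t - \<phi> t) *\<^sub>C f t) \<le> e / (I + 1) * norm (f t)" for t
            unfolding norm_scaleC by (rule mult_right_mono[OF N[OF that] norm_ge_zero])
        qed
        also have "\<dots> = e * (I / (I + 1))" by (simp add: I_def)
        also have "\<dots> < e * 1" using I \<open>e > 0\<close> by (intro mult_strict_left_mono) auto
        finally show ?thesis by simp
      qed
      then show "\<exists>N. \<forall>n\<ge>N. dist (dist_of_fun f (\<phi>s n)) (dist_of_fun f \<phi>) < e"
        by (auto simp: dist_norm)
    qed
  }
qed

lemma integral_shift_Icc: "integral {a..b} (\<lambda>s. f (x + s)) = integral {x + a..x + b} (f :: real \<Rightarrow> 'a::real_normed_vector)"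
  using integral_shift_cbox_plus[of a b f x] by (simp add: comp_def add.commute)

lemma dist_conv_fun:
  fixes f :: "real \<Rightarrow> 'a::complex_banach"
  assumes f: "f \<in> L1loc UNIV" and \<phi>: "\<phi> \<in> test_fun" and z: "\<And>t. \<bar>t\<bar> \<ge> R \<Longrightarrow> \<phi> t = 0"
  shows "dist_conv (dist_of_fun f) \<phi> x = integral {x - R..x + R} (\<lambda>y. \<phi> (x - y) *\<^sub>C f y)"
  unfolding dist_conv_def using z
  by (intro dist_of_fun_eq[OF f test_fun_reflect[OF \<phi>]]) (auto simp: abs_le_iff)

text \<open>
  With \<open>\<rho>(s) = e\<^sup>-\<^sup>i\<^sup>\<omega>\<^sup>s \<phi>(-s)\<close>, modulating \<open>f * \<phi>\<close> gives \<open>x \<mapsto> \<integral>\<rho>(s) (\<gamma>\<^sub>\<omega> f)(x + s) ds\<close>, and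
  integration by parts expresses it through a primitive \<open>G\<close> of \<open>\<gamma>\<^sub>\<omega> f\<close>.
\<close>

lemma modulate_dist_conv_fun:
  fixes f :: "real \<Rightarrow> 'a::complex_banach"
  assumes f: "f \<in> L1loc UNIV" and \<phi>: "\<phi> \<in> test_fun" and z: "\<And>t. \<bar>t\<bar> \<ge> R \<Longrightarrow> \<phi> t = 0" and R: "R \<ge> 0"
    and G: "primitive_on UNIV (modulate \<omega> f) G"
    and \<rho>: "\<rho> = (\<lambda>s. wave \<omega> (- s) * \<phi> (- s))"
    and \<rho>': "\<And>s. (\<rho> has_vector_derivative \<rho>' s) (at s)" and c\<rho>': "continuous_on UNIV \<rho>'"
  shows "modulate \<omega> (dist_conv (dist_of_fun f) \<phi>) x = - integral {-R..R} (\<lambda>s. \<rho>' s *\<^sub>C G (x + s))"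
proof -
  have int: "(\<lambda>y. \<phi> (x - y) *\<^sub>C f y) integrable_on {x - R..x + R}"
    using nderiv_continuous[OF test_fun_smooth[OF test_fun_reflect[OF \<phi>]], of UNIV 0]
    by (intro L1loc_integrable(1)[OF half_line_UNIV] L1loc_scaleC[OF half_line_UNIV f]) auto
  have eq: "wave \<omega> x *\<^sub>C (\<phi> (x - y) *\<^sub>C f y) = \<rho> (y - x) *\<^sub>C modulate \<omega> f y" for y
  proof -
    have "wave \<omega> x = wave \<omega> ((x - y) + y)" by simp
    then show ?thesis by (simp only: wave_add \<rho> modulate_wave scaleC_scaleC minus_diff_eq) (simp add: mult_ac)
  qed
  have "modulate \<omega> (dist_conv (dist_of_fun f) \<phi>) x = wave \<omega> x *\<^sub>C integral {x - R..x + R} (\<lambda>y. \<phi> (x - y) *\<^sub>C f y)"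
    by (simp only: modulate_wave dist_conv_fun[OF f \<phi> z])
  also have "\<dots> = integral {x - R..x + R} (\<lambda>y. \<rho> (y - x) *\<^sub>C modulate \<omega> f y)"
    using integral_linear[OF int scaleC.bounded_linear_right[of "wave \<omega> x"]]
    unfolding comp_def eq by (rule sym)
  also have "\<dots> = - integral {x - R..x + R} (\<lambda>y. \<rho>' (y - x) *\<^sub>C G y)"
  proof -
    have d: "((\<lambda>y. \<rho> (y - x)) has_vector_derivative \<rho>' (y - x)) (at y)" for y
    proof -
      have "((\<lambda>y. y - x) has_vector_derivative 1) (at y)" by (auto intro!: derivative_eq_intros)
      from vector_diff_chain_at[OF this \<rho>'] show ?thesis by (simp add: comp_def)
    qed
    have c: "continuous_on UNIV (\<lambda>y. \<rho>' (y - x))"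
      by (intro continuous_on_compose2[OF c\<rho>'] continuous_intros) auto
    have 0: "\<rho> R = 0" "\<rho> (- R) = 0" using R by (simp_all add: \<rho> z)
    show ?thesis
      using has_integral_scaleC_by_parts[OF half_line_UNIV modulate_L1loc[OF half_line_UNIV f] G d c UNIV_I, of "x - R" "x + R"] R 0
      by (simp add: integral_unique scaleC.zero_left)
  qed
  also have "integral {x - R..x + R} (\<lambda>y. \<rho>' (y - x) *\<^sub>C G y) = integral {-R..R} (\<lambda>s. \<rho>' s *\<^sub>C G (x + s))"
    using integral_shift_Icc[of "-R" R "\<lambda>y. \<rho>' (y - x) *\<^sub>C G y" x] by simp
  finally show ?thesis .
qed

text \<open>
  As \<open>G\<close> is merely continuous, the derivative is moved from \<open>\<rho>\<close> to a primitive \<open>K\<close> of \<open>G\<close> before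
  differentiating under the integral sign.
\<close>

lemma convolution_derivative:
  fixes G :: "real \<Rightarrow> 'a::complex_banach"
  assumes G: "continuous_on UNIV G" and R: "R \<ge> 0" and 0: "\<rho> R = 0" "\<rho> (- R) = 0"
    and \<rho>': "\<And>s. (\<rho> has_vector_derivative \<rho>' s) (at s)" and c\<rho>': "continuous_on UNIV \<rho>'"
  shows "((\<lambda>x. integral {-R..R} (\<lambda>s. \<rho> s *\<^sub>C G (x + s))) has_vector_derivative
           - integral {-R..R} (\<lambda>s. \<rho>' s *\<^sub>C G (x + s))) (at x)"
    and "continuous_on UNIV (\<lambda>x. integral {-R..R} (\<lambda>s. \<rho>' s *\<^sub>C G (x + s)))"
proof -
  obtain K where K: "primitive_on UNIV G K" "continuous_on UNIV K"
    using L1loc_primitive[OF half_line_UNIV continuous_L1loc[OF half_line_UNIV G]] by blast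
  have V: "integral {-R..R} (\<lambda>s. \<rho> s *\<^sub>C G (x + s)) = - integral {-R..R} (\<lambda>s. \<rho>' s *\<^sub>C K (x + s))" for x
  proof -
    have "continuous_on UNIV (\<lambda>s. G (x + s))" by (intro continuous_on_compose2[OF G] continuous_intros) auto
    moreover have "primitive_on UNIV (\<lambda>s. G (x + s)) (\<lambda>s. K (x + s))"
      unfolding primitive_on_def
    proof (intro ballI allI impI)
      fix a b :: real assume "a \<le> b"
      then have "(G has_integral K (x + b) - K (x + a)) {a + x..b + x}"
        using primitive_onD[OF K(1), of "a + x" "b + x"] by (simp add: add.commute)
      then show "((\<lambda>s. G (x + s)) has_integral K (x + b) - K (x + a)) {a..b}"
        unfolding has_integral_shift_Icc_real[symmetric] by (simp add: comp_def)
    qed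
    ultimately show ?thesis
      using has_integral_scaleC_by_parts[OF half_line_UNIV continuous_L1loc[OF half_line_UNIV] _ \<rho>' c\<rho>' UNIV_I, of "\<lambda>s. G (x + s)" "\<lambda>s. K (x + s)" "-R" R] R 0
      by (simp add: integral_unique scaleC.zero_left)
  qed
  have cG: "continuous_on (UNIV \<times> cbox (-R) R) (\<lambda>(x, s). \<rho>' s *\<^sub>C G (x + s))"
    unfolding split_def
    by (intro scaleC.continuous_on continuous_on_compose2[OF c\<rho>'] continuous_on_compose2[OF G] continuous_intros) auto
  show "continuous_on UNIV (\<lambda>x. integral {-R..R} (\<lambda>s. \<rho>' s *\<^sub>C G (x + s)))"
    using integral_continuous_on_param[OF cG] by simp
  have "((\<lambda>x. integral (cbox (-R) R) (\<lambda>s. \<rho>' s *\<^sub>C K (x + s))) has_vector_derivative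
      integral (cbox (-R) R) (\<lambda>s. \<rho>' s *\<^sub>C G (x + s))) (at x within UNIV)"
  proof (rule leibniz_rule_vector_derivative[OF _ _ cG])
    fix x s :: real
    have "((\<lambda>x. x + s) has_vector_derivative 1) (at x)" by (auto intro!: derivative_eq_intros)
    moreover have "(K has_vector_derivative G (x + s)) (at (x + s))"
      using primitive_on_derivative[OF half_line_UNIV G K(1) UNIV_I, of "x + s" "x + s - 1" "x + s + 1"]
      by (simp add: at_within_Icc_at)
    ultimately have "((\<lambda>x. K (x + s)) has_vector_derivative G (x + s)) (at x)"
      using vector_diff_chain_at[of "\<lambda>x. x + s" 1 x K "G (x + s)"] by (simp add: comp_def)
    from bounded_linear.has_vector_derivative[OF scaleC.bounded_linear_right this]
    show "((\<lambda>x. \<rho>' s *\<^sub>C K (x + s)) has_vector_derivative \<rho>' s *\<^sub>C G (x + s)) (at x within UNIV)" by simp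
  next
    fix x :: real
    show "(\<lambda>s. \<rho>' s *\<^sub>C K (x + s)) integrable_on cbox (-R) R"
      by (intro integrable_continuous scaleC.continuous_on continuous_on_subset[OF c\<rho>'] continuous_on_compose2[OF K(2)] continuous_intros) auto
  qed auto
  then show "((\<lambda>x. integral {-R..R} (\<lambda>s. \<rho> s *\<^sub>C G (x + s))) has_vector_derivative
           - integral {-R..R} (\<lambda>s. \<rho>' s *\<^sub>C G (x + s))) (at x)"
    unfolding V by (auto intro!: derivative_eq_intros)
qed

lemma
  fixes f :: "real \<Rightarrow> 'a::complex_banach"
  assumes f: "f \<in> L1loc UNIV" and \<phi>: "\<phi> \<in> test_fun" and z: "\<And>t. \<bar>t\<bar> \<ge> R \<Longrightarrow> \<phi> t = 0" and R: "R \<ge> 0"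
    and G: "primitive_on UNIV (modulate \<omega> f) G" and x: "x \<le> y"
  shows has_integral_modulate_dist_conv:
    "(modulate \<omega> (dist_conv (dist_of_fun f) \<phi>) has_integral
       integral {-R..R} (\<lambda>s. (wave \<omega> (- s) * \<phi> (- s)) *\<^sub>C (G (y + s) - G (x + s)))) {x..y}" (is ?th1)
    and continuous_on_modulate_dist_conv: "continuous_on UNIV (modulate \<omega> (dist_conv (dist_of_fun f) \<phi>))" (is ?th2)
proof -
  define \<rho> where "\<rho> = (\<lambda>s. wave \<omega> (- s) * \<phi> (- s))"
  have sm: "smooth \<rho>"
    using smooth_affine[OF smooth_mult[OF smooth_wave test_fun_smooth[OF \<phi>]], of \<omega> 0 "-1"] by (simp add: \<rho>_def)
  have \<rho>': "(\<rho> has_vector_derivative nderiv (Suc 0) \<rho> s) (at s)" for s using smooth_nderiv[OF sm, of 0] by simp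
  have c\<rho>': "continuous_on S (nderiv (Suc 0) \<rho>)" for S by (rule nderiv_continuous[OF sm])
  have c\<rho>: "continuous_on S \<rho>" for S using nderiv_continuous[OF sm, of S 0] by simp
  have 0: "\<rho> R = 0" "\<rho> (- R) = 0" using R by (simp_all add: \<rho>_def z)
  have cG: "continuous_on UNIV G" by (rule primitive_on_continuous[OF half_line_UNIV G])
  have m: "modulate \<omega> (dist_conv (dist_of_fun f) \<phi>) = (\<lambda>x. - integral {-R..R} (\<lambda>s. nderiv (Suc 0) \<rho> s *\<^sub>C G (x + s)))"
    using modulate_dist_conv_fun[OF f \<phi> z R G \<rho>_def \<rho>' c\<rho>'] by (rule ext)
  show ?th2 unfolding m by (intro continuous_intros convolution_derivative(2)[OF cG R 0 \<rho>' c\<rho>'])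
  let ?V = "\<lambda>x. integral {-R..R} (\<lambda>s. \<rho> s *\<^sub>C G (x + s))"
  have int: "(\<lambda>s. \<rho> s *\<^sub>C G (x + s)) integrable_on {-R..R}" for x
    by (rule integrable_continuous_interval, rule scaleC.continuous_on[OF c\<rho>], rule continuous_on_compose2[OF cG])
      (auto intro!: continuous_intros)
  have "(modulate \<omega> (dist_conv (dist_of_fun f) \<phi>) has_integral (?V y - ?V x)) {x..y}"
    unfolding m
    by (rule fundamental_theorem_of_calculus[OF x])
      (rule has_vector_derivative_at_within[OF convolution_derivative(1)[OF cG R 0 \<rho>' c\<rho>']])
  moreover have "?V y - ?V x = integral {-R..R} (\<lambda>s. \<rho> s *\<^sub>C (G (y + s) - G (x + s)))"
    unfolding scaleC.diff_right by (rule integral_diff[OF int int, symmetric])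
  ultimately show ?th1 unfolding \<rho>_def by (simp only:)
qed

lemma continuous_on_dist_conv:
  fixes f :: "real \<Rightarrow> 'a::complex_banach"
  assumes f: "f \<in> L1loc UNIV" and \<phi>: "\<phi> \<in> test_fun"
  shows "continuous_on UNIV (dist_conv (dist_of_fun f) \<phi>)"
proof -
  obtain R where R: "R > 0" "\<And>t. \<bar>t\<bar> \<ge> R \<Longrightarrow> \<phi> t = 0" using \<phi> by (auto simp: test_fun_iff)
  obtain F where "primitive_on UNIV f F" using L1loc_primitive[OF half_line_UNIV f] by blast
  then show ?thesis
    using continuous_on_modulate_dist_conv[OF f \<phi> R(2) less_imp_le[OF R(1)], where \<omega>=0 and G=F, OF _ _ order_refl] by simp
qed

text \<open>
  The increments of a primitive of \<open>\<gamma>\<^sub>\<omega> (f * \<phi>)\<close> are those of a primitive of \<open>\<gamma>\<^sub>\<omega> f\<close> averaged with the kernel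
  \<open>s \<mapsto> e\<^sup>-\<^sup>i\<^sup>\<omega>\<^sup>s \<phi>(-s)\<close>, just as for \<open>M\<^sub>h f\<close>.
\<close>

lemma erg_class_dist_conv:
  fixes f :: "real \<Rightarrow> 'a::complex_banach"
  assumes f: "f \<in> erg_class UNIV \<Omega> z" and \<phi>: "\<phi> \<in> test_fun"
  shows "dist_conv (dist_of_fun f) \<phi> \<in> erg_class UNIV \<Omega> z"
proof (rule erg_classI[OF half_line_UNIV])
  have fl: "f \<in> L1loc UNIV" by (rule erg_class_L1loc[OF f])
  let ?u = "dist_conv (dist_of_fun f) \<phi>"
  show ul: "?u \<in> L1loc UNIV" by (rule continuous_L1loc[OF half_line_UNIV continuous_on_dist_conv[OF fl \<phi>]])
  obtain R where R: "R > 0" "\<And>t. \<bar>t\<bar> \<ge> R \<Longrightarrow> \<phi> t = 0" using \<phi> by (auto simp: test_fun_iff)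
  then have R': "-R \<le> R" "R \<ge> 0" by auto
  fix \<omega> assume w: "\<omega> \<in> \<Omega>"
  obtain G where G: "primitive_on UNIV (modulate \<omega> f) G" "continuous_on UNIV G"
    using L1loc_primitive[OF half_line_UNIV modulate_L1loc[OF half_line_UNIV fl]] by blast
  obtain m where m: "z \<longrightarrow> m = 0" "mean_on UNIV G m" using erg_classD[OF half_line_UNIV f w G(1)] by blast
  obtain H where H: "primitive_on UNIV (modulate \<omega> ?u) H"
    using L1loc_primitive[OF half_line_UNIV modulate_L1loc[OF half_line_UNIV ul]] by blast
  let ?k = "\<lambda>s. wave \<omega> (- s) * \<phi> (- s)"
  have k: "continuous_on S ?k" for S
    using nderiv_continuous[OF test_fun_smooth[OF \<phi>], of UNIV 0]
    by (intro continuous_intros continuous_on_compose2[of UNIV "wave \<omega>" S uminus] continuous_on_compose2[of UNIV \<phi> S uminus]) auto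
  have "mean_on UNIV H (integral {-R..R} ?k *\<^sub>C m)"
  proof (rule mean_on_kernel[OF half_line_UNIV G(2) k R'(1) _ _ m(2)])
    show "H (x + T) - H x = integral {-R..R} (\<lambda>s. ?k s *\<^sub>C (G (x + T + s) - G (x + s)))" if "T \<ge> 0" for x T
      using has_integral_modulate_dist_conv[OF fl \<phi> R(2) R'(2) G(1), of x "x + T"] primitive_onD[OF H UNIV_I, of x "x + T"] that
      by (simp add: has_integral_unique)
  qed auto
  then show "\<exists>G m. primitive_on UNIV (modulate \<omega> ?u) G \<and> (z \<longrightarrow> m = 0) \<and> mean_on UNIV G m"
    using H m(1) by (intro exI[of _ H] exI conjI) (auto simp: scaleC.zero_right)
qed

text \<open>
  For the converse a single test function per frequency suffices, one for which the integral of
  \<open>e\<^sup>-\<^sup>i\<^sup>\<omega>\<^sup>s \<phi>(-s)\<close> is not zero.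
\<close>

lemma erg_class_of_dist_conv:
  fixes f :: "real \<Rightarrow> 'a::complex_banach"
  assumes fl: "f \<in> L1loc UNIV" and F: "primitive_on UNIV f F" and b: "bounded_increments UNIV F"
    and conv: "\<And>\<phi>. \<phi> \<in> test_fun \<Longrightarrow> dist_conv (dist_of_fun f) \<phi> \<in> erg_class UNIV \<Omega> z"
  shows "f \<in> erg_class UNIV \<Omega> z"
proof (rule erg_classI[OF half_line_UNIV fl])
  fix \<omega> assume w: "\<omega> \<in> \<Omega>"
  obtain \<beta> :: "real \<Rightarrow> real" where \<beta>: "(\<lambda>t. complex_of_real (\<beta> t)) \<in> test_fun" "\<And>t. \<beta> t \<ge> 0" "\<beta> 0 > 0"
    "\<And>t. \<bar>t\<bar> \<ge> 1 \<Longrightarrow> \<beta> t = 0" by (rule ex_bump) blast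
  define \<phi> where "\<phi> t = wave (-\<omega>) t * complex_of_real (\<beta> t)" for t
  have \<phi>: "\<phi> \<in> test_fun"
    using \<beta>(4) unfolding \<phi>_def[abs_def] test_fun_iff
    by (intro conjI smooth_mult smooth_wave test_fun_smooth[OF \<beta>(1)] exI[of _ 1]) auto
  have \<phi>0: "\<phi> t = 0" if "\<bar>t\<bar> \<ge> 1" for t using \<beta>(4)[OF that] by (simp add: \<phi>_def)
  have k: "wave \<omega> (- s) * \<phi> (- s) = complex_of_real (\<beta> (- s))" for s
    using wave_minus[of \<omega> "- s"] by (simp add: \<phi>_def mult.assoc[symmetric] mult.commute[of "wave \<omega> (- s)"])
  have c\<beta>: "continuous_on S \<beta>" for S
    using nderiv_continuous[OF test_fun_smooth[OF \<beta>(1)], of S 0] by (auto dest: continuous_on_Re)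
  have c\<beta>m: "continuous_on S (\<lambda>s. \<beta> (- s))" for S
    by (intro continuous_on_compose2[OF c\<beta>[of UNIV]] continuous_intros) auto
  let ?u = "dist_conv (dist_of_fun f) \<phi>"
  obtain G where G: "primitive_on UNIV (modulate \<omega> f) G" "continuous_on UNIV G"
    using L1loc_primitive[OF half_line_UNIV modulate_L1loc[OF half_line_UNIV fl]] by blast
  obtain H where H: "primitive_on UNIV (modulate \<omega> ?u) H"
    using L1loc_primitive[OF half_line_UNIV modulate_L1loc[OF half_line_UNIV erg_class_L1loc[OF conv[OF \<phi>]]]] by blast
  obtain m where m: "z \<longrightarrow> m = 0" "mean_on UNIV H m" using erg_classD[OF half_line_UNIV conv[OF \<phi>] w H] by blast
  obtain B where B: "\<And>x s. s \<in> {0..1} \<Longrightarrow> norm (G (x + s) - G x) \<le> B"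
    using bounded_increments_modulate[OF half_line_UNIV fl F G(1) b] unfolding bounded_increments_def by blast
  have B': "norm (G (x + s) - G x) \<le> B" if "s \<in> {-1..1}" for x s
  proof (cases "s \<ge> 0")
    case False
    then show ?thesis using B[of "-s" "x + s"] that by (simp add: norm_minus_commute)
  qed (use B that in auto)
  let ?k = "\<lambda>s. complex_of_real (\<beta> (- s))"
  have ck: "continuous_on {-1..1} ?k" by (intro continuous_intros c\<beta>m)
  have c0: "integral {-1..1} ?k \<noteq> 0"
  proof
    assume "integral {-1..1} ?k = 0"
    moreover have "((\<lambda>s. complex_of_real (\<beta> (- s))) has_integral complex_of_real (integral {-1..1} (\<lambda>s. \<beta> (- s)))) {-1..1}"
      by (intro has_integral_of_real integrable_integral integrable_continuous_interval c\<beta>m)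
    ultimately have "integral {-1..1} (\<lambda>s. \<beta> (- s)) = 0" by (simp add: integral_unique)
    then have "\<forall>s\<in>{-1..1}. \<beta> (- s) = 0"
      by (subst (asm) integral_eq_0_iff) (auto intro!: c\<beta>m \<beta>(2))
    then show False using \<beta>(3) by (auto dest: bspec[of _ _ 0])
  qed
  have "mean_on UNIV G (inverse (integral {-1..1} ?k) *\<^sub>C m)"
  proof (rule mean_on_of_kernel[OF half_line_UNIV G(2) ck _ _ _ m(2) c0 B'])
    show "H (x + T) - H x = integral {-1..1} (\<lambda>s. ?k s *\<^sub>C (G (x + T + s) - G (x + s)))" if "T \<ge> 0" for x T
      using has_integral_modulate_dist_conv[OF fl \<phi> \<phi>0 zero_le_one G(1), of x "x + T"] primitive_onD[OF H UNIV_I, of x "x + T"] that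
      unfolding k by (simp add: has_integral_unique)
  qed auto
  then show "\<exists>G m. primitive_on UNIV (modulate \<omega> f) G \<and> (z \<longrightarrow> m = 0) \<and> mean_on UNIV G m"
    using G(1) m(1) by (intro exI[of _ G] exI conjI) (auto simp: scaleC.zero_right)
qed

lemma M_avg_dist_conv:
  fixes f :: "real \<Rightarrow> 'a::complex_banach"
  assumes f: "f \<in> L1loc UNIV" and \<phi>: "\<phi> \<in> test_fun" and h: "h > 0"
  shows "M_avg h (dist_conv (dist_of_fun f) \<phi>) = dist_conv (dist_of_fun (M_avg h f)) \<phi>"
proof
  fix x
  obtain R where R: "R > 0" "\<And>t. \<bar>t\<bar> \<ge> R \<Longrightarrow> \<phi> t = 0" using \<phi> by (auto simp: test_fun_iff)
  obtain F where F: "primitive_on UNIV f F" using L1loc_primitive[OF half_line_UNIV f] by blast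
  let ?u = "dist_conv (dist_of_fun f) \<phi>"
  have ul: "?u \<in> L1loc UNIV" by (rule continuous_L1loc[OF half_line_UNIV continuous_on_dist_conv[OF f \<phi>]])
  have "M_avg h ?u x = (1 / h) *\<^sub>R integral {x..x+h} ?u"
    by (simp add: M_avg_def bochner_integral_shift[OF half_line_UNIV ul])
  also have "integral {x..x+h} ?u = integral {-R..R} (\<lambda>s. \<phi> (- s) *\<^sub>C (F (x + h + s) - F (x + s)))"
    using has_integral_modulate_dist_conv[OF f \<phi> R(2), where \<omega>=0 and G=F and x=x and y="x + h"] F R(1) h by (simp add: integral_unique)
  also have "(1 / h) *\<^sub>R \<dots> = integral {-R..R} (\<lambda>s. (1 / h) *\<^sub>R (\<phi> (- s) *\<^sub>C (F (x + h + s) - F (x + s))))"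
    by (rule integral_cmul[symmetric])
  also have "\<dots> = integral {-R..R} (\<lambda>s. \<phi> (- s) *\<^sub>C M_avg h f (x + s))"
    using h by (intro integral_cong) (simp add: M_avg_eq[OF half_line_UNIV f F] scaleC.scaleR_right add.commute add.left_commute)
  also have "\<dots> = integral {x - R..x + R} (\<lambda>y. \<phi> (x - y) *\<^sub>C M_avg h f y)"
    using integral_shift_Icc[of "-R" R "\<lambda>y. \<phi> (x - y) *\<^sub>C M_avg h f y" x] by simp
  also have "\<dots> = dist_conv (dist_of_fun (M_avg h f)) \<phi> x"
    using h by (intro dist_conv_fun[symmetric] M_avg_L1loc[OF half_line_UNIV f] \<phi> R(2)) auto
  finally show "M_avg h ?u x = dist_conv (dist_of_fun (M_avg h f)) \<phi> x" .
qed

section \<open>Distributions with convolutions in an ergodic class\<close>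

lemma norm_diff_le_vector_derivative:
  fixes g :: "real \<Rightarrow> 'a::real_normed_vector"
  assumes S: "convex S" and g: "\<And>t. t \<in> S \<Longrightarrow> (g has_vector_derivative g' t) (at t within S)"
    and M: "\<And>t. t \<in> S \<Longrightarrow> norm (g' t) \<le> M" and xy: "x \<in> S" "y \<in> S"
  shows "norm (g x - g y) \<le> M * \<bar>x - y\<bar>"
proof -
  have "norm (g x - g y) \<le> M * norm (x - y)"
  proof (rule differentiable_bound[OF S, where f'="\<lambda>t h. h *\<^sub>R g' t"])
    have "M \<ge> 0" using M[OF xy(1)] norm_ge_zero order_trans by blast
    then show "onorm (\<lambda>h. h *\<^sub>R g' t) \<le> M" if "t \<in> S" for t
      using M[OF that] by (intro onorm_bound) (simp_all add: mult.commute[of M] mult_left_mono)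
  qed (use g xy in \<open>auto simp: has_vector_derivative_def\<close>)
  then show ?thesis by simp
qed

lemma norm_difference_quotient_minus_derivative_le:
  fixes g :: "real \<Rightarrow> 'a::real_normed_vector"
  assumes g: "\<And>t. (g has_vector_derivative g' t) (at t)" and g': "\<And>t. (g' has_vector_derivative g'' t) (at t)"
    and M: "\<And>t. norm (g'' t) \<le> M" and h: "h \<noteq> 0"
  shows "norm ((1 / h) *\<^sub>R (g (a + h) - g a) - g' a) \<le> M * \<bar>h\<bar>"
proof -
  have M0: "M \<ge> 0" using M[of 0] norm_ge_zero order_trans by blast
  let ?p = "\<lambda>t. g (a + t) - t *\<^sub>R g' a" and ?S = "{-\<bar>h\<bar>..\<bar>h\<bar>}"
  have "norm (?p h - ?p 0) \<le> (M * \<bar>h\<bar>) * \<bar>h - 0\<bar>"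
  proof (rule norm_diff_le_vector_derivative[where S="?S" and g'="\<lambda>t. g' (a + t) - g' a"])
    fix t assume t: "t \<in> ?S"
    have "((\<lambda>t. a + t) has_vector_derivative 1) (at t)" by (auto intro!: derivative_eq_intros)
    from vector_diff_chain_at[OF this g]
    have "((\<lambda>t. g (a + t)) has_vector_derivative g' (a + t)) (at t)" by (simp add: comp_def)
    moreover have "((\<lambda>t. t *\<^sub>R g' a) has_vector_derivative g' a) (at t)" by (auto intro!: derivative_eq_intros)
    ultimately show "(?p has_vector_derivative g' (a + t) - g' a) (at t within ?S)"
      by (rule has_vector_derivative_at_within[OF has_vector_derivative_diff])
    have "norm (g' (a + t) - g' a) \<le> M * \<bar>a + t - a\<bar>"
      by (rule norm_diff_le_vector_derivative[of UNIV]) (use g' M in auto)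
    also have "\<dots> \<le> M * \<bar>h\<bar>" using t M0 by (intro mult_left_mono) auto
    finally show "norm (g' (a + t) - g' a) \<le> M * \<bar>h\<bar>" .
  qed auto
  then have "norm (g (a + h) - g a - h *\<^sub>R g' a) \<le> M * \<bar>h\<bar> * \<bar>h\<bar>" by (simp add: diff_diff_eq add.commute)
  moreover have "(1 / h) *\<^sub>R (g (a + h) - g a) - g' a = (1 / h) *\<^sub>R (g (a + h) - g a - h *\<^sub>R g' a)"
    using h by (simp add: scaleR_diff_right)
  ultimately show ?thesis using h by (simp add: divide_le_eq)
qed

text \<open>
  The \<open>k\<close>-th derivatives of the difference quotients with step \<open>h\<close> differ from the limit by at most
  \<open>\<bar>h\<bar>\<close> times a bound for the derivative of order \<open>k + 2\<close> of \<open>\<phi>\<close>, by Taylor's formula.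
\<close>

lemma test_tendsto_difference_quotient:
  assumes \<phi>: "\<phi> \<in> test_fun" and h: "h \<longlonglongrightarrow> 0" "\<And>n. h n \<noteq> 0"
  shows "test_tendsto (\<lambda>n y. of_real (1 / h n) * (\<phi> ((x + h n) - y) + (-1) * \<phi> (x - y))) (\<lambda>y. nderiv (Suc 0) \<phi> (x - y))"
  unfolding test_tendsto_def
proof (intro conjI allI)
  let ?q = "\<lambda>n y. of_real (1 / h n) * (\<phi> ((x + h n) - y) + (-1) * \<phi> (x - y))"
  note sm = test_fun_smooth[OF \<phi>]
  obtain R where R: "R > 0" "\<And>t. \<bar>t\<bar> \<ge> R \<Longrightarrow> \<phi> t = 0" using \<phi> by (auto simp: test_fun_iff)
  obtain C where C: "\<And>n. \<bar>h n\<bar> \<le> C" using convergent_imp_Bseq[of h] h(1) unfolding convergent_def Bseq_def by auto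
  show "\<exists>K. compact K \<and> (\<forall>n. closure {t. ?q n t \<noteq> 0} \<subseteq> K)"
  proof (intro exI[of _ "{x - R - C..x + R + C}"] conjI allI closure_minimal)
    fix n
    have z: "?q n t = 0" if "t \<notin> {x - R - C..x + R + C}" for t
    proof -
      have "\<bar>x + h n - t\<bar> \<ge> R" "\<bar>x - t\<bar> \<ge> R" using that C[of n] abs_ge_zero[of "h n"] by auto
      then show ?thesis by (simp add: R(2))
    qed
    then show "{t. ?q n t \<noteq> 0} \<subseteq> {x - R - C..x + R + C}" by blast
  qed auto
  fix k
  have r: "nderiv k (\<lambda>y. \<psi> (a - y)) = (\<lambda>y. (-1) ^ k * nderiv k \<psi> (a - y))" if "smooth \<psi>" for \<psi> a
    using nderiv_affine[OF that, of k a "-1"] by simp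
  have s: "smooth (\<lambda>y. \<phi> (a - y))" for a using smooth_affine[OF sm, of a "-1"] by simp
  have nq: "nderiv k (?q n) = (\<lambda>y. of_real (1 / h n) * ((-1) ^ k * nderiv k \<phi> ((x + h n) - y) + (-1) * ((-1) ^ k * nderiv k \<phi> (x - y))))" for n
    unfolding nderiv_cmult[OF smooth_add[OF s smooth_cmult[OF s]]] nderiv_add[OF s smooth_cmult[OF s]] nderiv_cmult[OF s] r[OF sm] ..
  have nd: "nderiv k (\<lambda>y. nderiv (Suc 0) \<phi> (x - y)) = (\<lambda>y. (-1) ^ k * nderiv (Suc k) \<phi> (x - y))"
    using r[OF nderiv_nderiv(1)[OF sm], of "Suc 0" x] nderiv_nderiv(2)[OF sm, of k "Suc 0"] by simp
  obtain M where M: "\<And>t. norm (nderiv (Suc (Suc k)) \<phi> t) \<le> M" using test_fun_bounded[OF \<phi>] by blast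
  have M0: "M \<ge> 0" using M[of 0] norm_ge_zero order_trans by blast
  have est: "dist (nderiv k (?q n) y) (nderiv k (\<lambda>y. nderiv (Suc 0) \<phi> (x - y)) y) \<le> M * \<bar>h n\<bar>" for n y
  proof -
    have "nderiv k (?q n) y - nderiv k (\<lambda>y. nderiv (Suc 0) \<phi> (x - y)) y
        = (-1) ^ k * ((1 / h n) *\<^sub>R (nderiv k \<phi> ((x - y) + h n) - nderiv k \<phi> (x - y)) - nderiv (Suc k) \<phi> (x - y))"
      unfolding nq nd by (simp add: scaleR_conv_of_real algebra_simps)
    then show ?thesis
      using norm_difference_quotient_minus_derivative_le[OF smooth_nderiv[OF sm] smooth_nderiv[OF sm] M h(2)[of n], where a="x - y"]
      by (simp add: dist_norm norm_mult norm_power)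
  qed
  show "uniform_limit UNIV (\<lambda>n. nderiv k (?q n)) (nderiv k (\<lambda>y. nderiv (Suc 0) \<phi> (x - y))) sequentially"
  proof (rule uniform_limitI)
    fix e :: real assume e: "e > 0"
    have "(\<lambda>n. M * \<bar>h n\<bar>) \<longlonglongrightarrow> M * \<bar>0\<bar>" by (intro tendsto_intros h)
    then have "\<forall>\<^sub>F n in sequentially. M * \<bar>h n\<bar> < e" using e by (intro order_tendstoD) auto
    then show "\<forall>\<^sub>F n in sequentially. \<forall>y\<in>UNIV. dist (nderiv k (?q n) y) (nderiv k (\<lambda>y. nderiv (Suc 0) \<phi> (x - y)) y) < e"
      by eventually_elim (use est in \<open>blast intro: order_le_less_trans\<close>)
  qed
qed

lemma dist_conv_derivative:
  fixes T :: "(real \<Rightarrow> complex) \<Rightarrow> 'a::complex_banach"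
  assumes T: "T \<in> distributions" and \<phi>: "\<phi> \<in> test_fun"
  shows "(dist_conv T \<phi> has_vector_derivative dist_conv T (nderiv (Suc 0) \<phi>) x) (at x)"
proof -
  have T_add: "\<And>\<phi> \<psi>. \<phi> \<in> test_fun \<Longrightarrow> \<psi> \<in> test_fun \<Longrightarrow> T (\<lambda>t. \<phi> t + \<psi> t) = T \<phi> + T \<psi>"
    and T_mult: "\<And>c \<phi>. \<phi> \<in> test_fun \<Longrightarrow> T (\<lambda>t. c * \<phi> t) = c *\<^sub>C T \<phi>"
    and T_cont: "\<And>\<phi>s \<phi>. \<phi> \<in> test_fun \<Longrightarrow> (\<And>n. \<phi>s n \<in> test_fun) \<Longrightarrow> test_tendsto \<phi>s \<phi> \<Longrightarrow> (\<lambda>n. T (\<phi>s n)) \<longlonglongrightarrow> T \<phi>"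
    using T unfolding distributions_def by blast+
  note refl = test_fun_reflect
  let ?u = "dist_conv T \<phi>" and ?D = "dist_conv T (nderiv (Suc 0) \<phi>) x"
  have "((\<lambda>h. (1 / h) *\<^sub>R (?u (x + h) - ?u x)) \<longlongrightarrow> ?D) (at 0)"
    unfolding tendsto_at_iff_sequentially
  proof (intro allI impI)
    fix h :: "nat \<Rightarrow> real" assume h: "\<forall>i. h i \<in> UNIV - {0}" "h \<longlonglongrightarrow> 0"
    let ?q = "\<lambda>n y. of_real (1 / h n) * (\<phi> ((x + h n) - y) + (-1) * \<phi> (x - y))"
    have d: "(\<lambda>y. \<phi> ((x + h n) - y) + (-1) * \<phi> (x - y)) \<in> test_fun" for n
      by (intro test_fun_add test_fun_cmult refl \<phi>)
    have "(\<lambda>n. T (?q n)) \<longlonglongrightarrow> T (\<lambda>y. nderiv (Suc 0) \<phi> (x - y))"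
    proof (rule T_cont)
      show "(\<lambda>y. nderiv (Suc 0) \<phi> (x - y)) \<in> test_fun" by (rule refl[OF test_fun_nderiv[OF \<phi>]])
      show "?q n \<in> test_fun" for n by (rule test_fun_cmult[OF d])
      show "test_tendsto ?q (\<lambda>y. nderiv (Suc 0) \<phi> (x - y))"
        by (rule test_tendsto_difference_quotient[OF \<phi> h(2)]) (use h(1) in auto)
    qed
    moreover have "T (?q n) = (1 / h n) *\<^sub>R (?u (x + h n) - ?u x)" for n
    proof -
      have "T (?q n) = of_real (1 / h n) *\<^sub>C (T (\<lambda>y. \<phi> ((x + h n) - y)) + (-1) *\<^sub>C T (\<lambda>y. \<phi> (x - y)))"
        unfolding T_mult[OF d] T_add[OF refl[OF \<phi>] test_fun_cmult[OF refl[OF \<phi>]]] T_mult[OF refl[OF \<phi>]] ..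
      also have "\<dots> = (1 / h n) *\<^sub>R (?u (x + h n) - ?u x)"
        by (simp add: scaleC_of_real dist_conv_def scaleC.minus_left del: of_real_divide)
      finally show ?thesis .
    qed
    ultimately show "((\<lambda>h. (1 / h) *\<^sub>R (?u (x + h) - ?u x)) \<circ> h) \<longlonglongrightarrow> ?D"
      by (simp add: comp_def dist_conv_def)
  qed
  then have "((\<lambda>h. (1 / h) *\<^sub>R (?u (x + h) - ?u x) - ?D) \<longlongrightarrow> 0) (at 0)" by (rule Lim_null[THEN iffD1])
  then have "((\<lambda>h. norm (?u (x + h) - ?u x - h *\<^sub>R ?D) / norm h) \<longlongrightarrow> 0) (at 0)"
  proof (rule Lim_transform_eventually[OF tendsto_norm_zero])
    show "\<forall>\<^sub>F h in at 0. norm ((1 / h) *\<^sub>R (?u (x + h) - ?u x) - ?D) = norm (?u (x + h) - ?u x - h *\<^sub>R ?D) / norm h"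
    proof (rule eventually_at_filter[THEN iffD2], rule always_eventually, intro allI impI)
      fix h :: real assume h: "h \<noteq> 0"
      have "(1 / h) *\<^sub>R (?u (x + h) - ?u x) - ?D = (1 / h) *\<^sub>R (?u (x + h) - ?u x - h *\<^sub>R ?D)"
        using h by (simp add: scaleR_diff_right)
      then show "norm ((1 / h) *\<^sub>R (?u (x + h) - ?u x) - ?D) = norm (?u (x + h) - ?u x - h *\<^sub>R ?D) / norm h" by simp
    qed
  qed
  then show ?thesis
    unfolding has_vector_derivative_def has_derivative_at by (simp add: bounded_linear_scaleR_left)
qed

text \<open>
  The average \<open>M\<^sub>1 u\<close> is bounded, and it differs from \<open>u\<close> by increments of \<open>u\<close> only.
\<close>

lemma erg_class_bounded:
  fixes u :: "real \<Rightarrow> 'a::complex_banach"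
  assumes u: "u \<in> erg_class UNIV \<Omega> z" "0 \<in> \<Omega>" and c: "continuous_on UNIV u" and b: "bounded_increments UNIV u"
  shows "\<exists>B. \<forall>x. norm (u x) \<le> B"
proof -
  obtain A where A: "\<And>x. norm (M_avg 1 u x) \<le> A"
    using erg_class_M_avg_bounded[OF half_line_UNIV u zero_less_one] by auto
  obtain B where B: "\<And>x s. s \<in> {0..1} \<Longrightarrow> norm (u (x + s) - u x) \<le> B"
    using b unfolding bounded_increments_def by blast
  have "norm (u x) \<le> A + B" for x
  proof -
    have cu: "continuous_on {x..x+1} u" by (rule continuous_on_subset[OF c]) simp
    have "M_avg 1 u x = integral {x..x+1} u"
      by (simp add: M_avg_def bochner_integral_shift[OF half_line_UNIV erg_class_L1loc[OF u(1)]])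
    then have "((\<lambda>y. u y - u x) has_integral M_avg 1 u x - 1 *\<^sub>R u x) {x..x+1}"
      using has_integral_diff[OF integrable_integral[OF integrable_continuous_interval[OF cu]] has_integral_const_real[of "u x" x "x+1"]] by simp
    then have "norm (M_avg 1 u x - u x) = norm (integral {x..x+1} (\<lambda>y. u y - u x))" by (simp add: integral_unique)
    also have "\<dots> \<le> B * (x + 1 - x)"
    proof (rule integral_bound)
      show "norm (u y - u x) \<le> B" if "y \<in> {x..x+1}" for y using B[of "y - x" x] that by simp
    qed (auto intro!: continuous_intros cu)
    finally show ?thesis using A[of x] norm_triangle_ineq2[of "u x" "M_avg 1 u x"] by (simp add: norm_minus_commute)
  qed
  then show ?thesis by blast
qed

text \<open>
  All derivatives \<open>T * \<phi>\<^sup>(\<^sup>j\<^sup>)\<close> of \<open>T * \<phi>\<close> lie in the class again; being derivatives of one another, they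
  have bounded increments and are therefore bounded.
\<close>

lemma dist_conv_C_ub:
  fixes T :: "(real \<Rightarrow> complex) \<Rightarrow> 'a::complex_banach"
  assumes T: "T \<in> Dist_cl (erg_class UNIV \<Omega> z)" and \<Omega>: "0 \<in> \<Omega>" and \<phi>: "\<phi> \<in> test_fun"
  shows "dist_conv T \<phi> \<in> C_ub UNIV"
proof -
  let ?u = "\<lambda>\<phi>. dist_conv T \<phi>"
  have Td: "T \<in> distributions" and Tc: "\<And>\<phi>. \<phi> \<in> test_fun \<Longrightarrow> ?u \<phi> \<in> erg_class UNIV \<Omega> z"
    using T by (auto simp: Dist_cl_def)
  have c: "continuous_on UNIV (?u \<phi>)" if "\<phi> \<in> test_fun" for \<phi>
    using dist_conv_derivative[OF Td that] by (meson continuous_at_imp_continuous_on has_vector_derivative_continuous)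
  have p: "primitive_on UNIV (?u (nderiv (Suc 0) \<phi>)) (?u \<phi>)" if "\<phi> \<in> test_fun" for \<phi>
    by (rule primitive_on_of_derivative[OF dist_conv_derivative[OF Td that]])
  have b: "\<exists>B. \<forall>x. norm (?u \<phi> x) \<le> B" if "\<phi> \<in> test_fun" for \<phi>
    using erg_class_bounded[OF Tc[OF that] \<Omega> c[OF that]]
      erg_class_bounded_increments[OF half_line_UNIV Tc[OF test_fun_nderiv[OF that]] \<Omega> p[OF that]] by blast
  obtain B where B: "\<And>x. norm (?u \<phi> x) \<le> B" using b[OF \<phi>] by blast
  obtain L where L: "\<And>x. norm (?u (nderiv (Suc 0) \<phi>) x) \<le> L" using b[OF test_fun_nderiv[OF \<phi>]] by blast
  show ?thesis
    by (rule Lipschitz_C_ub[OF B])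
      (rule bounded_continuous_Lipschitz_primitive[OF half_line_UNIV c[OF test_fun_nderiv[OF \<phi>]] L p[OF \<phi>]], auto)
qed

lemma Dist_cl_erg_class_ub:
  assumes "0 \<in> \<Omega>"
  shows "Dist_cl (erg_class UNIV \<Omega> z \<inter> C_ub UNIV) = Dist_cl (erg_class UNIV \<Omega> z)"
  using dist_conv_C_ub[OF _ assms] by (auto simp: Dist_cl_def)

text \<open>
  Averaging commutes with the convolution: \<open>M\<^sub>h (f * \<phi>) = (M\<^sub>h f) * \<phi>\<close>.  By induction the right-hand side
  is in the class, bounded and uniformly continuous, so \<open>f * \<phi>\<close> is in the class as well.
\<close>

lemma dist_of_fun_Mcl_erg_class:
  fixes f :: "real \<Rightarrow> 'a::complex_banach"
  assumes \<Omega>: "0 \<in> \<Omega>" and f: "f \<in> (Mcl UNIV ^^ n) (erg_class UNIV \<Omega> z \<inter> C_ub UNIV)"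
  shows "dist_of_fun f \<in> Dist_cl (erg_class UNIV \<Omega> z)"
  using f
proof (induction n arbitrary: f)
  case 0
  then show ?case
    using dist_of_fun_distribution[OF erg_class_L1loc] erg_class_dist_conv by (auto simp: Dist_cl_def)
next
  case (Suc n)
  then have fl: "f \<in> L1loc UNIV" and M: "\<And>h. h > 0 \<Longrightarrow> dist_of_fun (M_avg h f) \<in> Dist_cl (erg_class UNIV \<Omega> z)"
    by (auto simp: Mcl_def)
  have "dist_conv (dist_of_fun f) \<phi> \<in> erg_class UNIV \<Omega> z" if \<phi>: "\<phi> \<in> test_fun" for \<phi>
  proof -
    have "M_avg h (dist_conv (dist_of_fun f) \<phi>) \<in> erg_class UNIV \<Omega> z \<inter> C_ub UNIV" if "h > 0" for h
      unfolding M_avg_dist_conv[OF fl \<phi> that]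
      using dist_conv_C_ub[OF M[OF that] \<Omega> \<phi>] M[OF that] \<phi> by (auto simp: Dist_cl_def)
    moreover have "dist_conv (dist_of_fun f) \<phi> \<in> L1loc UNIV"
      by (rule continuous_L1loc[OF half_line_UNIV continuous_on_dist_conv[OF fl \<phi>]])
    ultimately show ?thesis
      using Mcl_erg_class_ub_subset[OF half_line_UNIV, of \<Omega> z] by (auto simp: Mcl_def)
  qed
  then show ?case using dist_of_fun_distribution[OF fl] by (auto simp: Dist_cl_def)
qed

lemma C_ub_dist_of_fun_erg_class:
  fixes f :: "real \<Rightarrow> 'a::complex_banach"
  assumes f: "f \<in> C_ub UNIV" and T: "dist_of_fun f \<in> Dist_cl (erg_class UNIV \<Omega> z)"
  shows "f \<in> erg_class UNIV \<Omega> z"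
proof -
  have fl: "f \<in> L1loc UNIV" by (rule C_ub_L1loc[OF half_line_UNIV f])
  obtain F where F: "primitive_on UNIV f F" using L1loc_primitive[OF half_line_UNIV fl] by blast
  obtain B where "\<And>x y. x \<le> y \<Longrightarrow> norm (F y - F x) \<le> B * (y - x)"
    using C_ub_Lipschitz_primitive[OF half_line_UNIV f F] by blast
  from erg_class_of_dist_conv[OF fl F Lipschitz_bounded_increments[OF half_line_UNIV this]]
  show ?thesis using T by (auto simp: Dist_cl_def)
qed

section \<open>Functions vanishing at infinity\<close>

lemma vanishing_bounded:
  fixes u :: "real \<Rightarrow> 'a::real_normed_vector"
  assumes c: "continuous_on UNIV u" and l: "(u \<longlongrightarrow> 0) at_infinity"
  shows "\<exists>B. \<forall>t. norm (u t) \<le> B"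
proof -
  have "\<forall>\<^sub>F t in at_infinity. norm (u t) < 1" using tendstoD[OF l, of 1] by simp
  then obtain R where R: "\<And>t. norm t \<ge> R \<Longrightarrow> norm (u t) < 1" unfolding eventually_at_infinity by blast
  obtain B where B: "\<And>t. t \<in> {-R..R} \<Longrightarrow> norm (u t) \<le> B"
    using compact_imp_bounded[OF compact_continuous_image[OF continuous_on_subset[OF c, of "{-R..R}"]]]
    unfolding bounded_pos by force
  have "norm (u t) \<le> max B 1" for t
    using B[of t] R[of t] by (cases "\<bar>t\<bar> \<ge> R") (auto simp: not_le abs_less_iff le_max_iff_disj)
  then show ?thesis by blast
qed

lemma vanishing_C_ub:
  fixes u :: "real \<Rightarrow> 'a::complex_banach"
  assumes c: "continuous_on UNIV u" and l: "(u \<longlongrightarrow> 0) at_infinity"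
  shows "u \<in> C_ub J"
proof (rule C_ubI)
  show "bounded (u ` J)" using vanishing_bounded[OF assms] unfolding bounded_iff by blast
  have "uniformly_continuous_on UNIV u"
    unfolding uniformly_continuous_on_def
  proof (intro allI impI)
    fix e :: real assume e: "e > 0"
    have "\<forall>\<^sub>F t in at_infinity. norm (u t) < e/2" using tendstoD[OF l, of "e/2"] e by simp
    then obtain R where R: "\<And>t. norm t \<ge> R \<Longrightarrow> norm (u t) < e/2" unfolding eventually_at_infinity by blast
    have "uniformly_continuous_on {-R-1..R+1} u"
      by (intro compact_uniformly_continuous continuous_on_subset[OF c]) auto
    then obtain d where d: "d > 0" "\<And>s t. s \<in> {-R-1..R+1} \<Longrightarrow> t \<in> {-R-1..R+1} \<Longrightarrow> dist t s < d \<Longrightarrow> dist (u t) (u s) < e"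
      using e unfolding uniformly_continuous_on_def by metis
    have "dist (u t) (u s) < e" if st: "dist t s < min d 1" for s t
    proof (cases "s \<in> {-R-1..R+1} \<and> t \<in> {-R-1..R+1}")
      case False
      then have "\<bar>s\<bar> \<ge> R" "\<bar>t\<bar> \<ge> R" using st by (auto simp: dist_real_def)
      then have "norm (u s) < e/2" "norm (u t) < e/2" using R by auto
      then show ?thesis using norm_triangle_ineq4[of "u t" "u s"] by (simp add: dist_norm)
    qed (use d st in auto)
    then show "\<exists>d>0. \<forall>x\<in>UNIV. \<forall>x'\<in>UNIV. dist x' x < d \<longrightarrow> dist (u x') (u x) < e"
      using d(1) by (intro exI[of _ "min d 1"]) auto
  qed
  then show "uniformly_continuous_on J u" unfolding uniformly_continuous_on_def by (metis UNIV_I)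
qed

lemma vanishing_erg_class:
  fixes u :: "real \<Rightarrow> 'a::complex_banach"
  assumes J: "half_line J" and c: "continuous_on UNIV u" and l: "(u \<longlongrightarrow> 0) at_infinity"
  shows "u \<in> erg_class J \<Omega> z"
proof (rule erg_classI[OF J])
  show ul: "u \<in> L1loc J" by (rule continuous_L1loc[OF J continuous_on_subset[OF c]]) simp
  fix \<omega>
  obtain G where G: "primitive_on J (modulate \<omega> u) G"
    using L1loc_primitive[OF J modulate_L1loc[OF J ul]] by blast
  obtain B where B: "\<And>t. norm (u t) \<le> B" using vanishing_bounded[OF c l] by blast
  have B0: "B \<ge> 0" using B[of 0] norm_ge_zero order_trans by blast
  have "mean_on J G 0"
    unfolding mean_on_def
  proof (intro allI impI)
    fix e :: real assume e: "e > 0"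
    have "\<forall>\<^sub>F t in at_infinity. norm (u t) < e/2" using tendstoD[OF l, of "e/2"] e by simp
    then obtain R where R: "\<And>t. norm t \<ge> R \<Longrightarrow> norm (u t) < e/2" unfolding eventually_at_infinity by blast
    \<comment> \<open>the integrable majorant \<open>C / (1 + t\<^sup>2)\<close> takes care of the compact set where \<open>u\<close> is not small\<close>
    define C where "C = B * (1 + R\<^sup>2)"
    have C: "C \<ge> 0" using B0 by (simp add: C_def)
    have maj: "norm (u t) \<le> e/2 + C * inverse (1 + t\<^sup>2)" for t
    proof (cases "\<bar>t\<bar> \<ge> R")
      case True
      then show ?thesis using R[of t] C by (intro order_trans[OF less_imp_le[OF R]] ) (auto simp: add_nonneg_nonneg)
    next
      case False
      then have "t\<^sup>2 \<le> R\<^sup>2" by (intro abs_le_square_iff[THEN iffD1]) simp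
      then have "B * 1 \<le> B * ((1 + R\<^sup>2) * inverse (1 + t\<^sup>2))"
        using B0 by (intro mult_left_mono) (auto simp: field_simps add_pos_nonneg)
      then show ?thesis using B[of t] e by (simp add: C_def mult.assoc)
    qed
    have inc: "norm (G (x + T) - G x) \<le> e/2 * T + C * pi" if x: "x \<in> J" and T: "T \<ge> 0" for x T
    proof -
      have "((\<lambda>t. e/2 + C * inverse (1 + t\<^sup>2)) has_integral
          (e/2 * (x + T) + C * arctan (x + T)) - (e/2 * x + C * arctan x)) {x..x + T}"
        by (rule fundamental_theorem_of_calculus)
          (use T in \<open>auto intro!: derivative_eq_intros simp: has_real_derivative_iff_has_vector_derivative[symmetric]\<close>)
      note I = this
      have "norm (integral {x..x + T} (modulate \<omega> u)) \<le> integral {x..x + T} (\<lambda>t. e/2 + C * inverse (1 + t\<^sup>2))"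
        using I maj
        by (intro Henstock_Kurzweil_Integration.integral_norm_bound_integral L1loc_integrable(1)[OF J modulate_L1loc[OF J ul] x])
          (auto simp: modulate_wave norm_scaleC)
      also have "\<dots> = e/2 * T + C * (arctan (x + T) - arctan x)"
        using I by (simp add: integral_unique algebra_simps)
      also have "\<dots> \<le> e/2 * T + C * pi"
        using C arctan_bounded[of "x + T"] arctan_bounded[of x] by (intro add_left_mono mult_left_mono) auto
      finally show ?thesis using primitive_on_integral[OF G x, of "x + T"] T by simp
    qed
    show "\<exists>T0>0. \<forall>T\<ge>T0. \<forall>x\<in>J. norm (G (x + T) - G x - T *\<^sub>R 0) \<le> e * T"
    proof (intro exI[of _ "max 1 (2 * (C * pi) / e)"] conjI allI impI ballI)
      fix T x assume T: "max 1 (2 * (C * pi) / e) \<le> T" and x: "x \<in> J"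
      then have "2 * (C * pi) \<le> e * T" using e by (auto simp: divide_le_eq mult.commute)
      then show "norm (G (x + T) - G x - T *\<^sub>R 0) \<le> e * T" using inc[OF x, of T] T by simp
    qed simp
  qed
  then show "\<exists>G m. primitive_on J (modulate \<omega> u) G \<and> (z \<longrightarrow> m = 0) \<and> mean_on J G m"
    using G by blast
qed

section \<open>A distribution that is not a function\<close>

definition delta :: "'a::complex_banach \<Rightarrow> (real \<Rightarrow> complex) \<Rightarrow> 'a" where
  "delta v = (\<lambda>\<phi>\<in>test_fun. \<phi> 0 *\<^sub>C v)"

lemma delta_Dist_cl:
  fixes v :: "'a::complex_banach"
  shows "delta v \<in> Dist_cl (erg_class UNIV \<Omega> z \<inter> C_ub UNIV)"
proof -
  have "delta v \<in> distributions"
    unfolding distributions_def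
  proof (intro CollectI conjI ballI allI impI)
    show "delta v \<in> extensional test_fun" unfolding delta_def by (rule restrict_extensional)
    fix \<phi> :: "real \<Rightarrow> complex" and \<phi>s :: "nat \<Rightarrow> real \<Rightarrow> complex"
    assume \<phi>: "\<phi> \<in> test_fun" and *: "(\<forall>n. \<phi>s n \<in> test_fun) \<and> test_tendsto \<phi>s \<phi>"
    have "uniform_limit UNIV (\<lambda>n. nderiv 0 (\<phi>s n)) (nderiv 0 \<phi>) sequentially" using * unfolding test_tendsto_def by blast
    then have "(\<lambda>n. \<phi>s n 0) \<longlonglongrightarrow> \<phi> 0" using tendsto_uniform_limitI[where x=0] by fastforce
    then have "(\<lambda>n. \<phi>s n 0 *\<^sub>C v) \<longlonglongrightarrow> \<phi> 0 *\<^sub>C v" by (intro scaleC.tendsto tendsto_const)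
    then show "(\<lambda>n. delta v (\<phi>s n)) \<longlonglongrightarrow> delta v \<phi>" using * \<phi> by (simp add: delta_def)
  qed (auto simp: delta_def test_fun_add test_fun_cmult scaleC_add_left scaleC_scaleC)
  moreover have "dist_conv (delta v) \<phi> \<in> erg_class UNIV \<Omega> z \<inter> C_ub UNIV" if \<phi>: "\<phi> \<in> test_fun" for \<phi>
  proof -
    have eq: "dist_conv (delta v) \<phi> = (\<lambda>x. \<phi> x *\<^sub>C v)"
      by (rule ext) (simp add: dist_conv_def delta_def test_fun_reflect[OF \<phi>])
    obtain R where R: "\<And>t. \<bar>t\<bar> \<ge> R \<Longrightarrow> \<phi> t = 0" using \<phi> by (auto simp: test_fun_iff)
    have "continuous_on UNIV (\<lambda>x. \<phi> x *\<^sub>C v)"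
      using nderiv_continuous[OF test_fun_smooth[OF \<phi>], of UNIV 0] by (intro scaleC.continuous_on continuous_intros) auto
    moreover have "((\<lambda>x. \<phi> x *\<^sub>C v) \<longlongrightarrow> 0) at_infinity"
    proof (rule Lim_transform_eventually[OF tendsto_const])
      show "\<forall>\<^sub>F x in at_infinity. 0 = \<phi> x *\<^sub>C v"
        unfolding eventually_at_infinity using R by (intro exI[of _ R]) (auto simp: scaleC.zero_left)
    qed
    ultimately show ?thesis unfolding eq by (intro IntI vanishing_erg_class half_line_UNIV vanishing_C_ub)
  qed
  ultimately show ?thesis by (simp add: Dist_cl_def)
qed

text \<open>
  Test functions concentrating at \<open>0\<close> with a fixed value there: their integrals against \<open>f\<close> tend to zero.
\<close>

lemma delta_not_fun:
  fixes f :: "real \<Rightarrow> 'a::complex_banach"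
  assumes f: "f \<in> L1loc UNIV" and v: "v \<noteq> 0"
  shows "dist_of_fun f \<noteq> delta v"
proof
  assume eq: "dist_of_fun f = delta v"
  obtain \<beta> :: "real \<Rightarrow> real" where \<beta>: "(\<lambda>t. complex_of_real (\<beta> t)) \<in> test_fun" "\<And>t. \<beta> t \<ge> 0" "\<beta> 0 > 0"
    "\<And>t. \<beta> t \<le> 1" "\<And>t. \<bar>t\<bar> \<ge> 1 \<Longrightarrow> \<beta> t = 0" by (rule ex_bump) blast
  obtain N where N: "primitive_on UNIV (\<lambda>x. norm (f x)) N"
    using ex_primitive_on[OF half_line_UNIV, of "\<lambda>x. norm (f x)"] L1loc_integrable(2)[OF half_line_UNIV f] by blast
  have cN: "continuous_on UNIV N" by (rule primitive_on_continuous[OF half_line_UNIV N])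
  have le: "\<beta> 0 * norm v \<le> N (inverse (real (Suc n))) - N (- inverse (real (Suc n)))" for n
  proof -
    let ?r = "inverse (real (Suc n))" and ?\<phi> = "\<lambda>t. complex_of_real (\<beta> (0 + real (Suc n) * t))"
    have \<phi>: "?\<phi> \<in> test_fun" by (rule test_fun_affine[OF \<beta>(1)]) simp
    have z: "?\<phi> t = 0" if "t \<notin> {-?r..?r}" for t
    proof -
      have "\<bar>t\<bar> \<ge> ?r" using that by auto
      then have "real (Suc n) * \<bar>t\<bar> \<ge> 1" by (simp add: field_simps)
      then show ?thesis by (simp add: \<beta>(5) abs_mult)
    qed
    have "delta v ?\<phi> = of_real (\<beta> 0) *\<^sub>C v" using \<phi> by (simp add: delta_def)
    then have "\<beta> 0 * norm v = norm (dist_of_fun f ?\<phi>)" using \<beta>(2)[of 0] eq by (simp add: scaleC_of_real)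
    also have "dist_of_fun f ?\<phi> = integral {-?r..?r} (\<lambda>t. ?\<phi> t *\<^sub>C f t)" by (rule dist_of_fun_eq[OF f \<phi> z])
    also have "norm \<dots> \<le> integral {-?r..?r} (\<lambda>t. norm (f t))"
    proof (rule Henstock_Kurzweil_Integration.integral_norm_bound_integral)
      show "(\<lambda>t. ?\<phi> t *\<^sub>C f t) integrable_on {-?r..?r}"
        using nderiv_continuous[OF test_fun_smooth[OF \<phi>], of UNIV 0]
        by (intro L1loc_integrable(1)[OF half_line_UNIV] L1loc_scaleC[OF half_line_UNIV f]) auto
      show "(\<lambda>t. norm (f t)) integrable_on {-?r..?r}" by (rule L1loc_integrable(2)[OF half_line_UNIV f UNIV_I])
      show "norm (?\<phi> t *\<^sub>C f t) \<le> norm (f t)" for t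
        using \<beta>(2,4) by (simp add: norm_scaleC mult_left_le_one_le del: of_nat_Suc)
    qed
    also have "\<dots> = N ?r - N (- ?r)" by (rule primitive_on_integral[OF N]) auto
    finally show ?thesis .
  qed
  have "(\<lambda>n. N (inverse (real (Suc n))) - N (- inverse (real (Suc n)))) \<longlonglongrightarrow> N 0 - N (- 0)"
    by (intro tendsto_diff continuous_on_tendsto_compose[OF cN] tendsto_minus LIMSEQ_inverse_real_of_nat) auto
  then have "\<beta> 0 * norm v \<le> 0" using le by (intro LIMSEQ_le_const) auto
  then show False using \<beta>(3) v by (simp add: mult_le_0_iff)
qed

section \<open>Chains of derivatives and iterated averages\<close>

definition diff_quot :: "real \<Rightarrow> (real \<Rightarrow> 'a::real_vector) \<Rightarrow> real \<Rightarrow> 'a" where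
  "diff_quot h u t = (1 / h) *\<^sub>R (u (t + h) - u t)"

definition derivative_chain :: "(nat \<Rightarrow> real \<Rightarrow> 'a::real_normed_vector) \<Rightarrow> bool" where
  "derivative_chain U \<longleftrightarrow> (\<forall>k t. (U k has_vector_derivative U (Suc k) t) (at t))"

lemma derivative_chain_continuous: "derivative_chain U \<Longrightarrow> continuous_on S (U k)"
  unfolding derivative_chain_def by (meson continuous_at_imp_continuous_on has_vector_derivative_continuous)

lemma has_vector_derivative_diff_quot:
  assumes "\<And>t. (u has_vector_derivative u' t) (at t)"
  shows "(diff_quot h u has_vector_derivative diff_quot h u' t) (at t)"
proof -
  have "((\<lambda>t. t + h) has_vector_derivative 1) (at t)" by (auto intro!: derivative_eq_intros)
  from vector_diff_chain_at[OF this assms]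
  have "((\<lambda>t. u (t + h)) has_vector_derivative u' (t + h)) (at t)" by (simp add: comp_def)
  then have "((\<lambda>t. u (t + h) - u t) has_vector_derivative u' (t + h) - u' t) (at t)"
    by (intro has_vector_derivative_diff assms)
  from bounded_linear.has_vector_derivative[OF bounded_linear_scaleR_right this]
  show ?thesis unfolding diff_quot_def[abs_def] .
qed

lemma derivative_chain_diff_quot: "derivative_chain U \<Longrightarrow> derivative_chain (\<lambda>k. diff_quot h (U k))"
  unfolding derivative_chain_def by (blast intro: has_vector_derivative_diff_quot)

lemma M_avg_derivative:
  fixes u :: "real \<Rightarrow> 'a::complex_banach"
  assumes u: "\<And>t. (u has_vector_derivative u' t) (at t)" and c: "continuous_on UNIV u'" and h: "h > 0"
  shows "M_avg h u' = diff_quot h u"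
  using M_avg_eq[OF half_line_UNIV continuous_L1loc[OF half_line_UNIV c] primitive_on_of_derivative[OF u]] h
  by (auto simp: diff_quot_def fun_eq_iff)

lemma M_avg_derivative_chain:
  fixes U :: "nat \<Rightarrow> real \<Rightarrow> 'a::complex_banach"
  assumes "derivative_chain U" "h > 0"
  shows "M_avg h (U (Suc k)) = diff_quot h (U k)"
  using assms by (intro M_avg_derivative derivative_chain_continuous) (auto simp: derivative_chain_def)

lemma M_avg_funpow_derivative_chain:
  fixes U :: "nat \<Rightarrow> real \<Rightarrow> 'a::complex_banach"
  assumes "derivative_chain U" and h: "h > 0"
  shows "(M_avg h ^^ n) (U (k + n)) = (diff_quot h ^^ n) (U k)"
  using assms(1)
proof (induction n arbitrary: U)
  case (Suc n)
  have "(M_avg h ^^ Suc n) (U (k + Suc n)) = (M_avg h ^^ n) (diff_quot h (U (k + n)))"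
    by (simp add: funpow_Suc_right M_avg_derivative_chain[OF Suc.prems h] del: funpow.simps)
  also have "\<dots> = (diff_quot h ^^ n) (diff_quot h (U k))"
    by (rule Suc.IH[OF derivative_chain_diff_quot[OF Suc.prems]])
  finally show ?case by (simp add: funpow_Suc_right del: funpow.simps)
qed simp

text \<open>
  Averaging the \<open>(n + 1)\<close>-st derivative gives the \<open>n\<close>-th derivative of a difference quotient.  Hence the
  \<open>n\<close>-th derivatives of the members of a class that is closed under difference quotients lie in its
  \<open>n\<close>-fold extension.
\<close>

lemma Mcl_funpow_derivative_chain:
  fixes U :: "nat \<Rightarrow> real \<Rightarrow> 'a::complex_banach"
  assumes J: "half_line J" and A: "\<And>u h. u \<in> A \<Longrightarrow> h > 0 \<Longrightarrow> diff_quot h u \<in> A"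
    and "derivative_chain U" "U 0 \<in> A"
  shows "U n \<in> (Mcl J ^^ n) A"
  using assms(3-)
proof (induction n arbitrary: U)
  case (Suc n)
  have "U (Suc n) \<in> L1loc J"
    by (rule continuous_L1loc[OF J derivative_chain_continuous[OF Suc.prems(1)]])
  moreover have "M_avg h (U (Suc n)) \<in> (Mcl J ^^ n) A" if "h > 0" for h
    unfolding M_avg_derivative_chain[OF Suc.prems(1) that]
    by (rule Suc.IH[OF derivative_chain_diff_quot[OF Suc.prems(1)] A[OF Suc.prems(2) that]])
  ultimately show ?case by (simp add: Mcl_iff)
qed simp

lemma Mcl_funpow_M_avg: "f \<in> (Mcl J ^^ n) A \<Longrightarrow> h > 0 \<Longrightarrow> (M_avg h ^^ n) f \<in> A"
proof (induction n arbitrary: f)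
  case (Suc n)
  then have "M_avg h f \<in> (Mcl J ^^ n) A" by (simp add: Mcl_iff)
  from Suc.IH[OF this Suc.prems(2)] show ?case by (simp add: funpow_Suc_right del: funpow.simps)
qed simp

text \<open>
  An iterated difference quotient is dominated by its last term if the steps are long enough; for this
  it only matters that the coefficients do not depend on \<open>h\<close>.
\<close>

lemma diff_quot_funpow_expansion:
  "\<exists>c. \<forall>h (Q :: real \<Rightarrow> 'a::real_vector) t.
     (diff_quot h ^^ n) Q t = (1 / h) ^ n *\<^sub>R (Q (t + real n * h) + (\<Sum>k<n. c k *\<^sub>R Q (t + real k * h)))"
proof (induction n)
  case (Suc n)
  then obtain c where c: "\<And>h (Q :: real \<Rightarrow> 'a) t. (diff_quot h ^^ n) Q t =
      (1 / h) ^ n *\<^sub>R (Q (t + real n * h) + (\<Sum>k<n. c k *\<^sub>R Q (t + real k * h)))" by blast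
  define d where "d k = (if k = 0 then 0 else c (k - 1)) - (if k = n then 1 else c k)" for k
  have "(diff_quot h ^^ Suc n) Q t = (1 / h) ^ Suc n *\<^sub>R (Q (t + real (Suc n) * h) + (\<Sum>k<Suc n. d k *\<^sub>R Q (t + real k * h)))"
    for h and Q :: "real \<Rightarrow> 'a" and t
  proof -
    have "(\<Sum>k<Suc n. d k *\<^sub>R Q (t + real k * h)) =
        (\<Sum>k<Suc n. (if k = 0 then 0 else c (k - 1)) *\<^sub>R Q (t + real k * h)) - (\<Sum>k<Suc n. (if k = n then 1 else c k) *\<^sub>R Q (t + real k * h))"
      by (simp only: d_def scaleR_diff_left sum_subtractf)
    also have "(\<Sum>k<Suc n. (if k = 0 then 0 else c (k - 1)) *\<^sub>R Q (t + real k * h)) = (\<Sum>k<n. c k *\<^sub>R Q ((t + h) + real k * h))"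
      unfolding sum.lessThan_Suc_shift by (simp add: algebra_simps)
    also have "(\<Sum>k<Suc n. (if k = n then 1 else c k) *\<^sub>R Q (t + real k * h)) = (\<Sum>k<n. c k *\<^sub>R Q (t + real k * h)) + Q (t + real n * h)"
      by simp
    finally have "Q (t + real (Suc n) * h) + (\<Sum>k<Suc n. d k *\<^sub>R Q (t + real k * h)) =
        (Q ((t + h) + real n * h) + (\<Sum>k<n. c k *\<^sub>R Q ((t + h) + real k * h))) - (Q (t + real n * h) + (\<Sum>k<n. c k *\<^sub>R Q (t + real k * h)))"
      by (simp add: algebra_simps)
    then show ?thesis by (simp add: diff_quot_def c scaleR_diff_right)
  qed
  then show ?case by blast
qed simp

section \<open>Rapidly oscillating examples\<close>

definition vanishing :: "(real \<Rightarrow> 'a::real_normed_vector) set" where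
  "vanishing = {u. continuous_on UNIV u \<and> (u \<longlongrightarrow> 0) at_infinity}"

lemma filterlim_add_at_infinity: "filterlim (\<lambda>t::real. t + h) at_infinity at_infinity"
  using tendsto_add_filterlim_at_infinity'[OF filterlim_ident tendsto_const] .

lemma vanishing_diff_quot:
  assumes "u \<in> vanishing"
  shows "diff_quot h u \<in> vanishing"
proof -
  have u: "continuous_on UNIV u" "(u \<longlongrightarrow> 0) at_infinity" using assms by (auto simp: vanishing_def)
  have "continuous_on UNIV (diff_quot h u)"
    unfolding diff_quot_def[abs_def] by (intro continuous_intros continuous_on_compose2[OF u(1)]) auto
  moreover have "((\<lambda>t. (1 / h) *\<^sub>R (u (t + h) - u t)) \<longlongrightarrow> (1 / h) *\<^sub>R (0 - 0)) at_infinity"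
    by (intro tendsto_intros u(2) filterlim_compose[OF u(2) filterlim_add_at_infinity])
  ultimately show ?thesis by (simp add: vanishing_def diff_quot_def[abs_def])
qed

lemma vanishing_subset:
  assumes "half_line J"
  shows "vanishing \<subseteq> erg_class J \<Omega> z \<inter> C_ub J"
  using vanishing_erg_class[OF assms] vanishing_C_ub by (auto simp: vanishing_def)

text \<open>
  \<open>\<integral>\<gamma>\<^sub>\<omega> u'\<close> equals \<open>-i \<omega> \<integral>\<gamma>\<^sub>\<omega> u\<close> up to boundary terms, so all means of the derivative of a bounded \<open>u\<close>
  vanish if those of \<open>u\<close> do.
\<close>

lemma derivative_erg_class:
  fixes u :: "real \<Rightarrow> 'a::complex_banach"
  assumes J: "half_line J" and u: "u \<in> erg_class J \<Omega> True" and B: "\<And>t. norm (u t) \<le> B"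
    and d: "\<And>t. (u has_vector_derivative u' t) (at t)" and c: "continuous_on UNIV u'"
  shows "u' \<in> erg_class J \<Omega> True"
proof (rule erg_classI[OF J])
  have p: "primitive_on J u' u" by (rule primitive_on_of_derivative[OF d])
  show ul: "u' \<in> L1loc J" by (rule continuous_L1loc[OF J continuous_on_subset[OF c]]) simp
  fix \<omega> assume w: "\<omega> \<in> \<Omega>"
  obtain H where H: "primitive_on J (modulate \<omega> u') H"
    using L1loc_primitive[OF J modulate_L1loc[OF J ul]] by blast
  obtain G where G: "primitive_on J (modulate \<omega> u) G"
    using L1loc_primitive[OF J modulate_L1loc[OF J erg_class_L1loc[OF u]]] by blast
  have m: "mean_on J G 0" using erg_classD[OF J u w G] by auto
  have inc: "norm (H (x + T) - H x) \<le> 2 * B + \<bar>\<omega>\<bar> * norm (G (x + T) - G x)" if x: "x \<in> J" and T: "T \<ge> 0" for x T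
  proof -
    have "((\<lambda>t. (\<i> * of_real \<omega>) *\<^sub>C modulate \<omega> u t) has_integral (\<i> * of_real \<omega>) *\<^sub>C (G (x + T) - G x)) {x..x+T}"
      using has_integral_linear[OF primitive_onD[OF G x, of "x + T"] scaleC.bounded_linear_right] T by (simp add: comp_def)
    then have "H (x + T) - H x = wave \<omega> (x + T) *\<^sub>C u (x + T) - wave \<omega> x *\<^sub>C u x - (\<i> * of_real \<omega>) *\<^sub>C (G (x + T) - G x)"
      using primitive_on_modulate[OF J ul p H x, of "x + T"] T by (simp add: modulate_wave scaleC_scaleC integral_unique)
    moreover have "norm (wave \<omega> (x + T) *\<^sub>C u (x + T) - wave \<omega> x *\<^sub>C u x) \<le> 2 * B"
      using norm_triangle_ineq4[of "wave \<omega> (x + T) *\<^sub>C u (x + T)" "wave \<omega> x *\<^sub>C u x"] B[of x] B[of "x + T"] by (simp add: norm_scaleC)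
    ultimately show ?thesis
      using norm_triangle_ineq4[of "wave \<omega> (x + T) *\<^sub>C u (x + T) - wave \<omega> x *\<^sub>C u x" "(\<i> * of_real \<omega>) *\<^sub>C (G (x + T) - G x)"]
      by (simp add: norm_scaleC norm_mult)
  qed
  have "mean_on J H 0"
    unfolding mean_on_def
  proof (intro allI impI)
    fix e :: real assume e: "e > 0"
    define d where "d = e / (2 * (\<bar>\<omega>\<bar> + 1))"
    have d: "d > 0" "\<bar>\<omega>\<bar> * d \<le> e / 2" using e by (auto simp: d_def field_simps)
    obtain T0 where T0: "T0 > 0" "\<And>T x. T \<ge> T0 \<Longrightarrow> x \<in> J \<Longrightarrow> norm (G (x + T) - G x - T *\<^sub>R 0) \<le> d * T"
      using m d(1) unfolding mean_on_def by metis
    show "\<exists>T0>0. \<forall>T\<ge>T0. \<forall>x\<in>J. norm (H (x + T) - H x - T *\<^sub>R 0) \<le> e * T"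
    proof (intro exI[of _ "max T0 (4 * B / e)"] conjI allI impI ballI)
      show "max T0 (4 * B / e) > 0" using T0(1) by simp
      fix T x assume T: "max T0 (4 * B / e) \<le> T" and x: "x \<in> J"
      have T': "T \<ge> T0" "T \<ge> 0" "4 * B \<le> e * T" using T T0(1) e by (auto simp: divide_le_eq mult.commute)
      have "\<bar>\<omega>\<bar> * norm (G (x + T) - G x) \<le> \<bar>\<omega>\<bar> * (d * T)" using T0(2)[OF T'(1) x] by (intro mult_left_mono) auto
      also have "\<dots> \<le> e / 2 * T" using mult_right_mono[OF d(2) T'(2)] by (simp add: mult.assoc)
      finally show "norm (H (x + T) - H x - T *\<^sub>R 0) \<le> e * T" using inc[OF x T'(2)] T'(3) by simp
    qed
  qed
  then show "\<exists>G m. primitive_on J (modulate \<omega> u') G \<and> (True \<longrightarrow> m = 0) \<and> mean_on J G m" using H by blast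
qed

text \<open>
  By \<open>derivative_erg_class\<close>, applied twice, all means of these functions vanish; and since difference quotients
  commute with derivatives, the class is closed under difference quotients.
\<close>

definition second_derivatives :: "(real \<Rightarrow> 'a::real_normed_vector) set" where
  "second_derivatives = {u. continuous_on UNIV u \<and> (\<exists>H\<in>vanishing. \<exists>H' B. (\<forall>t. (H has_vector_derivative H' t) (at t)) \<and>
     (\<forall>t. (H' has_vector_derivative u t) (at t)) \<and> (\<forall>t. norm (H' t) \<le> B))}"

lemma second_derivatives_diff_quot:
  assumes "u \<in> second_derivatives" and h: "h > 0"
  shows "diff_quot h u \<in> second_derivatives"
proof -
  obtain H H' B where c: "continuous_on UNIV u" and H: "H \<in> vanishing" "\<And>t. (H has_vector_derivative H' t) (at t)"
      "\<And>t. (H' has_vector_derivative u t) (at t)" and B: "\<And>t. norm (H' t) \<le> B"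
    using assms unfolding second_derivatives_def by blast
  have "continuous_on UNIV (diff_quot h u)"
    unfolding diff_quot_def[abs_def] by (intro continuous_intros continuous_on_compose2[OF c]) auto
  moreover have "norm (diff_quot h H' t) \<le> 1 / h * (2 * B)" for t
    unfolding diff_quot_def using norm_triangle_ineq4[of "H' (t + h)" "H' t"] B[of t] B[of "t + h"] h
    by (simp add: divide_right_mono)
  ultimately show ?thesis
    unfolding second_derivatives_def mem_Collect_eq
    by (intro conjI bexI[of _ "diff_quot h H"] exI[of _ "diff_quot h H'"] exI[of _ "1 / h * (2 * B)"] allI
        has_vector_derivative_diff_quot H vanishing_diff_quot)
qed

lemma second_derivatives_subset:
  assumes J: "half_line J"
  shows "(second_derivatives :: (real \<Rightarrow> 'a::complex_banach) set) \<subseteq> erg_class J \<Omega> True"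
proof
  fix u :: "real \<Rightarrow> 'a" assume "u \<in> second_derivatives"
  then obtain H H' B where c: "continuous_on UNIV u" and H: "H \<in> vanishing" "\<And>t. (H has_vector_derivative H' t) (at t)"
      "\<And>t. (H' has_vector_derivative u t) (at t)" and B: "\<And>t. norm (H' t) \<le> B"
    unfolding second_derivatives_def by blast
  have HE: "H \<in> erg_class J \<Omega> True" using vanishing_subset[OF J] H(1) by blast
  obtain A where A: "\<And>t. norm (H t) \<le> A" using vanishing_bounded[of H] H(1) by (auto simp: vanishing_def)
  have "continuous_on UNIV H'"
    using H(3) by (meson continuous_at_imp_continuous_on has_vector_derivative_continuous)
  from derivative_erg_class[OF J derivative_erg_class[OF J HE A H(2) this] B H(3) c]
  show "u \<in> erg_class J \<Omega> True" .
qed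

text \<open>
  The function \<open>t \<mapsto> e\<^sup>-\<^sup>t (1 - exp (-e\<^sup>2\<^sup>t)) exp (i e\<^sup>l\<^sup>t)\<close> vanishes at infinity, while its derivative is
  about \<open>i exp (i e\<^sup>t)\<close> for \<open>l = 1\<close> and of size \<open>2 e\<^sup>t\<close> for \<open>l = 2\<close> as \<open>t \<rightarrow> \<infinity>\<close>.  As it extends to an
  entire function, it has derivatives of all orders.
\<close>

definition osc :: "real \<Rightarrow> complex \<Rightarrow> complex" where
  "osc l z = exp (- z) * (1 - exp (- exp (2 * z))) * exp (\<i> * exp (of_real l * z))"

definition osc_chain :: "real \<Rightarrow> 'a::complex_banach \<Rightarrow> nat \<Rightarrow> real \<Rightarrow> 'a" where
  "osc_chain l v k t = (deriv ^^ k) (osc l) (of_real t) *\<^sub>C v"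

definition damping :: "real \<Rightarrow> real" where
  "damping t = exp (- t) * (1 - exp (- exp (2 * t)))"

lemma derivative_chain_osc: "derivative_chain (osc_chain l v)"
  unfolding derivative_chain_def
proof (intro allI)
  fix k t
  have "osc l holomorphic_on UNIV" unfolding osc_def by (intro holomorphic_intros)
  then have "(deriv ^^ k) (osc l) holomorphic_on UNIV" by (rule holomorphic_higher_deriv) simp
  then have "((deriv ^^ k) (osc l) has_field_derivative (deriv ^^ Suc k) (osc l) (of_real t)) (at (of_real t))"
    using holomorphic_derivI[of "(deriv ^^ k) (osc l)" UNIV] by simp
  from has_vector_derivative_real_field[OF this]
  have "((\<lambda>t. (deriv ^^ k) (osc l) (of_real t)) has_vector_derivative (deriv ^^ Suc k) (osc l) (of_real t)) (at t)" .
  from bounded_linear.has_vector_derivative[OF scaleC.bounded_linear_left this]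
  show "(osc_chain l v k has_vector_derivative osc_chain l v (Suc k) t) (at t)"
    unfolding osc_chain_def[abs_def] .
qed

lemma wave_exp: "exp (\<i> * exp (of_real l * complex_of_real t)) = wave 1 (exp (l * t))"
  by (simp add: wave_def exp_of_real[symmetric])

lemma osc_chain_0: "osc_chain l v 0 t = (of_real (damping t) * wave 1 (exp (l * t))) *\<^sub>C v"
  unfolding osc_chain_def osc_def funpow_0 wave_exp
  by (simp add: damping_def flip: exp_of_real)

lemma osc_chain_1:
  "osc_chain l v (Suc 0) t =
     ((of_real (2 * exp t * exp (- exp (2 * t)) - damping t) + \<i> * of_real (l * (exp (l * t) * damping t))) * wave 1 (exp (l * t))) *\<^sub>C v"
proof -
  let ?z = "complex_of_real t"
  have e: "exp (- z) * exp (2 * z) = exp z" for z :: complex by (simp flip: exp_add)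
  have "(osc l has_field_derivative
      (2 * (exp (- ?z) * exp (2 * ?z)) * exp (- exp (2 * ?z)) - exp (- ?z) * (1 - exp (- exp (2 * ?z)))
        + \<i> * (of_real l * (exp (of_real l * ?z) * (exp (- ?z) * (1 - exp (- exp (2 * ?z))))))) * exp (\<i> * exp (of_real l * ?z))) (at ?z)"
    unfolding osc_def[abs_def] by (auto intro!: derivative_eq_intros) (simp add: algebra_simps)
  then have "deriv (osc l) ?z = (2 * (exp (- ?z) * exp (2 * ?z)) * exp (- exp (2 * ?z)) - exp (- ?z) * (1 - exp (- exp (2 * ?z)))
        + \<i> * (of_real l * (exp (of_real l * ?z) * (exp (- ?z) * (1 - exp (- exp (2 * ?z))))))) * exp (\<i> * exp (of_real l * ?z))"
    by (rule DERIV_imp_deriv)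
  then show ?thesis
    unfolding osc_chain_def wave_exp e by (simp add: damping_def flip: exp_of_real)
qed

lemma exp_neg_exp_le: "exp (- exp (2 * t)) \<le> exp (- 2 * t)" for t :: real
proof -
  have "2 * t \<le> exp (2 * t)" using exp_ge_add_one_self[of "2 * t"] by linarith
  then show ?thesis by simp
qed

lemma exp_neg_exp_bound: "exp t * exp (- exp (2 * t)) \<le> exp (- \<bar>t\<bar>)" for t :: real
proof (cases "t \<ge> 0")
  case True
  have "exp t * exp (- exp (2 * t)) \<le> exp t * exp (- 2 * t)" using exp_neg_exp_le[of t] by simp
  also have "\<dots> = exp (- \<bar>t\<bar>)" using True by (simp flip: exp_add)
  finally show ?thesis .
next
  case False
  have "exp t * exp (- exp (2 * t)) \<le> exp t * 1" by (intro mult_left_mono) auto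
  then show ?thesis using False by simp
qed

lemma damping_bounds: "0 \<le> damping t" "damping t \<le> exp (- \<bar>t\<bar>)"
proof -
  show "0 \<le> damping t" by (simp add: damping_def)
  show "damping t \<le> exp (- \<bar>t\<bar>)"
  proof (cases "t \<ge> 0")
    case True
    have "damping t \<le> exp (- t) * 1" unfolding damping_def by (intro mult_left_mono) auto
    then show ?thesis using True by simp
  next
    case False
    have "1 - exp (- exp (2 * t)) \<le> exp (2 * t)" using exp_ge_add_one_self[of "- exp (2 * t)"] by simp
    then have "damping t \<le> exp (- t) * exp (2 * t)" unfolding damping_def by (intro mult_left_mono) auto
    also have "\<dots> = exp (- \<bar>t\<bar>)" using False by (simp flip: exp_add)
    finally show ?thesis .
  qed
qed

lemma damping_derivative_bound: "\<bar>2 * exp t * exp (- exp (2 * t)) - damping t\<bar> \<le> 3 * exp (- \<bar>t\<bar>)"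
proof -
  have "0 \<le> exp t * exp (- exp (2 * t))" by simp
  moreover have "2 * exp t * exp (- exp (2 * t)) = 2 * (exp t * exp (- exp (2 * t)))" by simp
  ultimately show ?thesis using exp_neg_exp_bound[of t] damping_bounds[of t] by linarith
qed

lemma osc_chain_0_vanishing: "osc_chain l v 0 \<in> vanishing"
proof -
  have "((\<lambda>t::real. exp (- norm t)) \<longlongrightarrow> 0) at_infinity"
    by (rule filterlim_compose[OF exp_at_bot filterlim_compose[OF filterlim_uminus_at_bot_at_top filterlim_norm_at_top]])
  then have l: "((\<lambda>t::real. exp (- norm t) * norm v) \<longlongrightarrow> 0) at_infinity" by (rule tendsto_mult_left_zero)
  have "norm (osc_chain l v 0 t) \<le> exp (- norm t) * norm v" for t
    unfolding osc_chain_0 norm_scaleC using damping_bounds[of t] by (simp add: norm_mult mult_right_mono)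
  then have "((osc_chain l v 0) \<longlongrightarrow> 0) at_infinity"
    by (intro Lim_null_comparison[OF _ l] always_eventually) auto
  then show ?thesis using derivative_chain_continuous[OF derivative_chain_osc] by (simp add: vanishing_def)
qed

lemma osc_chain_in_Mcl:
  assumes J: "half_line J"
  shows "osc_chain l v n \<in> (Mcl J ^^ n) (erg_class J \<Omega> z \<inter> C_ub J)"
  using Mcl_funpow_derivative_chain[OF J vanishing_diff_quot derivative_chain_osc osc_chain_0_vanishing]
    Mcl_funpow_mono[OF vanishing_subset[OF J]] by blast

lemma osc_chain_1_remainder:
  fixes v :: "'a::complex_banach"
  shows "norm (osc_chain 1 v (Suc 0) t - (\<i> * wave 1 (exp t)) *\<^sub>C v) \<le> (3 * exp (- \<bar>t\<bar>) + exp (- exp (2 * t))) * norm v"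
proof -
  have ed: "exp t * damping t = 1 - exp (- exp (2 * t))" by (simp add: damping_def mult.assoc[symmetric] flip: exp_add)
  have "osc_chain 1 v (Suc 0) t - (\<i> * wave 1 (exp t)) *\<^sub>C v
      = ((of_real (2 * exp t * exp (- exp (2 * t)) - damping t) - \<i> * of_real (exp (- exp (2 * t)))) * wave 1 (exp t)) *\<^sub>C v"
    unfolding osc_chain_1 mult_1 ed scaleC.diff_left[symmetric]
    by (rule arg_cong[where f="\<lambda>c. c *\<^sub>C v"]) (simp add: algebra_simps)
  also have "norm \<dots> \<le> (3 * exp (- \<bar>t\<bar>) + exp (- exp (2 * t))) * norm v"
    unfolding norm_scaleC
  proof (rule mult_right_mono)
    have "norm ((of_real (2 * exp t * exp (- exp (2 * t)) - damping t) - \<i> * of_real (exp (- exp (2 * t)))) * wave 1 (exp t))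
        \<le> \<bar>2 * exp t * exp (- exp (2 * t)) - damping t\<bar> + exp (- exp (2 * t))"
      using norm_triangle_ineq4[of "of_real (2 * exp t * exp (- exp (2 * t)) - damping t) :: complex" "\<i> * of_real (exp (- exp (2 * t)))"]
      unfolding norm_mult norm_wave norm_of_real by (simp del: of_real_diff of_real_mult)
    also have "\<bar>2 * exp t * exp (- exp (2 * t)) - damping t\<bar> \<le> 3 * exp (- \<bar>t\<bar>)"
      using damping_derivative_bound .
    finally show "norm ((of_real (2 * exp t * exp (- exp (2 * t)) - damping t) - \<i> * of_real (exp (- exp (2 * t)))) * wave 1 (exp t))
        \<le> 3 * exp (- \<bar>t\<bar>) + exp (- exp (2 * t))" by simp
  qed simp
  finally show ?thesis .
qed

lemma osc_chain_2_in_Mcl: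
  assumes J: "half_line J"
  shows "osc_chain 1 v (n + 2) \<in> (Mcl J ^^ n) (erg_class J \<Omega> True)"
proof -
  let ?U = "\<lambda>k. osc_chain 1 v (k + 2)"
  have ch: "derivative_chain ?U" using derivative_chain_osc[of 1 v] by (simp add: derivative_chain_def)
  have d: "(osc_chain 1 v k has_vector_derivative osc_chain 1 v (Suc k) t) (at t)" for k t
    using derivative_chain_osc[of 1 v] by (simp add: derivative_chain_def)
  have B: "norm (osc_chain 1 v (Suc 0) t) \<le> 5 * norm v" for t
  proof -
    have "3 * exp (- \<bar>t\<bar>) + exp (- exp (2 * t)) \<le> 3 * 1 + 1" by (intro add_mono mult_left_mono) auto
    then have "3 * exp (- \<bar>t\<bar>) + exp (- exp (2 * t)) \<le> 4" by simp
    then have "(3 * exp (- \<bar>t\<bar>) + exp (- exp (2 * t))) * norm v \<le> 4 * norm v" by (rule mult_right_mono) simp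
    moreover have "norm ((\<i> * wave 1 (exp t)) *\<^sub>C v) = norm v" by (simp add: norm_scaleC norm_mult)
    ultimately show ?thesis
      using osc_chain_1_remainder[of v t] norm_triangle_sub[of "osc_chain 1 v (Suc 0) t" "(\<i> * wave 1 (exp t)) *\<^sub>C v"] by linarith
  qed
  have "?U 0 \<in> second_derivatives"
    unfolding second_derivatives_def mem_Collect_eq
    using d[of 0] d[of "Suc 0"] B derivative_chain_continuous[OF derivative_chain_osc] osc_chain_0_vanishing[of 1 v]
    by (intro conjI bexI[of _ "osc_chain 1 v 0"] exI[of _ "osc_chain 1 v (Suc 0)"] exI[of _ "5 * norm v"]) (auto simp: numeral_2_eq_2)
  from Mcl_funpow_derivative_chain[OF J second_derivatives_diff_quot ch this]
  show ?thesis using Mcl_funpow_mono[OF second_derivatives_subset[OF J]] by blast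
qed

lemma osc_chain_growth:
  fixes v :: "'a::complex_banach"
  assumes v: "norm v = 1"
  shows "\<bar>norm (osc_chain 2 v (Suc 0) t) - 2 * exp t\<bar> \<le> 5"
proof -
  have ed: "exp (2 * t) * damping t = exp t - exp t * exp (- exp (2 * t))"
  proof -
    have "exp (2 * t) * damping t = (exp (2 * t) * exp (- t)) * (1 - exp (- exp (2 * t)))" by (simp add: damping_def)
    also have "exp (2 * t) * exp (- t) = exp t" by (simp flip: exp_add)
    finally show ?thesis by (simp add: algebra_simps)
  qed
  let ?a = "2 * exp t * exp (- exp (2 * t)) - damping t" and ?b = "2 * (exp (2 * t) * damping t)"
  have n: "norm (osc_chain 2 v (Suc 0) t) = norm (complex_of_real ?a + \<i> * complex_of_real ?b)"
    unfolding osc_chain_1 norm_scaleC norm_mult[of _ "wave _ _"] norm_wave v by simp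
  have e1: "exp (- \<bar>t\<bar>) \<le> 1" by simp
  have a: "\<bar>?a\<bar> \<le> 3" using damping_derivative_bound[of t] e1 by linarith
  have b: "\<bar>?b - 2 * exp t\<bar> \<le> 2" 
  proof -
    have "\<bar>2 * (y - x) - 2 * y\<bar> \<le> 2" if "0 \<le> x" "x \<le> 1" for x y :: real using that by (simp add: abs_le_iff)
    from this[of "exp t * exp (- exp (2 * t))"] show ?thesis
      unfolding ed using order_trans[OF exp_neg_exp_bound e1] by simp
  qed
  have b0: "?b \<ge> 0" using damping_bounds[of t] by simp
  have "norm (\<i> * complex_of_real ?b) = ?b" using b0 by (simp only: norm_mult norm_of_real) simp
  then show ?thesis
    unfolding n using norm_triangle_ineq[of "complex_of_real ?a" "\<i> * complex_of_real ?b"]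
      norm_triangle_ineq4[of "complex_of_real ?a + \<i> * complex_of_real ?b" "complex_of_real ?a"] a b
    unfolding norm_of_real add_diff_cancel_left' by linarith
qed

lemma half_line_ex_large:
  assumes J: "half_line J"
  shows "\<exists>t\<in>J. t \<ge> M"
proof -
  obtain x where "x \<in> J" using half_line_nonempty[OF J] by blast
  then show ?thesis using half_lineD[OF J, of x "max x M"] by (intro bexI[of _ "max x M"]) auto
qed

text \<open>
  The derivative has size \<open>2 e\<^sup>t\<close>, so the terms before the last one, with arguments smaller by at least
  \<open>h\<close>, are smaller by the factor \<open>e\<^sup>-\<^sup>h\<close>.
\<close>

lemma diff_quot_osc_unbounded:
  fixes v :: "'a::complex_banach"
  assumes J: "half_line J" and v: "norm v = 1"
  shows "\<exists>h>0. \<forall>B. \<exists>t\<in>J. norm ((diff_quot h ^^ n) (osc_chain 2 v (Suc 0)) t) > B"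
proof -
  let ?Q = "osc_chain 2 v (Suc 0)"
  obtain c where c: "\<And>h t. (diff_quot h ^^ n) ?Q t = (1 / h) ^ n *\<^sub>R (?Q (t + real n * h) + (\<Sum>k<n. c k *\<^sub>R ?Q (t + real k * h)))"
    using diff_quot_funpow_expansion[of n] by blast
  define S where "S = (\<Sum>k<n. \<bar>c k\<bar>)"
  have S: "S \<ge> 0" by (simp add: S_def sum_nonneg)
  \<comment> \<open>then the sum of the other terms is at most half the last one, up to a constant\<close>
  define h where "h = ln (2 * S + 2)"
  have eh: "exp h = 2 * S + 2" using S by (simp add: h_def)
  have h: "h > 0" using S by (simp add: h_def)
  show ?thesis
  proof (intro exI[of _ h] conjI allI h)
    fix B
    define M where "M = \<bar>B\<bar> * h ^ n + 5 * (1 + S) + 1"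
    have "\<bar>B\<bar> * h ^ n \<ge> 0" using h by simp
    then have M: "M > 0" using S unfolding M_def by (intro add_nonneg_pos add_nonneg_nonneg) auto
    obtain t where t: "t \<in> J" "t \<ge> ln M" using half_line_ex_large[OF J] by blast
    have "M \<le> exp t" using t(2) M exp_le_cancel_iff[of "ln M" t] exp_ln[of M] by simp
    also have "exp t \<le> exp (t + real n * h)" using h by simp
    finally have Mt: "M \<le> exp (t + real n * h)" .
    let ?E = "exp (t + real n * h)"
    have "norm (\<Sum>k<n. c k *\<^sub>R ?Q (t + real k * h)) \<le> (\<Sum>k<n. \<bar>c k\<bar> * (2 * (?E / exp h) + 5))"
    proof (rule order_trans[OF norm_sum sum_mono])
      fix k assume "k \<in> {..<n}"
      then have "real k + 1 \<le> real n" by simp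
      then have "(real k + 1) * h \<le> real n * h" using h by (intro mult_right_mono) auto
      then have "exp (t + real k * h) \<le> exp (t + real n * h - h)" by (simp add: algebra_simps)
      also have "\<dots> = ?E / exp h" by (simp add: exp_diff)
      finally have "norm (?Q (t + real k * h)) \<le> 2 * (?E / exp h) + 5"
        using osc_chain_growth[OF v, of "t + real k * h"] by linarith
      then show "norm (c k *\<^sub>R ?Q (t + real k * h)) \<le> \<bar>c k\<bar> * (2 * (?E / exp h) + 5)"
        by (simp add: mult_left_mono)
    qed
    also have "\<dots> = S * (2 * (?E / exp h) + 5)" by (simp add: S_def sum_distrib_right)
    also have "\<dots> \<le> ?E + 5 * S"
    proof -
      have "S * 2 * ?E \<le> ?E * exp h" using S by (simp add: eh algebra_simps)
      then have "S * (2 * (?E / exp h)) \<le> ?E" by (simp add: divide_le_eq mult.assoc)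
      then show ?thesis by (simp add: algebra_simps)
    qed
    finally have sum: "norm (\<Sum>k<n. c k *\<^sub>R ?Q (t + real k * h)) \<le> ?E + 5 * S" .
    have "norm (?Q (t + real n * h) + (\<Sum>k<n. c k *\<^sub>R ?Q (t + real k * h))) \<ge> ?E - 5 * (1 + S)"
      using norm_diff_ineq[of "?Q (t + real n * h)" "\<Sum>k<n. c k *\<^sub>R ?Q (t + real k * h)"] sum osc_chain_growth[OF v, of "t + real n * h"]
      by (simp add: algebra_simps)
    then have "norm (?Q (t + real n * h) + (\<Sum>k<n. c k *\<^sub>R ?Q (t + real k * h))) > \<bar>B\<bar> * h ^ n"
      using Mt by (simp add: M_def)
    then have "norm ((diff_quot h ^^ n) ?Q t) > \<bar>B\<bar>"
      unfolding c using h by (simp add: power_divide less_divide_eq)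
    then show "\<exists>t\<in>J. norm ((diff_quot h ^^ n) ?Q t) > B" using t(1) by (intro bexI[of _ t]) auto
  qed
qed


lemma wave_diff_le: "norm (wave 1 a - wave 1 b) \<le> \<bar>a - b\<bar>"
proof -
  have "wave 1 a - wave 1 b = wave 1 b * (wave 1 (a - b) - 1)"
    using wave_add[of 1 b "a - b"] by (simp add: algebra_simps)
  then show ?thesis using norm_wave_minus_one[of 1 "a - b"] by (simp add: norm_mult)
qed

lemma wave_add_pi: "wave 1 (a + pi) = - wave 1 a"
  unfolding wave_add by (simp add: wave_def)

text \<open>
  With \<open>e\<^sup>t\<^sup>' = e\<^sup>t + \<pi> e\<^sup>-\<^sup>n\<^sup>h\<close> the phase \<open>e\<^sup>t\<^sup>+\<^sup>n\<^sup>h\<close> of the last term of the difference quotient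
  changes by \<open>\<pi>\<close>, while the phases of the other terms change by at most \<open>\<pi> e\<^sup>-\<^sup>h\<close>; and \<open>t' - t\<close> is small for large \<open>t\<close>.
\<close>

lemma diff_quot_osc_not_uniformly_continuous:
  fixes v :: "'a::complex_banach"
  assumes J: "half_line J" and v: "norm v = 1"
  shows "\<exists>h>0. \<not> uniformly_continuous_on J ((diff_quot h ^^ n) (osc_chain 1 v (Suc 0)))"
proof -
  let ?Q = "osc_chain 1 v (Suc 0)"
  obtain c where c: "\<And>h t. (diff_quot h ^^ n) ?Q t = (1 / h) ^ n *\<^sub>R (?Q (t + real n * h) + (\<Sum>k<n. c k *\<^sub>R ?Q (t + real k * h)))"
    using diff_quot_funpow_expansion[of n] by blast
  define S where "S = (\<Sum>k<n. \<bar>c k\<bar>)"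
  have S: "S \<ge> 0" by (simp add: S_def sum_nonneg)
  \<comment> \<open>then \<open>S \<pi> e\<^sup>-\<^sup>h \<le> 1/2\<close>\<close>
  define h where "h = ln (2 * pi * S + 2)"
  have "2 * pi * S \<ge> 0" using S by simp
  then have p: "2 * pi * S + 2 > 1" by linarith
  have eh: "exp h = 2 * pi * S + 2" using p by (simp add: h_def)
  have h: "h > 0" using p by (simp add: h_def)
  define r where "r t = ?Q t - (\<i> * wave 1 (exp t)) *\<^sub>C v" for t
  have r: "norm (r t) \<le> 4 * exp (- t)" if "t \<ge> 0" for t
  proof -
    have "exp (- exp (2 * t)) \<le> exp (- t)" using that by (intro order_trans[OF exp_neg_exp_le]) simp
    moreover have "norm (r t) \<le> 3 * exp (- t) + exp (- exp (2 * t))"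
      using osc_chain_1_remainder[of v t] that unfolding r_def v by simp
    ultimately show ?thesis by linarith
  qed
  show ?thesis
  proof (intro exI[of _ h] conjI h notI)
    assume uc: "uniformly_continuous_on J ((diff_quot h ^^ n) ?Q)"
    have "(1 / h) ^ n > 0" using h by simp
    then obtain d where d: "d > 0" "\<And>x y. x \<in> J \<Longrightarrow> y \<in> J \<Longrightarrow> dist y x < d \<Longrightarrow> dist ((diff_quot h ^^ n) ?Q y) ((diff_quot h ^^ n) ?Q x) < (1 / h) ^ n"
      using uc unfolding uniformly_continuous_on_def by metis
    \<comment> \<open>\<open>e\<^sup>t \<ge> M\<close> makes \<open>t' - t\<close> smaller than \<open>d\<close> and the total contribution of \<open>r\<close> at most \<open>1/2\<close>\<close>
    define M where "M = max (pi / d + 1) (16 * (1 + S))"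
    have M: "M \<ge> 1" "M > pi / d" "M \<ge> 16 * (1 + S)" using S d(1) by (auto simp: M_def)
    obtain t where t: "t \<in> J" "t \<ge> ln M" using half_line_ex_large[OF J] by blast
    have t0: "t \<ge> 0" using t(2) ln_ge_zero[OF M(1)] by linarith
    have Mt: "M \<le> exp t" using t(2) M(1) exp_le_cancel_iff[of "ln M" t] exp_ln[of M] by simp
    define \<delta> where "\<delta> = pi * exp (- real n * h)"
    have \<delta>: "\<delta> > 0" "\<delta> \<le> pi" using h by (auto simp: \<delta>_def)
    define t' where "t' = ln (exp t + \<delta>)"
    have et': "exp t' = exp t + \<delta>" using \<delta>(1) by (simp add: t'_def add_pos_pos)
    then have tt': "t \<le> t'" using \<delta>(1) exp_le_cancel_iff[of t t'] by simp
    have t'J: "t' \<in> J" by (rule half_lineD[OF J t(1) tt'])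
    have "t' - t = ln (1 + \<delta> * exp (- t))"
    proof -
      have "exp t + \<delta> = exp t * (1 + \<delta> * exp (- t))" by (simp add: algebra_simps flip: exp_add)
      moreover have "1 + \<delta> * exp (- t) > 0" using \<delta>(1) by (simp add: add_pos_pos)
      ultimately show ?thesis by (simp add: t'_def ln_mult)
    qed
    also have "\<dots> \<le> \<delta> * exp (- t)" using \<delta>(1) by (intro ln_add_one_self_le_self) simp
    also have "\<dots> \<le> pi * exp (- t)" using \<delta>(2) by (intro mult_right_mono) auto
    also have "\<dots> = pi / exp t" by (simp add: exp_minus divide_inverse)
    also have "\<dots> < d"
    proof -
      have "pi < d * M" using M(2) d(1) by (simp add: divide_less_eq mult.commute)
      also have "\<dots> \<le> d * exp t" using Mt d(1) by (intro mult_left_mono) auto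
      finally show ?thesis by (simp add: divide_less_eq)
    qed
    finally have "dist t' t < d" using tt' by (simp add: dist_real_def)
    from d(2)[OF t(1) t'J this]
    have lt: "norm ((diff_quot h ^^ n) ?Q t' - (diff_quot h ^^ n) ?Q t) < (1 / h) ^ n" by (simp add: dist_norm)
    have rb: "norm (r (s + real k * h)) \<le> 1 / (4 * (1 + S))" if "s \<ge> t" for s k
    proof -
      have s: "s + real k * h \<ge> t" using that h by (simp add: add_increasing2)
      have "norm (r (s + real k * h)) \<le> 4 * exp (- (s + real k * h))" using s t0 by (intro r) simp
      also have "\<dots> \<le> 4 * exp (- t)" using s by simp
      also have "\<dots> = 4 / exp t" by (simp add: exp_minus divide_inverse)
      also have "\<dots> \<le> 4 / (16 * (1 + S))" using Mt M(3) S by (intro divide_left_mono) (auto intro!: mult_pos_pos)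
      also have "\<dots> = 1 / (4 * (1 + S))" using S by (simp add: field_simps)
      finally show ?thesis .
    qed
    have diff: "?Q (t' + real k * h) - ?Q (t + real k * h) =
        (\<i> * (wave 1 (exp (t' + real k * h)) - wave 1 (exp (t + real k * h)))) *\<^sub>C v + (r (t' + real k * h) - r (t + real k * h))" for k
      by (simp add: r_def scaleC.diff_left right_diff_distrib)
    have rd: "norm (r (t' + real k * h) - r (t + real k * h)) \<le> 1 / (2 * (1 + S))" for k
    proof -
      have eq: "1 / (2 * (1 + S)) = 1 / (4 * (1 + S)) + 1 / (4 * (1 + S))" using S by (simp add: field_simps)
      show ?thesis
        unfolding eq by (rule order_trans[OF norm_triangle_ineq4 add_mono[OF rb[OF tt'] rb[OF order_refl]]])
    qed
    have ph: "exp (t' + real k * h) - exp (t + real k * h) = pi * exp (real k * h - real n * h)" for k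
      by (simp add: exp_add et' \<delta>_def algebra_simps exp_diff exp_minus divide_inverse)
    have small: "norm (?Q (t' + real k * h) - ?Q (t + real k * h)) \<le> pi / exp h + 1 / (2 * (1 + S))" if "k < n" for k
    proof -
      have "(real k + 1) * h \<le> real n * h" using that h by (intro mult_right_mono) auto
      then have "exp (real k * h - real n * h) \<le> exp (- h)" by (simp add: algebra_simps)
      then have "pi * exp (real k * h - real n * h) \<le> pi * exp (- h)" by (intro mult_left_mono) auto
      also have "pi * exp (- h) = pi / exp h" by (simp add: exp_minus divide_inverse)
      finally have "norm (wave 1 (exp (t' + real k * h)) - wave 1 (exp (t + real k * h))) \<le> pi / exp h"
        using wave_diff_le[of "exp (t' + real k * h)" "exp (t + real k * h)"] unfolding ph by simp
      then show ?thesis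
        unfolding diff using rd[of k]
        by (intro order_trans[OF norm_triangle_ineq] add_mono) (auto simp: norm_scaleC norm_mult v)
    qed
    have big: "norm (?Q (t' + real n * h) - ?Q (t + real n * h)) \<ge> 2 - 1 / (2 * (1 + S))"
    proof -
      have "exp (t' + real n * h) = exp (t + real n * h) + pi" using ph[of n] by simp
      then have weq: "wave 1 (exp (t' + real n * h)) - wave 1 (exp (t + real n * h)) = - (2 * wave 1 (exp (t + real n * h)))"
        by (simp add: wave_add_pi)
      have "norm ((\<i> * (wave 1 (exp (t' + real n * h)) - wave 1 (exp (t + real n * h)))) *\<^sub>C v) = 2"
        unfolding weq by (simp add: norm_scaleC norm_mult v)
      then show ?thesis
        unfolding diff[of n] using norm_diff_ineq[of "(\<i> * (wave 1 (exp (t' + real n * h)) - wave 1 (exp (t + real n * h)))) *\<^sub>C v" "r (t' + real n * h) - r (t + real n * h)"] rd[of n]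
        by linarith
    qed
    let ?s = "\<Sum>k<n. c k *\<^sub>R (?Q (t' + real k * h) - ?Q (t + real k * h))"
    have "norm ?s \<le> (\<Sum>k<n. \<bar>c k\<bar> * (pi / exp h + 1 / (2 * (1 + S))))"
      by (rule order_trans[OF norm_sum sum_mono]) (use small in \<open>auto intro!: mult_left_mono\<close>)
    also have "\<dots> = S * (pi / exp h) + S * (1 / (2 * (1 + S)))" 
      unfolding sum_distrib_right[symmetric] S_def[symmetric] by (rule distrib_left)
    also have "S * (pi / exp h) \<le> 1/2"
    proof -
      have "S * pi * 2 \<le> exp h" by (simp add: eh mult.commute mult.left_commute)
      then show ?thesis by (simp add: divide_le_eq)
    qed
    finally have "norm ?s \<le> 1/2 + S * (1 / (2 * (1 + S)))" by simp
    moreover have "S * (1 / (2 * (1 + S))) + 1 / (2 * (1 + S)) = 1/2" using S by (simp add: field_simps)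
    ultimately have "norm ((?Q (t' + real n * h) - ?Q (t + real n * h)) + ?s) \<ge> 1"
      using norm_diff_ineq[of "?Q (t' + real n * h) - ?Q (t + real n * h)" ?s] big by linarith
    moreover have "(diff_quot h ^^ n) ?Q t' - (diff_quot h ^^ n) ?Q t
        = (1 / h) ^ n *\<^sub>R ((?Q (t' + real n * h) - ?Q (t + real n * h)) + ?s)"
      unfolding c by (simp add: scaleR_diff_right sum_subtractf scaleR_add_right)
    ultimately have "norm ((diff_quot h ^^ n) ?Q t' - (diff_quot h ^^ n) ?Q t) \<ge> (1 / h) ^ n"
      using h by (simp add: mult_le_cancel_left1 power_one_over[symmetric])
    then show False using lt by simp
  qed
qed

section \<open>A slowly modulated wave\<close>

text \<open>
  The function \<open>t \<mapsto> exp (i (t + ln (1 + t\<^sup>2)))\<close> is ergodic because of the factor \<open>e\<^sup>i\<^sup>t\<close>.  Without this factor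
  it oscillates ever more slowly, so that its means over intervals of a fixed length do not approach
  each other.
\<close>

definition slow_wave :: "'a::complex_banach \<Rightarrow> real \<Rightarrow> 'a" where
  "slow_wave v t = wave 1 (t + ln (1 + t\<^sup>2)) *\<^sub>C v"

lemma wave_compose_derivative:
  assumes "(\<theta> has_real_derivative \<theta>') (at t)"
  shows "((\<lambda>t. wave 1 (\<theta> t) *\<^sub>C v) has_vector_derivative \<theta>' *\<^sub>R (\<i> * wave 1 (\<theta> t)) *\<^sub>C v) (at t)"
proof -
  have "(\<theta> has_vector_derivative \<theta>') (at t)" using assms by (simp add: has_real_derivative_iff_has_vector_derivative)
  from vector_diff_chain_at[OF this wave_derivative[of 1]]
  have "((\<lambda>t. wave 1 (\<theta> t)) has_vector_derivative \<theta>' *\<^sub>R (\<i> * wave 1 (\<theta> t))) (at t)" by (simp add: comp_def)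
  from bounded_linear.has_vector_derivative[OF scaleC.bounded_linear_left this] show ?thesis
    by (simp add: scaleC.scaleR_left)
qed

lemma ln_derivative: "((\<lambda>t. ln (1 + t\<^sup>2)) has_real_derivative 2 * t / (1 + t\<^sup>2)) (at t)" for t :: real
proof -
  have "1 + t\<^sup>2 > 0" by (simp add: add_pos_nonneg)
  then show ?thesis by (auto intro!: derivative_eq_intros simp: divide_inverse)
qed

lemma two_t_le: "\<bar>2 * t / (1 + t\<^sup>2)\<bar> \<le> 1" for t :: real
proof -
  have "0 < 1 + t\<^sup>2" by (simp add: add_pos_nonneg)
  moreover have "2 * \<bar>t\<bar> \<le> 1 + t\<^sup>2" using zero_le_power2[of "\<bar>t\<bar> - 1"] by (simp add: power2_diff)
  ultimately show ?thesis by (simp add: abs_mult divide_le_eq)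
qed

lemma norm_slow_wave [simp]: "norm (slow_wave v t) = norm v"
  by (simp add: slow_wave_def norm_scaleC)

lemma slow_wave_derivative:
  "(slow_wave v has_vector_derivative (1 + 2 * t / (1 + t\<^sup>2)) *\<^sub>R \<i> *\<^sub>C slow_wave v t) (at t)"
proof -
  have "((\<lambda>t. t + ln (1 + t\<^sup>2)) has_real_derivative 1 + 2 * t / (1 + t\<^sup>2)) (at t)"
    by (intro DERIV_add ln_derivative DERIV_ident)
  from wave_compose_derivative[OF this] show ?thesis
    unfolding slow_wave_def[abs_def] by (simp add: scaleC_scaleC)
qed

lemma slow_wave_continuous: "continuous_on S (slow_wave v)"
  using slow_wave_derivative by (meson continuous_at_imp_continuous_on has_vector_derivative_continuous)

lemma slow_wave_C_ub: "slow_wave v \<in> C_ub J"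
proof (rule Lipschitz_C_ub)
  show "norm (slow_wave v t) \<le> norm v" for t by simp
  show "norm (slow_wave v y - slow_wave v x) \<le> (2 * norm v) * (y - x)" if "x \<le> y" for x y
  proof -
    have "norm (slow_wave v y - slow_wave v x) \<le> (2 * norm v) * \<bar>y - x\<bar>"
    proof (rule norm_diff_le_vector_derivative[of UNIV])
      show "norm ((1 + 2 * t / (1 + t\<^sup>2)) *\<^sub>R \<i> *\<^sub>C slow_wave v t) \<le> 2 * norm v" for t
      proof -
        have "\<bar>1 + q\<bar> \<le> 2" if "\<bar>q\<bar> \<le> 1" for q :: real using that by (simp add: abs_le_iff)
        from mult_right_mono[OF this[OF two_t_le[of t]] norm_ge_zero[of v]] show ?thesis
          by (simp add: norm_scaleC)
      qed
    qed (use slow_wave_derivative in auto)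
    then show ?thesis using that by simp
  qed
qed

text \<open>
  As \<open>ln (1 + t\<^sup>2)\<close> has the small derivative \<open>2 t / (1 + t\<^sup>2)\<close>, the function differs from the derivative of
  the bounded function \<open>-i exp (i (t + ln (1 + t\<^sup>2)))\<close> by one that vanishes at infinity.
\<close>

lemma slow_wave_Erg0:
  fixes v :: "'a::complex_banach"
  assumes J: "half_line J"
  shows "slow_wave v \<in> erg_class J {0} True"
proof (rule erg_classI[OF J])
  show fl: "slow_wave v \<in> L1loc J" by (rule continuous_L1loc[OF J slow_wave_continuous])
  fix \<omega> :: real assume "\<omega> \<in> {0}"
  then have w: "\<omega> = 0" by simp
  obtain F where F: "primitive_on J (slow_wave v) F" using L1loc_primitive[OF J fl] by blast
  define w where "w t = (2 * t / (1 + t\<^sup>2)) *\<^sub>R slow_wave v t" for t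
  have cw: "continuous_on UNIV w"
  proof -
    have "1 + t\<^sup>2 \<noteq> 0" for t :: real by (smt (verit) zero_le_power2)
    then show ?thesis unfolding w_def[abs_def] by (intro continuous_intros slow_wave_continuous) auto
  qed
  have wl: "w \<in> L1loc J" by (rule continuous_L1loc[OF J continuous_on_subset[OF cw]]) simp
  have "(w \<longlongrightarrow> 0) at_infinity"
  proof (rule Lim_null_comparison)
    have "((\<lambda>t::real. 2 * inverse (norm t) * norm v) \<longlongrightarrow> 2 * 0 * norm v) at_infinity"
      by (intro tendsto_intros tendsto_inverse_0_at_top[OF filterlim_norm_at_top])
    then show "((\<lambda>t::real. 2 * inverse (norm t) * norm v) \<longlongrightarrow> 0) at_infinity" by simp
    show "\<forall>\<^sub>F t in at_infinity. norm (w t) \<le> 2 * inverse (norm t) * norm v"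
      unfolding eventually_at_infinity
    proof (intro exI[of _ 1] allI impI)
      fix t :: real assume "1 \<le> norm t"
      then have t: "\<bar>t\<bar> \<ge> 1" by simp
      have "\<bar>2 * t / (1 + t\<^sup>2)\<bar> = 2 * \<bar>t\<bar> / (1 + t\<^sup>2)" by (simp add: abs_mult)
      also have "\<dots> \<le> 2 * \<bar>t\<bar> / (\<bar>t\<bar> * \<bar>t\<bar>)"
        using t by (intro divide_left_mono) (auto simp: power2_eq_square[symmetric] add_pos_nonneg)
      also have "\<dots> = 2 * inverse \<bar>t\<bar>"
      proof -
        have "2 * a / (a * a) = 2 * inverse a" if "a \<noteq> 0" for a :: real using that by (simp add: divide_inverse)
        from this[of "\<bar>t\<bar>"] show ?thesis using t by fastforce
      qed
      finally show "norm (w t) \<le> 2 * inverse (norm t) * norm v" 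
        unfolding w_def norm_scaleR norm_slow_wave real_norm_def by (rule mult_right_mono[OF _ norm_ge_zero])
    qed
  qed
  then have wE: "w \<in> erg_class J {0} True" by (rule vanishing_erg_class[OF J cw])
  obtain W where W: "primitive_on J w W" using L1loc_primitive[OF J wl] by blast
  have mW: "mean_on J W 0" using erg_classD[OF J wE, of 0 W] W by auto
  have inc: "norm (F (x + T) - F x) \<le> 2 * norm v + norm (W (x + T) - W x)" if x: "x \<in> J" and T: "T \<ge> 0" for x T
  proof -
    have "((\<lambda>t. slow_wave v t + w t) has_integral (- \<i> *\<^sub>C slow_wave v (x + T)) - (- \<i> *\<^sub>C slow_wave v x)) {x..x+T}"
    proof (rule fundamental_theorem_of_calculus)
      fix t
      from bounded_linear.has_vector_derivative[OF scaleC.bounded_linear_right slow_wave_derivative, of "- \<i>" v t]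
      have "((\<lambda>t. - \<i> *\<^sub>C slow_wave v t) has_vector_derivative (1 + 2 * t / (1 + t\<^sup>2)) *\<^sub>R slow_wave v t) (at t)"
        by (simp add: scaleC.scaleR_right scaleC_scaleC)
      then show "((\<lambda>t. - \<i> *\<^sub>C slow_wave v t) has_vector_derivative slow_wave v t + w t) (at t within {x..x+T})"
        by (simp add: w_def scaleR_add_left has_vector_derivative_at_within)
    qed (use T in simp)
    from has_integral_diff[OF this primitive_onD[OF W x, of "x + T"]]
    have "F (x + T) - F x = (- \<i> *\<^sub>C slow_wave v (x + T)) - (- \<i> *\<^sub>C slow_wave v x) - (W (x + T) - W x)"
      using T primitive_onD[OF F x, of "x + T"] by (simp add: has_integral_unique)
    then show ?thesis
      using norm_triangle_ineq4[of "(- \<i> *\<^sub>C slow_wave v (x + T)) - (- \<i> *\<^sub>C slow_wave v x)" "W (x + T) - W x"]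
        norm_triangle_ineq4[of "- \<i> *\<^sub>C slow_wave v (x + T)" "- \<i> *\<^sub>C slow_wave v x"] by (simp add: norm_scaleC)
  qed
  have "mean_on J F 0"
    unfolding mean_on_def
  proof (intro allI impI)
    fix e :: real assume e: "e > 0"
    then have "e / 2 > 0" by simp
    then obtain T0 where T0: "T0 > 0" "\<And>T x. T \<ge> T0 \<Longrightarrow> x \<in> J \<Longrightarrow> norm (W (x + T) - W x - T *\<^sub>R 0) \<le> e / 2 * T"
      using mW unfolding mean_on_def by metis
    show "\<exists>T0>0. \<forall>T\<ge>T0. \<forall>x\<in>J. norm (F (x + T) - F x - T *\<^sub>R 0) \<le> e * T"
    proof (intro exI[of _ "max T0 (4 * norm v / e)"] conjI allI impI ballI)
      show "max T0 (4 * norm v / e) > 0" using T0(1) by simp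
      fix T x assume T: "max T0 (4 * norm v / e) \<le> T" and x: "x \<in> J"
      have T': "T \<ge> T0" "T \<ge> 0" "4 * norm v \<le> e * T" using T T0(1) e by (auto simp: divide_le_eq mult.commute)
      show "norm (F (x + T) - F x - T *\<^sub>R 0) \<le> e * T" using inc[OF x T'(2)] T0(2)[OF T'(1) x] T'(3) by simp
    qed
  qed
  then show "\<exists>G m. primitive_on J (modulate \<omega> (slow_wave v)) G \<and> (True \<longrightarrow> m = 0) \<and> mean_on J G m"
    using F w by auto
qed

text \<open>
  Otherwise \<open>g(t) = exp (i ln (1 + t\<^sup>2))\<close> would have a mean \<open>m\<close>, and as \<open>g\<close> varies slowly, it would come
  close to \<open>m\<close>; but it takes the values \<open>1\<close> and \<open>-1\<close> at arbitrarily large arguments.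
\<close>

lemma slow_wave_not_TErg:
  fixes v :: "'a::complex_banach"
  assumes J: "half_line J" and v: "norm v = 1"
  shows "slow_wave v \<notin> erg_class J UNIV False"
proof
  assume f: "slow_wave v \<in> erg_class J UNIV False"
  define g where "g t = wave 1 (ln (1 + t\<^sup>2)) *\<^sub>C v" for t
  have g: "modulate (-1) (slow_wave v) = g"
  proof
    fix t
    have eq: "wave (-1) t * (wave 1 t * wave 1 (ln (1 + t\<^sup>2))) = wave 1 (ln (1 + t\<^sup>2))"
      using wave_minus[of 1 t] by (simp add: mult.assoc[symmetric])
    show "modulate (-1) (slow_wave v) t = g t"
      unfolding modulate_wave slow_wave_def g_def scaleC_scaleC wave_add by (simp only: eq)
  qed
  have gd: "(g has_vector_derivative (2 * t / (1 + t\<^sup>2)) *\<^sub>R (\<i> * wave 1 (ln (1 + t\<^sup>2))) *\<^sub>C v) (at t)" for t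
    unfolding g_def[abs_def] by (rule wave_compose_derivative[OF ln_derivative])
  have cg: "continuous_on S g" for S
    using gd by (meson continuous_at_imp_continuous_on has_vector_derivative_continuous)
  obtain G where G: "primitive_on J g G" using L1loc_primitive[OF J continuous_L1loc[OF J cg]] by blast
  obtain m where m: "mean_on J G m" using erg_classD[OF J f, of "-1" G] G g by auto
  have "(1/4::real) > 0" by simp
  then obtain T where T: "T > 0" "\<And>x. x \<in> J \<Longrightarrow> norm (G (x + T) - G x - T *\<^sub>R m) \<le> 1/4 * T"
    using m unfolding mean_on_def by (metis order_refl)
  \<comment> \<open>\<open>g\<close> varies by at most \<open>2 T / x\<close> on \<open>[x, x + T]\<close>, so \<open>g x\<close> is close to its mean over this interval, hence to \<open>m\<close>\<close>
  have close: "norm (g x - m) \<le> 1/2" if x: "x \<in> J" "x \<ge> 8 * T" for x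
  proof -
    have x0: "x > 0" using x T(1) by linarith
    have step: "norm (g y - g x) \<le> 1/4" if y: "y \<in> {x..x+T}" for y
    proof -
      have "norm (g y - g x) \<le> (2 / x) * \<bar>y - x\<bar>"
      proof (rule norm_diff_le_vector_derivative[of "{x..y}"])
        fix t assume t: "t \<in> {x..y}"
        show "(g has_vector_derivative (2 * t / (1 + t\<^sup>2)) *\<^sub>R (\<i> * wave 1 (ln (1 + t\<^sup>2))) *\<^sub>C v) (at t within {x..y})"
          by (rule has_vector_derivative_at_within[OF gd])
        have "\<bar>2 * t / (1 + t\<^sup>2)\<bar> = 2 * t / (1 + t\<^sup>2)" using t x0 by simp
        also have "\<dots> \<le> 2 * t / (t * t)"
          using t x0 by (intro divide_left_mono) (auto simp: power2_eq_square[symmetric] add_pos_nonneg)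
        also have "\<dots> = 2 / t" using t x0 by simp
        also have "\<dots> \<le> 2 / x" using t x0 by (intro divide_left_mono) auto
        finally show "norm ((2 * t / (1 + t\<^sup>2)) *\<^sub>R (\<i> * wave 1 (ln (1 + t\<^sup>2))) *\<^sub>C v) \<le> 2 / x"
          by (simp add: norm_scaleC norm_mult v)
      qed (use y in auto)
      also have "\<dots> \<le> (2 / x) * T" using y x0 by (intro mult_left_mono) auto
      also have "\<dots> \<le> 1/4" using x(2) x0 by (simp add: divide_le_eq)
      finally show ?thesis .
    qed
    have "((\<lambda>y. g y - g x) has_integral (G (x + T) - G x) - T *\<^sub>R g x) {x..x+T}"
      using has_integral_diff[OF primitive_onD[OF G x(1), of "x + T"] has_integral_const_real[of "g x" x "x + T"]] T(1) by simp
    then have "norm ((G (x + T) - G x) - T *\<^sub>R g x) = norm (integral {x..x+T} (\<lambda>y. g y - g x))" by (simp add: integral_unique)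
    also have "\<dots> \<le> 1/4 * (x + T - x)"
      by (rule integral_bound) (use T(1) step in \<open>auto intro!: continuous_intros cg\<close>)
    finally have 1: "norm ((G (x + T) - G x) - T *\<^sub>R g x) \<le> 1/4 * T" by simp
    have eq: "T *\<^sub>R (g x - m) = (G (x + T) - G x - T *\<^sub>R m) - ((G (x + T) - G x) - T *\<^sub>R g x)" by (simp add: scaleR_diff_right)
    have "T * norm (g x - m) = norm (T *\<^sub>R (g x - m))" using T(1) by simp
    also have "\<dots> \<le> T * (1/2)"
      unfolding eq using norm_triangle_ineq4[of "G (x + T) - G x - T *\<^sub>R m" "(G (x + T) - G x) - T *\<^sub>R g x"] 1 T(2)[OF x(1)] by simp
    finally show ?thesis by (rule mult_left_le_imp_le) (rule T(1))
  qed
  obtain X where X: "X \<in> J" "X \<ge> max 1 (8 * T)" using half_line_ex_large[OF J] by blast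
  obtain n :: nat where n: "ln (1 + X\<^sup>2) \<le> real n" using real_arch_simple by blast
  have hits: "\<exists>x\<in>J. x \<ge> 8 * T \<and> g x = wave 1 a *\<^sub>C v" if a: "a \<ge> real n" for a
  proof -
    define x where "x = sqrt (exp a - 1)"
    have "1 + X\<^sup>2 = exp (ln (1 + X\<^sup>2))" by (simp add: add_pos_nonneg)
    also have "\<dots> \<le> exp a" using n a by simp
    finally have e: "X\<^sup>2 \<le> exp a - 1" by simp
    then have "X \<le> x" unfolding x_def by (rule real_le_rsqrt)
    moreover have "x\<^sup>2 = exp a - 1" unfolding x_def using e by (intro real_sqrt_pow2) (meson order_trans zero_le_power2)
    then have "ln (1 + x\<^sup>2) = a" by simp
    ultimately show ?thesis using X half_lineD[OF J X(1)] by (intro bexI[of _ x]) (auto simp: g_def)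
  qed
  have a: "2 * pi * real n \<ge> real n" using pi_gt3 by (simp add: mult_le_cancel_right1)
  have w1: "wave 1 (2 * pi * real n) = 1"
    using exp_of_nat2_mult[of "\<i> * pi" n] by (simp add: wave_def mult_ac exp_of_nat_mult)
  obtain x where x: "x \<in> J" "x \<ge> 8 * T" "g x = v" using hits[OF a] by (auto simp: w1)
  have "2 * pi * real n + pi \<ge> real n" using a pi_gt_zero by linarith
  from hits[OF this] obtain y where y: "y \<in> J" "y \<ge> 8 * T" "g y = - v"
    by (auto simp: wave_add_pi w1 scaleC.minus_left)
  have "norm (v - m) \<le> 1/2" "norm (- v - m) \<le> 1/2" using close[OF x(1,2)] close[OF y(1,2)] x(3) y(3) by auto
  moreover have "norm (2 *\<^sub>R v) \<le> norm (v - m) + norm (- v - m)"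
    using norm_triangle_ineq4[of "v - m" "- v - m"] by (simp add: scaleR_2)
  ultimately show False using v by simp
qed

section \<open>Strictness of the inclusions\<close>

lemma continuous_on_diff_quot_funpow:
  fixes Q :: "real \<Rightarrow> 'a::real_normed_vector"
  assumes "continuous_on UNIV Q"
  shows "continuous_on UNIV ((diff_quot h ^^ n) Q)"
proof (induction n)
  case (Suc n)
  have "continuous_on UNIV (\<lambda>t. (diff_quot h ^^ n) Q (t + h))"
    by (rule continuous_on_compose2[OF Suc]) (auto intro!: continuous_intros)
  then have "continuous_on UNIV (\<lambda>t. (1 / h) *\<^sub>R ((diff_quot h ^^ n) Q (t + h) - (diff_quot h ^^ n) Q t))"
    using Suc by (intro continuous_on_scaleR continuous_on_const continuous_on_diff)
  then show ?case by (simp add: diff_quot_def[abs_def])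
qed (simp add: assms)

lemma osc_chain_not_C_ub:
  fixes v :: "'a::complex_banach"
  assumes J: "half_line J" and v: "norm v = 1"
  shows "osc_chain 2 v (Suc 0) \<notin> C_ub J"
proof
  assume "osc_chain 2 v (Suc 0) \<in> C_ub J"
  from C_ub_continuous_on(1)[OF J this derivative_chain_continuous[OF derivative_chain_osc]]
  obtain B where B: "\<And>t. t \<in> J \<Longrightarrow> norm (osc_chain 2 v (Suc 0) t) \<le> B" unfolding bounded_iff by blast
  obtain t where "t \<in> J" "norm (osc_chain 2 v (Suc 0) t) > B"
    using diff_quot_osc_unbounded[OF J v, of 0] by auto
  then show False using B[of t] by simp
qed

text \<open>
  Applying \<open>M\<^sub>h\<close> repeatedly to a derivative of the example yields a difference quotient of its first derivative.
  Membership would make the average of an ergodic function unbounded.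
\<close>

lemma osc_chain_not_in_Mcl:
  fixes v :: "'a::complex_banach"
  assumes J: "half_line J" and v: "norm v = 1" and \<Omega>: "0 \<in> \<Omega>"
  shows "osc_chain 2 v (n + 2) \<notin> (Mcl J ^^ n) (erg_class J \<Omega> z)"
proof
  assume *: "osc_chain 2 v (n + 2) \<in> (Mcl J ^^ n) (erg_class J \<Omega> z)"
  obtain h where h: "h > 0" and u: "\<And>B. \<exists>t\<in>J. norm ((diff_quot h ^^ Suc n) (osc_chain 2 v (Suc 0)) t) > B"
    using diff_quot_osc_unbounded[OF J v, of "Suc n"] by blast
  have eq: "M_avg h ((M_avg h ^^ n) (osc_chain 2 v (n + 2))) = (diff_quot h ^^ Suc n) (osc_chain 2 v (Suc 0))"
    using M_avg_funpow_derivative_chain[OF derivative_chain_osc[of 2 v] h, of "Suc n" "Suc 0"] by simp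
  obtain B where B: "\<And>t. t \<in> J \<Longrightarrow> norm ((diff_quot h ^^ Suc n) (osc_chain 2 v (Suc 0)) t) \<le> B"
    using erg_class_M_avg_bounded[OF J Mcl_funpow_M_avg[OF * h] \<Omega> h] unfolding eq by blast
  obtain t where "t \<in> J" "norm ((diff_quot h ^^ Suc n) (osc_chain 2 v (Suc 0)) t) > B" using u by blast
  then show False using B[of t] by simp
qed

lemma osc_chain_not_in_Mcl_C_ub:
  fixes v :: "'a::complex_banach"
  assumes J: "half_line J" and v: "norm v = 1"
  shows "osc_chain 1 v (n + 2) \<notin> (Mcl J ^^ Suc n) (C_ub J)"
proof
  assume *: "osc_chain 1 v (n + 2) \<in> (Mcl J ^^ Suc n) (C_ub J)"
  let ?D = "\<lambda>h. (diff_quot h ^^ Suc n) (osc_chain 1 v (Suc 0))"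
  obtain h where h: "h > 0" and u: "\<not> uniformly_continuous_on J (?D h)"
    using diff_quot_osc_not_uniformly_continuous[OF J v, of "Suc n"] by blast
  have "(M_avg h ^^ Suc n) (osc_chain 1 v (n + 2)) = ?D h"
    using M_avg_funpow_derivative_chain[OF derivative_chain_osc[of 1 v] h, of "Suc n" "Suc 0"] by simp
  then have "?D h \<in> C_ub J" using Mcl_funpow_M_avg[OF * h] by simp
  moreover have "continuous_on J (?D h)"
    by (rule continuous_on_subset[OF continuous_on_diff_quot_funpow[OF derivative_chain_continuous[OF derivative_chain_osc]]]) simp
  ultimately show False using C_ub_continuous_on(2)[OF J] u by blast
qed

lemma funpow_plus_2: "(f ^^ (n + 2)) x = (f ^^ n) (f (f x))"
  by (simp only: funpow_add comp_apply numeral_2_eq_2 funpow.simps id_apply)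

lemma erg_class_subset_Mcl_funpow:
  assumes J: "half_line J" and \<Omega>: "0 \<in> \<Omega>"
  shows "(Mcl J ^^ n) (erg_class J \<Omega> z) \<subseteq> (Mcl J ^^ (n + 2)) (erg_class J \<Omega> z \<inter> C_ub J)"
  unfolding funpow_plus_2 by (rule Mcl_funpow_mono[OF erg_class_subset_Mcl_Mcl[OF J \<Omega>]])

text \<open>
  The derivative of order \<open>n\<close> of the example with phase \<open>e\<^sup>2\<^sup>t\<close> belongs to the \<open>n\<close>-fold extension of the bounded
  uniformly continuous class, but not to the \<open>(n - 2)\<close>-fold extension of the whole class.  The derivative of
  order \<open>n + 2\<close> of the example with phase \<open>e\<^sup>t\<close> belongs to the \<open>n\<close>-fold extension of the whole class, but not to
  the \<open>(n + 1)\<close>-fold extension of the bounded uniformly continuous class.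
\<close>

lemma
  fixes v :: "'a::complex_banach" and z :: bool
  assumes J: "half_line J" and v: "norm v = 1" and \<Omega>: "0 \<in> \<Omega>"
  defines "A \<equiv> (erg_class J \<Omega> z :: (real \<Rightarrow> 'a) set)"
  shows erg_class_ub_psubset: "A \<inter> C_ub J \<subset> Mcl J (A \<inter> C_ub J)"
    and Mcl_erg_class_ub_psubset: "Mcl J (A \<inter> C_ub J) \<subset> A"
    and Mcl_funpow_erg_class_psubset: "(Mcl J ^^ n) A \<subset> (Mcl J ^^ (n + 2)) (A \<inter> C_ub J)"
    and Mcl_funpow_erg_class_ub_psubset: "(Mcl J ^^ (n + 2)) (A \<inter> C_ub J) \<subset> (Mcl J ^^ (n + 1)) A"
proof -
  have sub: "Mcl J (A \<inter> C_ub J) \<subseteq> A" unfolding A_def by (rule Mcl_erg_class_ub_subset[OF J])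
  have osc1: "osc_chain 1 v (n + 2) \<in> (Mcl J ^^ n) A" for n
    using osc_chain_2_in_Mcl[OF J, of v n \<Omega>] Mcl_funpow_mono[where A="erg_class J \<Omega> True" and B=A and J=J and n=n] erg_class_mono[of \<Omega> \<Omega> z True J]
    unfolding A_def by blast
  have osc1': "osc_chain 1 v (n + 2) \<notin> (Mcl J ^^ Suc n) (A \<inter> C_ub J)" for n
    using osc_chain_not_in_Mcl_C_ub[OF J v, of n] Mcl_funpow_mono[OF Int_lower2[of A "C_ub J"]] by blast
  have osc2: "osc_chain 2 v n \<in> (Mcl J ^^ n) (A \<inter> C_ub J)" for n
    unfolding A_def by (rule osc_chain_in_Mcl[OF J])
  show "A \<inter> C_ub J \<subset> Mcl J (A \<inter> C_ub J)"
    using erg_class_ub_subset_Mcl[OF J, of \<Omega> z] osc2[of "Suc 0"] osc_chain_not_C_ub[OF J v] unfolding A_def by auto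
  show "Mcl J (A \<inter> C_ub J) \<subset> A"
    using sub osc1[of 0] osc1'[of 0] by auto
  show "(Mcl J ^^ n) A \<subset> (Mcl J ^^ (n + 2)) (A \<inter> C_ub J)"
    using erg_class_subset_Mcl_funpow[OF J \<Omega>, of n z] osc2[of "n + 2"] osc_chain_not_in_Mcl[OF J v \<Omega>, of n z]
    unfolding A_def by blast
  have "(Mcl J ^^ (n + 2)) (A \<inter> C_ub J) \<subseteq> (Mcl J ^^ (n + 1)) A"
    using Mcl_funpow_mono[OF sub, where J=J and n="Suc n"] by (simp add: funpow_Suc_right funpow_add numeral_2_eq_2 del: funpow.simps)
  then show "(Mcl J ^^ (n + 2)) (A \<inter> C_ub J) \<subset> (Mcl J ^^ (n + 1)) A"
    using osc1[of "n + 1"] osc1'[of "n + 1"] by auto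
qed

lemma dist_of_fun_psubset:
  fixes v :: "'a::complex_banach"
  assumes v: "v \<noteq> 0" and S: "S \<subseteq> L1loc UNIV" and sub: "dist_of_fun ` S \<subseteq> Dist_cl (erg_class UNIV \<Omega> z \<inter> C_ub UNIV)"
  shows "(dist_of_fun ` S :: ((real \<Rightarrow> complex) \<Rightarrow> 'a) set) \<subset> Dist_cl (erg_class UNIV \<Omega> z \<inter> C_ub UNIV)"
proof (rule psubsetI[OF sub notI])
  assume "dist_of_fun ` S = Dist_cl (erg_class UNIV \<Omega> z \<inter> C_ub UNIV)"
  then have "delta v \<in> dist_of_fun ` S" using delta_Dist_cl[of v \<Omega> z] by simp
  then obtain f where f: "f \<in> S" "delta v = dist_of_fun f" by (rule imageE)
  from delta_not_fun[OF subsetD[OF S f(1)] v] f(2) show False by simp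
qed

lemma Mcl_funpow_L1loc: "A \<subseteq> L1loc J \<Longrightarrow> (Mcl J ^^ n) A \<subseteq> L1loc J"
  by (cases n) (auto simp: Mcl_iff)

lemma
  fixes v :: "'a::complex_banach" and z :: bool
  assumes v: "v \<noteq> 0" and \<Omega>: "0 \<in> \<Omega>"
  defines "A \<equiv> (erg_class UNIV \<Omega> z :: (real \<Rightarrow> 'a) set)"
  shows dist_of_fun_Mcl_erg_class_ub_psubset: "dist_of_fun ` (Mcl UNIV ^^ n) (A \<inter> C_ub UNIV) \<subset> Dist_cl (A \<inter> C_ub UNIV)"
    and dist_of_fun_Mcl_erg_class_psubset: "dist_of_fun ` (Mcl UNIV ^^ n) A \<subset> Dist_cl (A \<inter> C_ub UNIV)"
proof -
  have A: "A \<subseteq> L1loc UNIV" by (auto simp: A_def erg_class_L1loc)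
  have ub: "dist_of_fun ` (Mcl UNIV ^^ n) (A \<inter> C_ub UNIV) \<subseteq> Dist_cl (A \<inter> C_ub UNIV)" for n
    unfolding A_def Dist_cl_erg_class_ub[OF \<Omega>] using dist_of_fun_Mcl_erg_class[OF \<Omega>] by blast
  show "dist_of_fun ` (Mcl UNIV ^^ n) (A \<inter> C_ub UNIV) \<subset> Dist_cl (A \<inter> C_ub UNIV)"
    using A unfolding A_def by (intro dist_of_fun_psubset[OF v Mcl_funpow_L1loc ub[unfolded A_def]]) auto
  have "(Mcl UNIV ^^ n) A \<subseteq> (Mcl UNIV ^^ (n + 2)) (A \<inter> C_ub UNIV)"
    unfolding A_def by (rule erg_class_subset_Mcl_funpow[OF half_line_UNIV \<Omega>])
  from order_trans[OF image_mono[OF this] ub]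
  show "dist_of_fun ` (Mcl UNIV ^^ n) A \<subset> Dist_cl (A \<inter> C_ub UNIV)"
    using A unfolding A_def by (intro dist_of_fun_psubset[OF v Mcl_funpow_L1loc])
qed

lemma slow_wave_not_in_Mcl:
  fixes v :: "'a::complex_banach"
  assumes J: "half_line J" and v: "norm v = 1"
  shows "slow_wave v \<notin> (Mcl J ^^ n) (erg_class J UNIV False)"
proof
  assume *: "slow_wave v \<in> (Mcl J ^^ n) (erg_class J UNIV False)"
  have l: "slow_wave v \<in> L1loc J" by (rule continuous_L1loc[OF J slow_wave_continuous])
  obtain F where F: "primitive_on J (slow_wave v) F" using L1loc_primitive[OF J l] by blast
  have "norm (F y - F x) \<le> norm v * (y - x)" if "x \<in> J" "x \<le> y" for x y
    by (rule bounded_continuous_Lipschitz_primitive[OF J slow_wave_continuous _ F that]) simp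
  from Mcl_funpow_erg_class_Lipschitz[OF J * l F this] show False using slow_wave_not_TErg[OF J v] by blast
qed

lemma C_ub_dist_of_fun_Dist_cl:
  assumes \<Omega>: "0 \<in> \<Omega>"
  shows "dist_of_fun ` C_ub UNIV \<inter> Dist_cl (erg_class UNIV \<Omega> z) = dist_of_fun ` (erg_class UNIV \<Omega> z \<inter> C_ub UNIV)"
proof (intro equalityI subsetI)
  fix T assume "T \<in> dist_of_fun ` C_ub UNIV \<inter> Dist_cl (erg_class UNIV \<Omega> z)"
  then obtain f where f: "f \<in> C_ub UNIV" "T = dist_of_fun f" "dist_of_fun f \<in> Dist_cl (erg_class UNIV \<Omega> z)" by blast
  from f C_ub_dist_of_fun_erg_class[OF f(1,3)] show "T \<in> dist_of_fun ` (erg_class UNIV \<Omega> z \<inter> C_ub UNIV)" by blast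
next
  fix T assume "T \<in> dist_of_fun ` (erg_class UNIV \<Omega> z \<inter> C_ub UNIV)"
  then obtain f where f: "f \<in> erg_class UNIV \<Omega> z \<inter> C_ub UNIV" "T = dist_of_fun f" by blast
  have "dist_of_fun f \<in> Dist_cl (erg_class UNIV \<Omega> z)"
    by (rule dist_of_fun_Mcl_erg_class[OF \<Omega>, where n=0]) (use f(1) in simp)
  then show "T \<in> dist_of_fun ` C_ub UNIV \<inter> Dist_cl (erg_class UNIV \<Omega> z)" using f by blast
qed

lemma ergodic_classes:
  assumes J: "half_line J" and A: "A \<in> {Erg J, Erg0 J, TErg0 J, TErg J}"
  shows "\<exists>\<Omega> z. 0 \<in> \<Omega> \<and> A = erg_class J \<Omega> z"
  using A unfolding Erg_eq[OF J] Erg0_eq[OF J] TErg0_eq[OF J] TErg_eq[OF J] by auto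

theorem proposition7p1:
  fixes J :: "real set"
  assumes X_nontrivial: "(UNIV :: 'a::complex_banach set) \<noteq> {0}"
    and J_form: "J = UNIV \<or> (\<exists>\<alpha>. J = {\<alpha><..} \<or> J = {\<alpha>..})"
  shows "(TErg J \<inter> C_ub J :: (real \<Rightarrow> 'a) set) \<subset> Erg J \<inter> C_ub J \<and>
    (TErg0 J \<inter> C_ub J :: (real \<Rightarrow> 'a) set) \<subset> Erg0 J \<inter> C_ub J \<and>
    (\<forall>A \<in> {Erg J, Erg0 J, TErg0 J, TErg J :: (real \<Rightarrow> 'a) set}.
        A \<inter> C_ub J \<subset> Mcl J (A \<inter> C_ub J) \<and>
        Mcl J (A \<inter> C_ub J) \<subset> A \<and>
        (\<forall>n. (Mcl J ^^ n) A \<subset> (Mcl J ^^ (n + 2)) (A \<inter> C_ub J) \<and>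
             (Mcl J ^^ (n + 2)) (A \<inter> C_ub J) \<subset> (Mcl J ^^ (n + 1)) A)) \<and>
    dist_of_fun ` (TErg UNIV \<inter> C_ub UNIV :: (real \<Rightarrow> 'a) set)
      \<subset> Dist_cl (Erg UNIV \<inter> C_ub UNIV) \<and>
    dist_of_fun ` (TErg0 UNIV \<inter> C_ub UNIV :: (real \<Rightarrow> 'a) set)
      \<subset> Dist_cl (Erg0 UNIV \<inter> C_ub UNIV) \<and>
    (\<forall>A \<in> {Erg UNIV, Erg0 UNIV, TErg0 UNIV, TErg UNIV :: (real \<Rightarrow> 'a) set}.
        Dist_cl (A \<inter> C_ub UNIV) = Dist_cl A \<and>
        (\<forall>n. dist_of_fun ` (Mcl UNIV ^^ n) (A \<inter> C_ub UNIV) \<subset> Dist_cl (A \<inter> C_ub UNIV) \<and>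
             dist_of_fun ` (Mcl UNIV ^^ n) A \<subset> Dist_cl (A \<inter> C_ub UNIV))) \<and>
    dist_of_fun ` (C_ub UNIV :: (real \<Rightarrow> 'a) set) \<inter> Dist_cl (TErg UNIV)
      = dist_of_fun ` (TErg UNIV \<inter> C_ub UNIV) \<and>
    dist_of_fun ` (C_ub UNIV :: (real \<Rightarrow> 'a) set) \<inter> Dist_cl (TErg0 UNIV)
      = dist_of_fun ` (TErg0 UNIV \<inter> C_ub UNIV) \<and>
    \<not> (Erg J \<inter> C_ub J :: (real \<Rightarrow> 'a) set) \<subseteq> (\<Union>n. (Mcl J ^^ n) (TErg J)) \<and>
    (\<Union>n. (Mcl J ^^ n) (TErg J :: (real \<Rightarrow> 'a) set)) = (\<Union>n. (Mcl J ^^ n) (TErg J \<inter> C_ub J))"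
  proof -
  have J: "half_line J" using J_form by (simp add: half_line_def)
  obtain x :: 'a where "x \<noteq> 0" using X_nontrivial by blast
  then have "norm ((1 / norm x) *\<^sub>R x) = 1" by simp
  then obtain v :: 'a where v: "norm v = 1" by blast
  then have v0: "v \<noteq> 0" by auto
  note eqs = Erg_eq[OF J] Erg0_eq[OF J] TErg_eq[OF J] TErg0_eq[OF J]
  note eqsU = Erg_eq[OF half_line_UNIV] Erg0_eq[OF half_line_UNIV] TErg_eq[OF half_line_UNIV] TErg0_eq[OF half_line_UNIV]
  have mono: "erg_class J UNIV z \<subseteq> erg_class J {0} z" "erg_class J {0} True \<subseteq> erg_class J {0} z"
    "erg_class J UNIV z \<subseteq> (erg_class J UNIV False :: (real \<Rightarrow> 'a) set)" for J z
    by (rule erg_class_mono; simp)+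
  have slow_in: "slow_wave v \<in> erg_class J {0} z \<inter> C_ub J" for z
    using slow_wave_C_ub subsetD[OF mono(2) slow_wave_Erg0[OF J]] by (rule IntI[rotated])
  have ub: "erg_class J UNIV z \<inter> C_ub J \<subset> (erg_class J {0} z \<inter> C_ub J :: (real \<Rightarrow> 'a) set)" for z
  proof (rule psubsetI[OF Int_mono[OF mono(1) order_refl] notI])
    assume "erg_class J UNIV z \<inter> C_ub J = (erg_class J {0} z \<inter> C_ub J :: (real \<Rightarrow> 'a) set)"
    then have "slow_wave v \<in> erg_class J UNIV z" using slow_in[of z] by (metis IntD1)
    from subsetD[OF mono(3) this] show False using slow_wave_not_TErg[OF J v] by (rule notE[rotated])
  qed
  have chain: "\<forall>A \<in> {Erg J, Erg0 J, TErg0 J, TErg J :: (real \<Rightarrow> 'a) set}.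
        A \<inter> C_ub J \<subset> Mcl J (A \<inter> C_ub J) \<and>
        Mcl J (A \<inter> C_ub J) \<subset> A \<and>
        (\<forall>n. (Mcl J ^^ n) A \<subset> (Mcl J ^^ (n + 2)) (A \<inter> C_ub J) \<and>
             (Mcl J ^^ (n + 2)) (A \<inter> C_ub J) \<subset> (Mcl J ^^ (n + 1)) A)"
  proof
    fix A assume "A \<in> {Erg J, Erg0 J, TErg0 J, TErg J :: (real \<Rightarrow> 'a) set}"
    from ergodic_classes[OF J this] obtain \<Omega> z where "0 \<in> \<Omega>" and A: "A = erg_class J \<Omega> z"
      by (elim exE conjE) (rule that)
    note facts = erg_class_ub_psubset[OF J v \<open>0 \<in> \<Omega>\<close>] Mcl_erg_class_ub_psubset[OF J v \<open>0 \<in> \<Omega>\<close>]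
      Mcl_funpow_erg_class_psubset[OF J v \<open>0 \<in> \<Omega>\<close>] Mcl_funpow_erg_class_ub_psubset[OF J v \<open>0 \<in> \<Omega>\<close>]
    show "A \<inter> C_ub J \<subset> Mcl J (A \<inter> C_ub J) \<and>
        Mcl J (A \<inter> C_ub J) \<subset> A \<and>
        (\<forall>n. (Mcl J ^^ n) A \<subset> (Mcl J ^^ (n + 2)) (A \<inter> C_ub J) \<and>
             (Mcl J ^^ (n + 2)) (A \<inter> C_ub J) \<subset> (Mcl J ^^ (n + 1)) A)"
      unfolding A by (intro conjI allI facts)
  qed
  have dist: "\<forall>A \<in> {Erg UNIV, Erg0 UNIV, TErg0 UNIV, TErg UNIV :: (real \<Rightarrow> 'a) set}.
        Dist_cl (A \<inter> C_ub UNIV) = Dist_cl A \<and>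
        (\<forall>n. dist_of_fun ` (Mcl UNIV ^^ n) (A \<inter> C_ub UNIV) \<subset> Dist_cl (A \<inter> C_ub UNIV) \<and>
             dist_of_fun ` (Mcl UNIV ^^ n) A \<subset> Dist_cl (A \<inter> C_ub UNIV))"
  proof
    fix A assume "A \<in> {Erg UNIV, Erg0 UNIV, TErg0 UNIV, TErg UNIV :: (real \<Rightarrow> 'a) set}"
    from ergodic_classes[OF half_line_UNIV this] obtain \<Omega> z where \<Omega>: "0 \<in> \<Omega>" and A: "A = erg_class UNIV \<Omega> z"
      by (elim exE conjE) (rule that)
    show "Dist_cl (A \<inter> C_ub UNIV) = Dist_cl A \<and>
        (\<forall>n. dist_of_fun ` (Mcl UNIV ^^ n) (A \<inter> C_ub UNIV) \<subset> Dist_cl (A \<inter> C_ub UNIV) \<and>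
             dist_of_fun ` (Mcl UNIV ^^ n) A \<subset> Dist_cl (A \<inter> C_ub UNIV))"
      unfolding A
      by (intro conjI allI Dist_cl_erg_class_ub[OF \<Omega>] dist_of_fun_Mcl_erg_class_ub_psubset[OF v0 \<Omega>]
          dist_of_fun_Mcl_erg_class_psubset[OF v0 \<Omega>])
  qed
  have ub_dist: "dist_of_fun ` (erg_class UNIV UNIV z \<inter> C_ub UNIV :: (real \<Rightarrow> 'a) set)
      \<subset> Dist_cl (erg_class UNIV {0} z \<inter> C_ub UNIV)" for z
  proof (rule order.strict_trans1[OF image_mono[OF Int_mono[OF mono(1) order_refl]]])
    show "dist_of_fun ` (erg_class UNIV {0} z \<inter> C_ub UNIV :: (real \<Rightarrow> 'a) set) \<subset> Dist_cl (erg_class UNIV {0} z \<inter> C_ub UNIV)"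
      using dist_of_fun_Mcl_erg_class_ub_psubset[OF v0, of "{0}" 0 z] by simp
  qed
  have slow: "\<not> (Erg J \<inter> C_ub J :: (real \<Rightarrow> 'a) set) \<subseteq> (\<Union>n. (Mcl J ^^ n) (TErg J))"
    unfolding eqs
  proof
    assume "(erg_class J {0} False \<inter> C_ub J :: (real \<Rightarrow> 'a) set) \<subseteq> (\<Union>n. (Mcl J ^^ n) (erg_class J UNIV False))"
    from subsetD[OF this slow_in] show False using slow_wave_not_in_Mcl[OF J v] by blast
  qed
  have union: "(\<Union>n. (Mcl J ^^ n) (TErg J :: (real \<Rightarrow> 'a) set)) = (\<Union>n. (Mcl J ^^ n) (TErg J \<inter> C_ub J))"
    unfolding eqs
  proof (intro equalityI UN_least)
    fix n
    show "(Mcl J ^^ n) (erg_class J UNIV False :: (real \<Rightarrow> 'a) set) \<subseteq> (\<Union>n. (Mcl J ^^ n) (erg_class J UNIV False \<inter> C_ub J))"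
      by (rule order_trans[OF erg_class_subset_Mcl_funpow[OF J UNIV_I]]) (rule UN_upper, rule UNIV_I)
    show "(Mcl J ^^ n) (erg_class J UNIV False \<inter> C_ub J :: (real \<Rightarrow> 'a) set) \<subseteq> (\<Union>n. (Mcl J ^^ n) (erg_class J UNIV False))"
      by (rule order_trans[OF Mcl_funpow_mono[OF Int_lower1]]) (rule UN_upper, rule UNIV_I)
  qed
  show ?thesis
  proof (intro conjI)
    show "(TErg J \<inter> C_ub J :: (real \<Rightarrow> 'a) set) \<subset> Erg J \<inter> C_ub J" unfolding eqs by (rule ub)
    show "(TErg0 J \<inter> C_ub J :: (real \<Rightarrow> 'a) set) \<subset> Erg0 J \<inter> C_ub J" unfolding eqs by (rule ub)
    show "dist_of_fun ` (TErg UNIV \<inter> C_ub UNIV :: (real \<Rightarrow> 'a) set) \<subset> Dist_cl (Erg UNIV \<inter> C_ub UNIV)"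
      unfolding eqsU by (rule ub_dist)
    show "dist_of_fun ` (TErg0 UNIV \<inter> C_ub UNIV :: (real \<Rightarrow> 'a) set) \<subset> Dist_cl (Erg0 UNIV \<inter> C_ub UNIV)"
      unfolding eqsU by (rule ub_dist)
    show "dist_of_fun ` (C_ub UNIV :: (real \<Rightarrow> 'a) set) \<inter> Dist_cl (TErg UNIV) = dist_of_fun ` (TErg UNIV \<inter> C_ub UNIV)"
      unfolding eqsU by (rule C_ub_dist_of_fun_Dist_cl[OF UNIV_I])
    show "dist_of_fun ` (C_ub UNIV :: (real \<Rightarrow> 'a) set) \<inter> Dist_cl (TErg0 UNIV) = dist_of_fun ` (TErg0 UNIV \<inter> C_ub UNIV)"
      unfolding eqsU by (rule C_ub_dist_of_fun_Dist_cl[OF UNIV_I])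
  qed (fact chain dist slow union)+
qed


end
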